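(* Let $\Omega,p,h,\gamma$ satisfy the standing assumptions listed in the context, fix $\varepsilon>0$, $m>0$, $\mu\ge0$, and for every $\delta\in(0,1]$ let $u_\delta\in\mathcal M_m^+$ be a minimizer of $I_{\mu,\delta}$ over $\mathcal M_m^+$. Put $d(x)=\operatorname{dist}(x,\partial\Omega)$ and assume: (i) there are constants $\delta_0\in(0,1]$, $c_*>0$, $\vartheta>0$, independent of $\delta$, such that $u_\delta(x)\ge c_*d(x)^\vartheta$ for a.e. $x\in\Omega$ and every $0<\delta\le\delta_0$; (ii) the function $\omega_\vartheta(x):=h(x)d(x)^{1-\vartheta\gamma(x)}$ belongs to $L^{p'(\cdot)}(\Omega)$. Then the functions $f_\delta(x)=h(x)(u_\delta(x)+\delta)^{-\gamma(x)}$, $0<\delta\le\delta_0$, are uniformly bounded in $X^*$; that is, there is a constant $C$ independent of $\delta$ such that $\left|\int_\Omega f_\delta\phi\,dx\right|\le C\|\phi\|$ for every $\phi\in X$ and every $0<\delta\le\delta_0$. Moreover, if $\delta_n\downarrow0$ and $u_{\delta_n}\to u$ a.e. in $\Omega$, then $u\ge c_*d^\vartheta>0$ a.e. in $\Omega$ and $$\int_\Omega h(x)(u_{\delta_n}+\delta_n)^{-\gamma(x)}\phi\,dx\to\int_\Omega h(x)u^{-\gamma(x)}\phi\,dx\qquad\text{for every }\phi\in X.$$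
   Context: Standing assumptions: $N\ge2$ and $\Omega\subset\mathbb R^N$ is a bounded domain with Lipschitz boundary. The exponent $p:\overline\Omega\to(1,\infty)$ satisfies $1<p^-\le p(x)\le p^+<\infty$, where $p^-=\min_{\overline\Omega}p$ and $p^+=\max_{\overline\Omega}p$, and is log-Hölder continuous: there is $C_{\log}>0$ with $|p(x)-p(y)|\le C_{\log}/\log(e+1/|x-y|)$ for all $x\ne y$ in $\overline\Omega$. Further $h\in L^\infty(\Omega)$, $h\ge0$ a.e., $h\not\equiv0$; and $\gamma\in C(\overline\Omega)$ with $0<\gamma^-\le\gamma(x)\le\gamma^+<1$ for all $x\in\overline\Omega$. Spaces: $L^{p(\cdot)}(\Omega)$ is the space of measurable $u$ with $\int_\Omega|u|^{p(x)}dx<\infty$, with the Luxemburg norm $\|u\|_{p(\cdot)}=\inf\{\tau>0:\int_\Omega|u/\tau|^{p(x)}dx\le1\}$; $p'(x)=p(x)/(p(x)-1)$. $W^{1,p(\cdot)}(\Omega)=\{u\in L^{p(\cdot)}(\Omega):|\nabla u|\in L^{p(\cdot)}(\Omega)\}$ with norm $\|u\|_{p(\cdot)}+\|\nabla u\|_{p(\cdot)}$; $X=W^{1,p(\cdot)}_0(\Omega)$ is the closure of $C_0^\infty(\Omega)$ in $W^{1,p(\cdot)}(\Omega)$, with the equivalent norm $\|u\|=\|\nabla u\|_{p(\cdot)}$; $X^*$ is its dual. A function $f$ is identified with the functional $\phi\mapsto\int_\Omega f\phi\,dx$. $X_+=\{u\in X:u\ge0\text{ a.e. in }\Omega\}$.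 Functionals: $\Phi_\varepsilon(x,\xi)=\frac{(\varepsilon^2+|\xi|^2)^{p(x)/2}-\varepsilon^{p(x)}}{p(x)}$ for $\xi\in\mathbb R^N$; $E_\varepsilon(u)=\int_\Omega\Phi_\varepsilon(x,\nabla u)\,dx$; $J(u)=\int_\Omega\frac{|u|^{p(x)}}{p(x)}dx$; $\mathcal M_m^+=\{u\in X_+:J(u)=m\}$. For $0<\delta\le1$ and $s\ge0$, $G_\delta(x,s)=\frac{(s+\delta)^{1-\gamma(x)}-\delta^{1-\gamma(x)}}{1-\gamma(x)}$, and $I_{\mu,\delta}(u)=E_\varepsilon(u)-\mu\int_\Omega h(x)G_\delta(x,u)\,dx$ for $u\in X_+$. *)

theory Defs
  imports "HOL-Analysis.Analysis"
begin

section \<open>Domains\<close>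

text \<open>Every boundary point has a neighbourhood in which \<open>\<Omega>\<close> is the strict subgraph, in some
  direction \<open>\<nu>\<close>, of a Lipschitz function on the hyperplane orthogonal to \<open>\<nu>\<close>.\<close>

definition lipschitz_boundary :: "'a::euclidean_space set \<Rightarrow> bool" where
  "lipschitz_boundary \<Omega> \<longleftrightarrow>
     (\<forall>z\<in>frontier \<Omega>. \<exists>r>0. \<exists>\<nu> g L. norm \<nu> = 1 \<and> L-lipschitz_on {y. y \<bullet> \<nu> = 0} g \<and>
        \<Omega> \<inter> ball z r = {x \<in> ball z r. x \<bullet> \<nu> < g (x - (x \<bullet> \<nu>) *\<^sub>R \<nu>)})"

definition bounded_lipschitz_domain :: "'a::euclidean_space set \<Rightarrow> bool" where
  "bounded_lipschitz_domain \<Omega> \<longleftrightarrow>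
     open \<Omega> \<and> connected \<Omega> \<and> \<Omega> \<noteq> {} \<and> bounded \<Omega> \<and> lipschitz_boundary \<Omega>"

definition bdry_dist :: "'a::euclidean_space set \<Rightarrow> 'a \<Rightarrow> real" where
  "bdry_dist \<Omega> x = infdist x (frontier \<Omega>)"

section \<open>Coefficients and exponents\<close>

definition variable_exponent :: "'a::euclidean_space set \<Rightarrow> ('a \<Rightarrow> real) \<Rightarrow> bool" where
  "variable_exponent \<Omega> p \<longleftrightarrow>
     (\<exists>pmin pmax. 1 < pmin \<and> (\<forall>x\<in>closure \<Omega>. pmin \<le> p x \<and> p x \<le> pmax))"

definition log_hoelder :: "'a::euclidean_space set \<Rightarrow> ('a \<Rightarrow> real) \<Rightarrow> bool" where
  "log_hoelder \<Omega> p \<longleftrightarrow>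
     (\<exists>C>0. \<forall>x\<in>closure \<Omega>. \<forall>y\<in>closure \<Omega>. x \<noteq> y \<longrightarrow>
        \<bar>p x - p y\<bar> \<le> C / ln (exp 1 + 1 / dist x y))"

definition conj_exponent :: "('a \<Rightarrow> real) \<Rightarrow> 'a \<Rightarrow> real" where
  "conj_exponent p x = p x / (p x - 1)"

definition singular_exponent :: "'a::euclidean_space set \<Rightarrow> ('a \<Rightarrow> real) \<Rightarrow> bool" where
  "singular_exponent \<Omega> \<gamma> \<longleftrightarrow> continuous_on (closure \<Omega>) \<gamma> \<and>
     (\<exists>gmin gmax. 0 < gmin \<and> gmax < 1 \<and> (\<forall>x\<in>closure \<Omega>. gmin \<le> \<gamma> x \<and> \<gamma> x \<le> gmax))"

definition Linfty :: "'a::euclidean_space set \<Rightarrow> ('a \<Rightarrow> real) set" where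
  "Linfty \<Omega> = {h \<in> borel_measurable (lebesgue_on \<Omega>). \<exists>C. AE x in lebesgue_on \<Omega>. \<bar>h x\<bar> \<le> C}"

section \<open>Variable exponent Lebesgue spaces\<close>

text \<open>Functions are defined on the whole space, but only their values on \<open>\<Omega>\<close> matter.
  They are not quotiented by almost everywhere equality.\<close>

definition modular :: "'a::euclidean_space set \<Rightarrow> ('a \<Rightarrow> real) \<Rightarrow> ('a \<Rightarrow> real) \<Rightarrow> ennreal" where
  "modular \<Omega> p u = (\<integral>\<^sup>+x. ennreal (\<bar>u x\<bar> powr p x) \<partial>lebesgue_on \<Omega>)"

definition Lpx :: "'a::euclidean_space set \<Rightarrow> ('a \<Rightarrow> real) \<Rightarrow> ('a \<Rightarrow> real) set" where
  "Lpx \<Omega> p = {u \<in> borel_measurable (lebesgue_on \<Omega>). modular \<Omega> p u < \<infinity>}"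

definition luxemburg_norm :: "'a::euclidean_space set \<Rightarrow> ('a \<Rightarrow> real) \<Rightarrow> ('a \<Rightarrow> real) \<Rightarrow> real" where
  "luxemburg_norm \<Omega> p u = Inf {\<tau>. 0 < \<tau> \<and> modular \<Omega> p (\<lambda>x. u x / \<tau>) \<le> 1}"

section \<open>Test functions and weak gradients\<close>

primrec Ck :: "nat \<Rightarrow> ('a::euclidean_space \<Rightarrow> real) \<Rightarrow> bool" where
  "Ck 0 f \<longleftrightarrow> continuous_on UNIV f"
| "Ck (Suc k) f \<longleftrightarrow> (\<forall>x. f differentiable (at x)) \<and>
     (\<forall>b\<in>Basis. Ck k (\<lambda>x. frechet_derivative f (at x) b))"

text \<open>Elements of \<open>C\<^sub>0\<^sup>\<infinity>(\<Omega>)\<close> are taken together with their extension by zero.\<close>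

definition test_functions :: "'a::euclidean_space set \<Rightarrow> ('a \<Rightarrow> real) set" where
  "test_functions \<Omega> = {\<phi>. (\<forall>k. Ck k \<phi>) \<and>
     compact (closure {x. \<phi> x \<noteq> 0}) \<and> closure {x. \<phi> x \<noteq> 0} \<subseteq> \<Omega>}"

definition has_weak_gradient ::
    "'a::euclidean_space set \<Rightarrow> ('a \<Rightarrow> real) \<Rightarrow> ('a \<Rightarrow> 'a) \<Rightarrow> bool" where
  "has_weak_gradient \<Omega> u G \<longleftrightarrow>
     (\<forall>K. compact K \<and> K \<subseteq> \<Omega> \<longrightarrow> u absolutely_integrable_on K \<and> G absolutely_integrable_on K) \<and>
     (\<forall>\<phi>\<in>test_functions \<Omega>. \<forall>b\<in>Basis.
        (\<integral>x. u x * frechet_derivative \<phi> (at x) b \<partial>lebesgue_on \<Omega>) =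
        - (\<integral>x. (G x \<bullet> b) * \<phi> x \<partial>lebesgue_on \<Omega>))"

text \<open>Weak gradients are unique almost everywhere, so nothing below depends on the choice.\<close>

definition weak_grad :: "'a::euclidean_space set \<Rightarrow> ('a \<Rightarrow> real) \<Rightarrow> 'a \<Rightarrow> 'a" where
  "weak_grad \<Omega> u = (SOME G. has_weak_gradient \<Omega> u G)"

section \<open>Variable exponent Sobolev spaces\<close>

definition W1px :: "'a::euclidean_space set \<Rightarrow> ('a \<Rightarrow> real) \<Rightarrow> ('a \<Rightarrow> real) set" where
  "W1px \<Omega> p = {u \<in> Lpx \<Omega> p. (\<exists>G. has_weak_gradient \<Omega> u G) \<and>
     (\<lambda>x. norm (weak_grad \<Omega> u x)) \<in> Lpx \<Omega> p}"

definition grad_norm :: "'a::euclidean_space set \<Rightarrow> ('a \<Rightarrow> real) \<Rightarrow> ('a \<Rightarrow> real) \<Rightarrow> real" where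
  "grad_norm \<Omega> p u = luxemburg_norm \<Omega> p (\<lambda>x. norm (weak_grad \<Omega> u x))"

definition W1px_norm :: "'a::euclidean_space set \<Rightarrow> ('a \<Rightarrow> real) \<Rightarrow> ('a \<Rightarrow> real) \<Rightarrow> real" where
  "W1px_norm \<Omega> p u = luxemburg_norm \<Omega> p u + grad_norm \<Omega> p u"

definition W1px0 :: "'a::euclidean_space set \<Rightarrow> ('a \<Rightarrow> real) \<Rightarrow> ('a \<Rightarrow> real) set" where
  "W1px0 \<Omega> p = {u \<in> W1px \<Omega> p.
     \<forall>e>0. \<exists>\<phi>\<in>test_functions \<Omega>. W1px_norm \<Omega> p (\<lambda>x. u x - \<phi> x) < e}"

section \<open>Functionals\<close>

definition Phi :: "('a \<Rightarrow> real) \<Rightarrow> real \<Rightarrow> 'a \<Rightarrow> 'a::euclidean_space \<Rightarrow> real" where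
  "Phi p \<epsilon> x \<xi> = ((\<epsilon>\<^sup>2 + (norm \<xi>)\<^sup>2) powr (p x / 2) - \<epsilon> powr p x) / p x"

definition energy :: "'a::euclidean_space set \<Rightarrow> ('a \<Rightarrow> real) \<Rightarrow> real \<Rightarrow> ('a \<Rightarrow> real) \<Rightarrow> real" where
  "energy \<Omega> p \<epsilon> u = (\<integral>x. Phi p \<epsilon> x (weak_grad \<Omega> u x) \<partial>lebesgue_on \<Omega>)"

definition mass :: "'a::euclidean_space set \<Rightarrow> ('a \<Rightarrow> real) \<Rightarrow> ('a \<Rightarrow> real) \<Rightarrow> real" where
  "mass \<Omega> p u = (\<integral>x. \<bar>u x\<bar> powr p x / p x \<partial>lebesgue_on \<Omega>)"

definition mass_constraint ::
    "'a::euclidean_space set \<Rightarrow> ('a \<Rightarrow> real) \<Rightarrow> real \<Rightarrow> ('a \<Rightarrow> real) set" where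
  "mass_constraint \<Omega> p m =
     {u \<in> W1px0 \<Omega> p. (AE x in lebesgue_on \<Omega>. 0 \<le> u x) \<and> mass \<Omega> p u = m}"

definition G_reg :: "('a \<Rightarrow> real) \<Rightarrow> real \<Rightarrow> 'a \<Rightarrow> real \<Rightarrow> real" where
  "G_reg \<gamma> \<delta> x s = ((s + \<delta>) powr (1 - \<gamma> x) - \<delta> powr (1 - \<gamma> x)) / (1 - \<gamma> x)"

definition I_reg ::
    "'a::euclidean_space set \<Rightarrow> ('a \<Rightarrow> real) \<Rightarrow> ('a \<Rightarrow> real) \<Rightarrow> ('a \<Rightarrow> real) \<Rightarrow>
     real \<Rightarrow> real \<Rightarrow> real \<Rightarrow> ('a \<Rightarrow> real) \<Rightarrow> real" where
  "I_reg \<Omega> p h \<gamma> \<epsilon> \<mu> \<delta> u =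
     energy \<Omega> p \<epsilon> u - \<mu> * (\<integral>x. h x * G_reg \<gamma> \<delta> x (u x) \<partial>lebesgue_on \<Omega>)"

end

theory Submission
  imports Defs
begin

text \<open>
  The lower bound on \<open>u \<delta>\<close> gives \<open>\<bar>h * (u \<delta> + \<delta>) powr (- \<gamma>) * \<phi>\<bar> \<le> const * \<bar>\<omega>\<bar> * (\<bar>\<phi>\<bar> / d)\<close>
  with the weight \<open>\<omega> = h * d powr (1 - \<theta> * \<gamma>)\<close> and \<open>d\<close> the distance to the boundary
  (\<open>singular_term_le\<close>). Since \<open>\<omega>\<close> lies in the Lebesgue space with the conjugate exponent, the theorem
  follows from Hardy's inequality: \<open>\<phi> / d\<close> is bounded in the Lebesgue space with exponent \<open>p\<close> by the
  gradient of \<open>\<phi>\<close> (\<open>hardy_W1px0\<close>). Young's inequality then bounds the integral of the right-hand side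
  by a multiple of the gradient norm (\<open>singular_weight_bound\<close>), and since the right-hand side does not
  depend on \<open>\<delta>\<close>, it also serves as the dominating function for the limit.

  Hardy's inequality for the variable exponent combines three facts about a test function \<open>\<phi>\<close>.
  First, near a Lipschitz boundary the complement of \<open>\<Omega>\<close> contains, within distance comparable to
  \<open>d x\<close> from \<open>x\<close>, a ball of radius comparable to \<open>d x\<close> (\<open>exterior_ball_at_boundary_distance\<close>). As
  \<open>\<phi>\<close> vanishes there, averaging line integrals over that ball shows that \<open>\<bar>\<phi> x\<bar> / d x\<close> is at most a
  constant times the largest average of the gradient over balls centred at \<open>x\<close>
  (\<open>test_function_le_gradient_averages\<close>). Second, by log-Hoelder continuity the power \<open>p x\<close> of an
  average of a function with modular at most one is controlled by the \<open>q\<close>-th power of an average of its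
  \<open>p / q\<close>-th power, for the constant \<open>q > 1\<close> below \<open>p\<close> (\<open>average_le_of_modular_le_1\<close>). Third,
  the Hardy--Littlewood maximal inequality holds for the constant exponent \<open>q\<close>; it is proved from the
  Vitali covering lemma (\<open>weak_type_estimate\<close>, \<open>nn_integral_le_of_large_average_sets\<close>).

  Passing from test functions to their closure requires comparing classical gradients with the weak
  gradients in the norm, hence uniqueness of weak gradients. It rests on the fundamental lemma of the
  calculus of variations, for which smooth cut-offs of boxes are constructed.
\<close>

section \<open>Smooth cut-offs\<close>

lemma Ck_SucI:
  assumes "\<And>x. (f has_derivative f' x) (at x)" "\<And>b. b \<in> Basis \<Longrightarrow> Ck k (\<lambda>x. f' x b)"
  shows "Ck (Suc k) f"
proof -
  have "frechet_derivative f (at x) = f' x" for x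
    using frechet_derivative_at[OF assms(1)] by simp
  then show ?thesis
    using assms by (auto simp: differentiable_def)
qed

lemma Ck_SucD:
  assumes "Ck (Suc k) f"
  shows "(f has_derivative frechet_derivative f (at x)) (at x)"
    and "b \<in> Basis \<Longrightarrow> Ck k (\<lambda>x. frechet_derivative f (at x) b)"
  using assms by (auto simp: frechet_derivative_works)

lemma Ck_Suc_imp: "Ck (Suc k) f \<Longrightarrow> Ck k f"
proof (induction k arbitrary: f)
  case 0
  then show ?case
    by (auto intro!: continuous_at_imp_continuous_on differentiable_imp_continuous_within)
next
  case (Suc k)
  then show ?case by (metis Ck.simps(2))
qed

lemma Ck_const: "Ck k (\<lambda>x. c)"
proof (induction k arbitrary: c)
  case (Suc k)
  show ?case by (rule Ck_SucI[where f'="\<lambda>x h. 0"]) (auto intro!: derivative_eq_intros Suc)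
qed auto

lemma Ck_add: "Ck k f \<Longrightarrow> Ck k g \<Longrightarrow> Ck k (\<lambda>x. f x + g x)"
proof (induction k arbitrary: f g)
  case 0
  then show ?case by (auto intro!: continuous_intros)
next
  case (Suc k)
  show ?case
    by (rule Ck_SucI[OF has_derivative_add[OF Ck_SucD(1)[OF Suc.prems(1)] Ck_SucD(1)[OF Suc.prems(2)]]])
       (intro Suc.IH Ck_SucD(2)[OF Suc.prems(1)] Ck_SucD(2)[OF Suc.prems(2)])
qed

lemma Ck_mult: "Ck k f \<Longrightarrow> Ck k g \<Longrightarrow> Ck k (\<lambda>x. f x * g x)"
proof (induction k arbitrary: f g)
  case 0
  then show ?case by (auto intro!: continuous_intros)
next
  case (Suc k)
  show ?case
    by (rule Ck_SucI[OF has_derivative_mult[OF Ck_SucD(1)[OF Suc.prems(1)] Ck_SucD(1)[OF Suc.prems(2)]]])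
       (intro Ck_add Suc.IH Ck_SucD(2)[OF Suc.prems(1)] Ck_SucD(2)[OF Suc.prems(2)]
         Ck_Suc_imp[OF Suc.prems(1)] Ck_Suc_imp[OF Suc.prems(2)])
qed

lemma Ck_prod: "finite I \<Longrightarrow> (\<And>i. i \<in> I \<Longrightarrow> Ck k (f i)) \<Longrightarrow> Ck k (\<lambda>x. \<Prod>i\<in>I. f i x)"
  by (induction I rule: finite_induct) (auto intro: Ck_const Ck_mult)

text \<open>Differentiating \<open>exp (-1/t)\<close> only produces multiples of \<open>exp (-1/t) / t ^ n\<close>. Keeping
  \<open>n\<close> as a parameter makes the family closed under differentiation, so that all derivatives are
  reached by one induction.\<close>

definition flat_exp :: "nat \<Rightarrow> real \<Rightarrow> real" where
  "flat_exp n t = (if 0 < t then exp (- (1 / t)) / t ^ n else 0)"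

lemma flat_exp_right: "(flat_exp n \<longlongrightarrow> 0) (at_right 0)"
proof -
  have "((\<lambda>t. (inverse t) ^ n / exp (inverse t)) \<longlongrightarrow> (0::real)) (at_right 0)"
    by (rule filterlim_compose[OF tendsto_power_div_exp_0 filterlim_inverse_at_top_right])
  moreover have "eventually (\<lambda>t. (inverse t) ^ n / exp (inverse t) = flat_exp n t) (at_right 0)"
    unfolding eventually_at_right_field flat_exp_def
    by (intro exI[of _ 1]) (auto simp: exp_minus field_simps)
  ultimately show ?thesis
    using tendsto_cong by force
qed

text \<open>Only \<open>t = 0\<close> needs an argument: there the difference quotient of one member of the family is the
  next member, which tends to zero from the right.\<close>

lemma flat_exp_DERIV:
  "(flat_exp n has_real_derivative flat_exp (n+2) t - real n * flat_exp (n+1) t) (at t)"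
proof -
  consider "t < 0" | "t = 0" | "0 < t" by linarith
  then show ?thesis
  proof cases
    case 1
    have "((\<lambda>t. 0) has_real_derivative 0) (at t)" by simp
    then have "(flat_exp n has_real_derivative 0) (at t)"
      by (rule has_field_derivative_transform_within_open[where S="{..<0}"])
         (use 1 in \<open>auto simp: flat_exp_def\<close>)
    then show ?thesis using 1 by (simp add: flat_exp_def)
  next
    case 2
    have "((\<lambda>y. flat_exp n y / y) \<longlongrightarrow> 0) (at 0)"
    proof (rule filterlim_split_at)
      have "eventually (\<lambda>y. flat_exp n y / y = 0) (at_left 0)"
        unfolding eventually_at_left_field by (intro exI[of _ "-1"]) (auto simp: flat_exp_def)
      then show "((\<lambda>y. flat_exp n y / y) \<longlongrightarrow> 0) (at_left 0)"
        by (rule tendsto_eventually)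
      have "(\<lambda>y. flat_exp n y / y) = flat_exp (Suc n)"
        by (auto simp: flat_exp_def fun_eq_iff)
      then show "((\<lambda>y. flat_exp n y / y) \<longlongrightarrow> 0) (at_right 0)"
        using flat_exp_right by metis
    qed
    then show ?thesis
      by (simp add: 2 has_field_derivative_iff flat_exp_def)
  next
    case 3
    have "((\<lambda>t. exp (- (1 / t)) / t ^ n) has_real_derivative
        exp (- (1 / t)) / t ^ (n+2) - real n * (exp (- (1 / t)) / t ^ (n+1))) (at t)"
      proof -
      have "((\<lambda>t. exp (- (1 / t)) * inverse (t ^ n)) has_real_derivative
          exp (- (1 / t)) * (1 / t ^ 2) * inverse (t ^ n)
            - exp (- (1 / t)) * (inverse (t ^ n) * (real n * t ^ (n - 1)) * inverse (t ^ n))) (at t)"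
        using 3 by (auto intro!: derivative_eq_intros simp: power2_eq_square divide_simps)
      moreover have "inverse (t ^ n) * (real n * t ^ (n - 1)) * inverse (t ^ n) = real n / t ^ (n+1)"
        using 3 by (cases n) (auto simp: divide_simps)
      then have "exp (- (1 / t)) * (1 / t ^ 2) * inverse (t ^ n)
            - exp (- (1 / t)) * (inverse (t ^ n) * (real n * t ^ (n - 1)) * inverse (t ^ n))
          = exp (- (1 / t)) / t ^ (n+2) - real n * (exp (- (1 / t)) / t ^ (n+1))"
        using 3 by (simp only: right_diff_distrib divide_inverse power_add) (simp add: divide_simps power2_eq_square)
      ultimately show ?thesis
        by (simp only: divide_inverse[of "exp _" "_ ^ n", symmetric])
    qed
    then have "(flat_exp n has_real_derivative
        exp (- (1 / t)) / t ^ (n+2) - real n * (exp (- (1 / t)) / t ^ (n+1))) (at t)"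
      by (rule has_field_derivative_transform_within_open[where S="{0<..}"])
         (use 3 in \<open>auto simp: flat_exp_def\<close>)
    then show ?thesis using 3 by (simp add: flat_exp_def)
  qed
qed

text \<open>A derivative of such a function is a linear combination of two functions of the same kind, with
  other values of \<open>n\<close>.\<close>

lemma Ck_flat_exp_affine:
  fixes l :: "'a::euclidean_space"
  shows "Ck k (\<lambda>x. flat_exp n (l \<bullet> x + c))"
proof (induction k arbitrary: n)
  case 0
  have "continuous_on UNIV (flat_exp n)"
    using flat_exp_DERIV DERIV_isCont continuous_at_imp_continuous_on by blast
  then show ?case
    by (auto intro!: continuous_intros continuous_on_compose2[of UNIV "flat_exp n"])
next
  case (Suc k)
  let ?D = "\<lambda>x. flat_exp (n+2) (l \<bullet> x + c) - real n * flat_exp (n+1) (l \<bullet> x + c)"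
  show ?case
  proof (rule Ck_SucI)
    fix x :: 'a
    have "((\<lambda>x. l \<bullet> x + c) has_derivative (\<lambda>h. l \<bullet> h)) (at x)"
      by (auto intro!: derivative_eq_intros)
    from DERIV_compose_FDERIV[OF flat_exp_DERIV[of n "l \<bullet> x + c"] this]
    show "((\<lambda>x. flat_exp n (l \<bullet> x + c)) has_derivative (\<lambda>h. (l \<bullet> h) * ?D x)) (at x)" .
  next
    fix b :: 'a
    have "Ck k (\<lambda>x. (l \<bullet> b) * (flat_exp (n+2) (l \<bullet> x + c) + (- real n) * flat_exp (n+1) (l \<bullet> x + c)))"
      by (intro Ck_mult Ck_add Ck_const Suc.IH)
    then show "Ck k (\<lambda>x. (l \<bullet> b) * ?D x)" by simp
  qed
qed

text \<open>One smooth factor for each face of the box \<open>box a b\<close>. Stretching the argument by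
  \<open>n + 1\<close> pushes the factors to \<open>1\<close> inside the box without enlarging the support.\<close>

definition box_bump :: "'a::euclidean_space \<Rightarrow> 'a \<Rightarrow> nat \<Rightarrow> 'a \<Rightarrow> real" where
  "box_bump a b n x = (\<Prod>i\<in>Basis. flat_exp 0 (real (Suc n) * ((x - a) \<bullet> i)) *
     flat_exp 0 (real (Suc n) * ((b - x) \<bullet> i)))"

lemma flat_exp_0_bounds: "0 \<le> flat_exp 0 t" "flat_exp 0 t \<le> 1"
  by (auto simp: flat_exp_def)

lemma Ck_box_bump: "Ck k (box_bump a b n)"
proof -
  have "Ck k (\<lambda>x. flat_exp 0 ((real (Suc n) *\<^sub>R i) \<bullet> x + (- (real (Suc n) * (a \<bullet> i)))) *
     flat_exp 0 ((- real (Suc n) *\<^sub>R i) \<bullet> x + real (Suc n) * (b \<bullet> i)))" for i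
    by (intro Ck_mult Ck_flat_exp_affine)
  moreover have "(real (Suc n) *\<^sub>R i) \<bullet> x + (- (real (Suc n) * (a \<bullet> i))) = real (Suc n) * ((x - a) \<bullet> i)"
      "(- real (Suc n) *\<^sub>R i) \<bullet> x + real (Suc n) * (b \<bullet> i) = real (Suc n) * ((b - x) \<bullet> i)" for i x
    by (simp_all add: inner_diff_left right_diff_distrib inner_commute[of i x] del: of_nat_Suc)
  ultimately have "Ck k (\<lambda>x. flat_exp 0 (real (Suc n) * ((x - a) \<bullet> i)) *
     flat_exp 0 (real (Suc n) * ((b - x) \<bullet> i)))" for i
    by simp
  then show ?thesis
    unfolding box_bump_def by (intro Ck_prod) auto
qed

lemma box_bump_bounds: "0 \<le> box_bump a b n x" "box_bump a b n x \<le> 1"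
proof -
  show "0 \<le> box_bump a b n x"
    unfolding box_bump_def by (intro prod_nonneg mult_nonneg_nonneg flat_exp_0_bounds)
  show "box_bump a b n x \<le> 1"
    unfolding box_bump_def
    by (intro prod_le_1 conjI mult_nonneg_nonneg mult_le_one flat_exp_0_bounds)
qed

lemma box_bump_zero: "x \<notin> box a b \<Longrightarrow> box_bump a b n x = 0"
  unfolding box_bump_def
  by (auto simp: mem_box flat_exp_def inner_diff_left zero_less_mult_iff simp del: of_nat_Suc)

lemma flat_exp_scale_tendsto:
  assumes "0 < t" shows "(\<lambda>n. flat_exp 0 (real (Suc n) * t)) \<longlonglongrightarrow> 1"
proof -
  have "(\<lambda>n. exp (- (inverse t * inverse (real (Suc n))))) \<longlonglongrightarrow> exp (- (inverse t * 0))"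
    by (intro tendsto_intros LIMSEQ_inverse_real_of_nat)
  moreover have "flat_exp 0 (real (Suc n) * t) = exp (- (inverse t * inverse (real (Suc n))))" for n
    using assms by (simp add: flat_exp_def divide_simps zero_less_mult_iff del: of_nat_Suc)
  ultimately show ?thesis by simp
qed

lemma box_bump_tendsto: "(\<lambda>n. box_bump a b n x) \<longlonglongrightarrow> indicator (box a b) x"
proof (cases "x \<in> box a b")
  case True
  have "(\<lambda>n. box_bump a b n x) \<longlonglongrightarrow> (\<Prod>i\<in>(Basis::'a set). 1 * 1)"
    unfolding box_bump_def
    by (intro tendsto_prod tendsto_mult flat_exp_scale_tendsto)
       (use True in \<open>auto simp: mem_box inner_diff_left\<close>)
  then show ?thesis using True by simp
qed (simp add: box_bump_zero)

lemma box_bump_test_function: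
  assumes "cbox a b \<subseteq> \<Omega>"
  shows "box_bump a b n \<in> test_functions \<Omega>"
proof -
  have "{x. box_bump a b n x \<noteq> 0} \<subseteq> cbox a b"
    using box_bump_zero box_subset_cbox by blast
  then have sub: "closure {x. box_bump a b n x \<noteq> 0} \<subseteq> cbox a b"
    by (rule closure_minimal[OF _ closed_cbox])
  then have "compact (closure {x. box_bump a b n x \<noteq> 0})"
    by (meson bounded_cbox bounded_subset closed_closure compact_eq_bounded_closed)
  with sub assms Ck_box_bump show ?thesis
    by (auto simp: test_functions_def)
qed

section \<open>Uniqueness of weak gradients\<close>

text \<open>Open boxes are stable under intersection and generate the Borel sets, so it suffices that the sets
  over which \<open>w\<close> integrates to zero are closed under complements and disjoint unions. For
  complements the total integral has to vanish; this is why \<open>w\<close> is supported in a box.\<close>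

lemma integral_lebesgue_eq_0_on_borel:
  fixes w :: "'a::euclidean_space \<Rightarrow> real"
  assumes w: "integrable lebesgue w" "\<And>x. x \<notin> box c d \<Longrightarrow> w x = 0"
    and 0: "\<And>a b. (\<integral>x. indicator (box a b) x * w x \<partial>lebesgue) = 0"
    and A: "A \<in> sets borel"
  shows "(\<integral>x. indicator A x * w x \<partial>lebesgue) = 0"
proof -
  let ?G = "range (\<lambda>(a, b). box a b :: 'a set)"
  have gen: "sets borel = sigma_sets UNIV ?G"
    unfolding borel_eq_box by (simp add: sets_measure_of)
  have "Int_stable ?G"
    by (auto simp: Int_stable_def box_Int_box)
  moreover have "?G \<subseteq> Pow UNIV" by auto
  moreover have "A \<in> sigma_sets UNIV ?G" using A gen by simp
  ultimately show ?thesis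
  proof (induction rule: sigma_sets_induct_disjoint)
    case (basic B)
    then show ?case using 0 by auto
  next
    case empty
    then show ?case by simp
  next
    case (compl B)
    then have B: "B \<in> sets lebesgue" using gen by auto
    have tot: "(\<integral>x. w x \<partial>lebesgue) = 0"
    proof -
      have "(\<lambda>x. indicator (box c d) x * w x) = w"
        using w(2) by (auto simp: fun_eq_iff indicator_def)
      then show ?thesis using 0[of c d] by metis
    qed
    have "(\<integral>x. indicator (UNIV - B) x * w x \<partial>lebesgue)
        = (\<integral>x. w x - indicator B x * w x \<partial>lebesgue)"
      by (intro Bochner_Integration.integral_cong) (auto simp: indicator_def)
    also have "\<dots> = 0"
      using tot compl.IH integrable_mult_indicator[OF B w(1)] w(1)
      by (subst Bochner_Integration.integral_diff) auto
    finally show ?case .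
  next
    case (union B)
    then have "B i \<in> sets borel" for i using gen by (auto simp: image_subset_iff)
    then have B: "B i \<in> sets lebesgue" for i by auto
    have "set_integrable lebesgue (\<Union>i. B i) w"
      unfolding set_integrable_def using B w(1) by (intro integrable_mult_indicator) auto
    then have "(\<integral>x\<in>(\<Union>i. B i). w x \<partial>lebesgue) = (\<Sum>i. (\<integral>x\<in>B i. w x \<partial>lebesgue))"
      using B union(1) by (intro lebesgue_integral_countable_add) (auto simp: disjoint_family_on_def)
    then show ?case
      using union.IH by (simp add: set_lebesgue_integral_def)
  qed
qed

text \<open>Up to a null set every Lebesgue set is a Borel set, so all set integrals of \<open>w\<close> vanish.\<close>

lemma AE_eq_0_of_integral_boxes:
  fixes w :: "'a::euclidean_space \<Rightarrow> real"
  assumes w: "integrable lebesgue w" "\<And>x. x \<notin> box c d \<Longrightarrow> w x = 0"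
    and 0: "\<And>a b. (\<integral>x. indicator (box a b) x * w x \<partial>lebesgue) = 0"
  shows "AE x in lebesgue. w x = 0"
proof (rule density_unique_real[OF w(1) integrable_zero])
  fix A :: "'a set" assume "A \<in> sets lebesgue"
  then obtain S N N' where S: "A = S \<union> N" "N \<subseteq> N'" "N' \<in> null_sets lborel" "S \<in> sets lborel"
    by (rule sets_completionE)
  have "AE x in lebesgue. x \<notin> N'"
    using S(3) AE_completion AE_not_in by blast
  then have "AE x in lebesgue. indicator A x * w x = indicator S x * w x"
    by eventually_elim (use S in \<open>auto simp: indicator_def\<close>)
  moreover have "w \<in> borel_measurable lebesgue" using w(1) by auto
  ultimately have "(\<integral>x. indicator A x * w x \<partial>lebesgue) = (\<integral>x. indicator S x * w x \<partial>lebesgue)"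
    using \<open>A \<in> sets lebesgue\<close> S(4)
    by (intro integral_cong_AE borel_measurable_times borel_measurable_indicator) auto
  also have "\<dots> = 0"
    using S(4) by (intro integral_lebesgue_eq_0_on_borel[OF w 0]) auto
  finally show "set_lebesgue_integral lebesgue A w = set_lebesgue_integral lebesgue A (\<lambda>x. 0)"
    by (simp add: set_lebesgue_integral_def)
qed

text \<open>Testing with the cut-offs of a box and letting them tend to its indicator function shows that
  \<open>v\<close> integrates to zero over every box whose closure lies in \<open>\<Omega>\<close>. Countably many closed boxes
  exhaust \<open>\<Omega>\<close>.\<close>

lemma fundamental_lemma_calculus_of_variations:
  fixes v :: "'a::euclidean_space \<Rightarrow> real"
  assumes "open \<Omega>"
    and v: "\<And>K. compact K \<Longrightarrow> K \<subseteq> \<Omega> \<Longrightarrow> v absolutely_integrable_on K"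
    and 0: "\<And>\<psi>. \<psi> \<in> test_functions \<Omega> \<Longrightarrow> (\<integral>x. v x * \<psi> x \<partial>lebesgue_on \<Omega>) = 0"
  shows "AE x in lebesgue_on \<Omega>. v x = 0"
proof -
  have Om: "\<Omega> \<inter> space lebesgue \<in> sets lebesgue" using \<open>open \<Omega>\<close> by simp
  have int_box: "(\<integral>x. indicator (box a b) x * v x \<partial>lebesgue) = 0" if ab: "cbox a b \<subseteq> \<Omega>" for a b
  proof -
    have i: "integrable lebesgue (\<lambda>x. indicator (cbox a b) x *\<^sub>R v x)"
      using v[OF compact_cbox ab] by (simp add: set_integrable_def)
    have eq: "indicator \<Omega> x *\<^sub>R (v x * box_bump a b n x)
        = (indicator (cbox a b) x *\<^sub>R v x) * box_bump a b n x" for n x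
      using ab box_bump_zero[of x a b n] box_subset_cbox[of a b] by (auto simp: indicator_def)
    have "(\<lambda>n. \<integral>x. (indicator (cbox a b) x *\<^sub>R v x) * box_bump a b n x \<partial>lebesgue)
        \<longlonglongrightarrow> (\<integral>x. (indicator (cbox a b) x *\<^sub>R v x) * indicator (box a b) x \<partial>lebesgue)"
    proof (rule integral_dominated_convergence[where w="\<lambda>x. norm (indicator (cbox a b) x *\<^sub>R v x)"])
      have "box_bump a b n \<in> borel_measurable lebesgue" for n
        using Ck_box_bump[of 0 a b n]
        by (intro measurable_completion) (simp add: borel_measurable_continuous_onI del: Ck.simps(2))
      then show "(\<lambda>x. (indicator (cbox a b) x *\<^sub>R v x) * box_bump a b n x) \<in> borel_measurable lebesgue" for n
        using borel_measurable_integrable[OF i] by (intro borel_measurable_times)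
      show "(\<lambda>x. (indicator (cbox a b) x *\<^sub>R v x) * indicator (box a b) x) \<in> borel_measurable lebesgue"
        using borel_measurable_integrable[OF i]
        by (intro borel_measurable_times borel_measurable_indicator) auto
      show "AE x in lebesgue. (\<lambda>n. (indicator (cbox a b) x *\<^sub>R v x) * box_bump a b n x)
          \<longlonglongrightarrow> (indicator (cbox a b) x *\<^sub>R v x) * indicator (box a b) x"
        by (intro AE_I2 tendsto_intros box_bump_tendsto)
      show "AE x in lebesgue. norm ((indicator (cbox a b) x *\<^sub>R v x) * box_bump a b n x)
          \<le> norm (indicator (cbox a b) x *\<^sub>R v x)" for n
        using box_bump_bounds[of a b n]
        by (intro AE_I2) (simp add: abs_mult mult_left_le)
    qed (use i in auto)
    moreover have "(\<integral>x. (indicator (cbox a b) x *\<^sub>R v x) * box_bump a b n x \<partial>lebesgue) = 0" for n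
      using 0[OF box_bump_test_function[OF ab, of n]]
      unfolding integral_restrict_space[OF Om] eq .
    ultimately have "(\<integral>x. (indicator (cbox a b) x *\<^sub>R v x) * indicator (box a b) x \<partial>lebesgue) = 0"
      by (simp add: LIMSEQ_const_iff)
    moreover have "(indicator (cbox a b) x *\<^sub>R v x) * indicator (box a b) x = indicator (box a b) x * v x" for x
      using box_subset_cbox[of a b] by (auto simp: indicator_def)
    ultimately show ?thesis by (simp only:)
  qed
  have AE_box: "AE x in lebesgue. x \<in> cbox c d \<longrightarrow> v x = 0" if cd: "cbox c d \<subseteq> \<Omega>" for c d
  proof -
    let ?w = "\<lambda>x. indicator (box c d) x * v x"
    have i: "integrable lebesgue (\<lambda>x. indicator (cbox c d) x *\<^sub>R v x)"
      using v[OF compact_cbox cd] by (simp add: set_integrable_def)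
    have "AE x in lebesgue. ?w x = 0"
    proof (rule AE_eq_0_of_integral_boxes)
      have "integrable lebesgue (\<lambda>x. indicator (box c d) x *\<^sub>R (indicator (cbox c d) x *\<^sub>R v x))"
        by (intro integrable_mult_indicator i) auto
      moreover have "indicator (box c d) x *\<^sub>R (indicator (cbox c d) x *\<^sub>R v x) = ?w x" for x
        using box_subset_cbox[of c d] by (auto simp: indicator_def)
      ultimately show "integrable lebesgue ?w" by (simp only:)
      show "?w x = 0" if "x \<notin> box c d" for x using that by simp
      fix a b :: 'a
      obtain a' b' where ab: "box a b \<inter> box c d = box a' b'"
        by (rule that[OF box_Int_box])
      have eq: "indicator (box a b) x * ?w x = indicator (box a' b') x * v x" for x
        unfolding ab[symmetric] by (simp add: indicator_inter_arith)
      show "(\<integral>x. indicator (box a b) x * ?w x \<partial>lebesgue) = 0"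
      proof (cases "box a' b' = {}")
        case False
        then have "cbox a' b' = closure (box a' b')" by simp
        also have "\<dots> \<subseteq> closure (box c d)" using ab by (intro closure_mono) auto
        also have "\<dots> \<subseteq> cbox c d" by (intro closure_minimal box_subset_cbox closed_cbox)
        finally show ?thesis unfolding eq using int_box cd by blast
      qed (simp add: eq)
    qed
    moreover have "cbox c d - box c d \<in> null_sets lebesgue"
      using negligible_frontier_interval negligible_iff_null_sets by blast
    then have "AE x in lebesgue. x \<notin> cbox c d - box c d" by (rule AE_not_in)
    ultimately show ?thesis by eventually_elim auto
  qed
  obtain \<D> where D: "countable \<D>" "\<And>X. X \<in> \<D> \<Longrightarrow> X \<subseteq> \<Omega> \<and> (\<exists>a b. X = cbox a b)" "\<Union>\<D> = \<Omega>"
    by (rule open_countable_Union_open_cbox[OF \<open>open \<Omega>\<close>]) (rule that; auto)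
  have "AE x in lebesgue. x \<in> X \<longrightarrow> v x = 0" if "X \<in> \<D>" for X
    using D(2)[OF that] AE_box by auto
  then have "AE x in lebesgue. \<forall>X\<in>\<D>. x \<in> X \<longrightarrow> v x = 0"
    by (subst AE_ball_countable[OF D(1)]) blast
  then have "AE x in lebesgue. x \<in> \<Omega> \<longrightarrow> v x = 0"
    by eventually_elim (use D(3) in blast)
  then show ?thesis
    using Om by (simp add: AE_restrict_space_iff)
qed

lemma AE_eq_of_inner_Basis:
  fixes G H :: "'b \<Rightarrow> 'a::euclidean_space"
  assumes "\<And>b. b \<in> Basis \<Longrightarrow> AE x in M. (G x - H x) \<bullet> b = 0"
  shows "AE x in M. G x = H x"
proof -
  have "AE x in M. \<forall>b\<in>Basis. (G x - H x) \<bullet> b = 0"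
    using assms by (subst AE_ball_countable) (auto intro: countable_finite)
  then show ?thesis
    by eventually_elim (metis euclidean_all_zero_iff right_minus_eq)
qed

lemma zero_off_support: "x \<notin> closure {x. \<phi> x \<noteq> 0} \<Longrightarrow> \<phi> x = 0"
  using closure_subset[of "{x. \<phi> x \<noteq> 0}"] by blast

lemma test_functionD:
  fixes \<phi> :: "'a::euclidean_space \<Rightarrow> real"
  assumes "\<phi> \<in> test_functions \<Omega>"
  shows "Ck k \<phi>" "compact (closure {x. \<phi> x \<noteq> 0})" "closure {x. \<phi> x \<noteq> 0} \<subseteq> \<Omega>"
    "\<phi> x \<noteq> 0 \<Longrightarrow> x \<in> \<Omega>"
    "(\<phi> has_derivative frechet_derivative \<phi> (at x)) (at x)"
    "continuous_on S \<phi>"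
    "b \<in> Basis \<Longrightarrow> continuous_on S (\<lambda>x. frechet_derivative \<phi> (at x) b)"
proof -
  show k: "Ck k \<phi>" for k
    using assms by (simp add: test_functions_def)
  show "compact (closure {x. \<phi> x \<noteq> 0})" "closure {x. \<phi> x \<noteq> 0} \<subseteq> \<Omega>"
    using assms by (auto simp: test_functions_def)
  then show "\<phi> x \<noteq> 0 \<Longrightarrow> x \<in> \<Omega>"
    using closure_subset by fastforce
  show "(\<phi> has_derivative frechet_derivative \<phi> (at x)) (at x)"
    using Ck_SucD(1)[OF k[of "Suc 0"]] .
  show "continuous_on S \<phi>"
    using k[of 0] by (auto intro: continuous_on_subset)
  show "b \<in> Basis \<Longrightarrow> continuous_on S (\<lambda>x. frechet_derivative \<phi> (at x) b)"
    using Ck_SucD(2)[OF k[of "Suc 0"]] by (auto intro: continuous_on_subset)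
qed

lemma frechet_derivative_zero_off_support:
  fixes \<phi> :: "'a::euclidean_space \<Rightarrow> real"
  assumes "x \<notin> closure {x. \<phi> x \<noteq> 0}"
  shows "frechet_derivative \<phi> (at x) = (\<lambda>h. 0)"
proof -
  have "((\<lambda>x. 0) has_derivative (\<lambda>h. 0)) (at x)" by simp
  then have "(\<phi> has_derivative (\<lambda>h. 0)) (at x)"
    by (rule has_derivative_transform_within_open[where s="- closure {x. \<phi> x \<noteq> 0}"])
       (use assms closure_subset[of "{x. \<phi> x \<noteq> 0}"] in \<open>auto simp: open_Compl\<close>)
  then show ?thesis
    using frechet_derivative_at by metis
qed

text \<open>The pairings in the definition of a weak gradient are integrals of integrable functions, not
  default values of the integral; without this they could not be added or subtracted.\<close>

lemma integrable_mult_compact_support: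
  fixes \<Omega> :: "'a::euclidean_space set" and v :: "'a \<Rightarrow> real"
  assumes "open \<Omega>" "\<And>K. compact K \<Longrightarrow> K \<subseteq> \<Omega> \<Longrightarrow> v absolutely_integrable_on K"
    and K: "compact K" "K \<subseteq> \<Omega>" and \<psi>: "continuous_on UNIV \<psi>" "\<And>x. x \<notin> K \<Longrightarrow> \<psi> x = 0"
  shows "integrable (lebesgue_on \<Omega>) (\<lambda>x. v x * \<psi> x)"
proof -
  have Om: "\<Omega> \<inter> space lebesgue \<in> sets lebesgue" using \<open>open \<Omega>\<close> by simp
  have KL: "K \<in> sets lebesgue" using \<open>compact K\<close> by (intro sets_completionI_sets) (auto intro: borel_compact)
  have "continuous_on K \<psi>" using \<psi>(1) continuous_on_subset by blast
  then have "(\<lambda>x. \<psi> x * v x) absolutely_integrable_on K"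
    using K KL assms(2) \<psi>(1)
    by (intro absolutely_integrable_bounded_measurable_product[OF bilinear_times])
       (auto intro!: compact_imp_bounded compact_continuous_image
          continuous_imp_measurable_on_sets_lebesgue)
  then have "integrable lebesgue (\<lambda>x. indicator K x *\<^sub>R (\<psi> x * v x))"
    by (simp add: set_integrable_def)
  moreover have "indicator K x *\<^sub>R (\<psi> x * v x) = indicator \<Omega> x *\<^sub>R (v x * \<psi> x)" for x
    using K(2) \<psi>(2)[of x] by (auto simp: indicator_def)
  ultimately show ?thesis
    unfolding integrable_restrict_space[OF Om] by (simp only:)
qed

text \<open>Every component of the difference of two weak gradients integrates to zero against all test
  functions.\<close>

lemma has_weak_gradient_unique:
  fixes \<Omega> :: "'a::euclidean_space set"
  assumes "open \<Omega>" and G: "has_weak_gradient \<Omega> u G" and H: "has_weak_gradient \<Omega> u H"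
  shows "AE x in lebesgue_on \<Omega>. G x = H x"
proof (rule AE_eq_of_inner_Basis)
  fix b :: 'a assume b: "b \<in> Basis"
  have ai: "(\<lambda>x. F x \<bullet> b) absolutely_integrable_on K"
    if "has_weak_gradient \<Omega> u F" "compact K" "K \<subseteq> \<Omega>" for F K
    using that b by (auto simp: has_weak_gradient_def intro: absolutely_integrable_component)
  show "AE x in lebesgue_on \<Omega>. (G x - H x) \<bullet> b = 0"
  proof (rule fundamental_lemma_calculus_of_variations[OF \<open>open \<Omega>\<close>])
    fix K assume "compact K" "K \<subseteq> \<Omega>"
    then show "(\<lambda>x. (G x - H x) \<bullet> b) absolutely_integrable_on K"
      unfolding inner_diff_left
      using ai[OF G] ai[OF H] by (intro set_integral_diff) auto
  next
    fix \<psi> assume \<psi>: "\<psi> \<in> test_functions \<Omega>"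
    have \<psi>0: "\<psi> x = 0" if "x \<notin> closure {x. \<psi> x \<noteq> 0}" for x
      by (rule zero_off_support[OF that])
    have i: "integrable (lebesgue_on \<Omega>) (\<lambda>x. (F x \<bullet> b) * \<psi> x)" if "has_weak_gradient \<Omega> u F" for F
      by (rule integrable_mult_compact_support[OF \<open>open \<Omega>\<close> ai[OF that] test_functionD(2,3)[OF \<psi>]
          test_functionD(6)[OF \<psi>] \<psi>0])
    have "(\<integral>x. ((G x - H x) \<bullet> b) * \<psi> x \<partial>lebesgue_on \<Omega>)
        = (\<integral>x. (G x \<bullet> b) * \<psi> x \<partial>lebesgue_on \<Omega>) - (\<integral>x. (H x \<bullet> b) * \<psi> x \<partial>lebesgue_on \<Omega>)"
      unfolding inner_diff_left left_diff_distrib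
      by (intro Bochner_Integration.integral_diff i G H)
    also have "\<dots> = 0"
    proof -
      have "(\<integral>x. (F x \<bullet> b) * \<psi> x \<partial>lebesgue_on \<Omega>)
          = - (\<integral>x. u x * frechet_derivative \<psi> (at x) b \<partial>lebesgue_on \<Omega>)"
        if "has_weak_gradient \<Omega> u F" for F
        using that \<psi> b unfolding has_weak_gradient_def by simp
      from this[OF G] this[OF H] show ?thesis by simp
    qed
    finally show "(\<integral>x. ((G x - H x) \<bullet> b) * \<psi> x \<partial>lebesgue_on \<Omega>) = 0" .
  qed
qed

section \<open>Classical gradients are weak gradients\<close>

lemma integral_translation_lborel:
  fixes F :: "'a::euclidean_space \<Rightarrow> real"
  assumes "F \<in> borel_measurable borel"
  shows "(\<integral>x. F (x + c) \<partial>lborel) = (\<integral>x. F x \<partial>lborel)"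
proof -
  have "(\<integral>x. F x \<partial>lborel) = (\<integral>x. F x \<partial>distr lborel borel ((+) c))"
    by (simp add: lborel_distr_plus)
  also have "\<dots> = (\<integral>x. F (c + x) \<partial>lborel)"
    using assms by (subst integral_distr) auto
  finally show ?thesis by (simp add: add.commute)
qed

lemma integrable_translation_lborel:
  fixes F :: "'a::euclidean_space \<Rightarrow> real"
  assumes "integrable lborel F"
  shows "integrable lborel (\<lambda>x. F (x + c))"
proof -
  have "integrable (distr lborel borel ((+) c)) F"
    using assms by (simp add: lborel_distr_plus)
  then have "integrable lborel (\<lambda>x. F (c + x))"
    by (rule integrable_distr[rotated]) simp
  then show ?thesis by (simp add: add.commute)
qed

lemma integrable_continuous_compact_support:
  fixes F :: "'a::euclidean_space \<Rightarrow> 'b::euclidean_space"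
  assumes "continuous_on UNIV F" "compact K" "\<And>x. x \<notin> K \<Longrightarrow> F x = 0"
  shows "integrable lborel F"
proof -
  have "integrable lborel (\<lambda>x. indicator K x *\<^sub>R F x)"
    using assms by (intro borel_integrable_compact) (auto intro: continuous_on_subset)
  moreover have "(\<lambda>x. indicator K x *\<^sub>R F x) = F"
    using assms(3) by (auto simp: indicator_def)
  ultimately show ?thesis by simp
qed

lemma continuous_compact_support_bounded:
  fixes f :: "'a::euclidean_space \<Rightarrow> 'b::euclidean_space"
  assumes "continuous_on UNIV f" "compact K" "\<And>x. x \<notin> K \<Longrightarrow> f x = 0"
  shows "\<exists>B\<ge>1. \<forall>x. norm (f x) \<le> B"
proof -
  have "compact (f ` K)"
    using assms(2) continuous_on_subset[OF assms(1)] by (intro compact_continuous_image) auto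
  then have "bounded (f ` K)" by (rule compact_imp_bounded)
  then obtain B where "\<forall>t\<in>f ` K. norm t \<le> B"
    unfolding bounded_iff by (rule exE)
  then have "norm (f x) \<le> max 1 B" for x
    using assms(3)[of x] by (cases "x \<in> K") (auto simp: le_max_iff_disj)
  then show ?thesis by (intro exI[of _ "max 1 B"]) simp
qed

text \<open>By translation invariance the difference quotients of \<open>F\<close> integrate to zero. They are bounded by
  the maximum of the derivative on a fixed ball, so dominated convergence applies.\<close>

lemma integral_partial_derivative_eq_0:
  fixes F :: "'a::euclidean_space \<Rightarrow> real"
  assumes F: "Ck (Suc 0) F" and K: "compact K" "closure {x. F x \<noteq> 0} \<subseteq> K" and b: "b \<in> Basis"
  shows "(\<integral>x. frechet_derivative F (at x) b \<partial>lborel) = 0"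
proof -
  let ?D = "\<lambda>x. frechet_derivative F (at x) b"
  define t where "t n = inverse (real (Suc n))" for n
  have t: "0 < t n" "t n \<le> 1" for n
    by (auto simp: t_def divide_simps)
  have t0: "t \<longlonglongrightarrow> 0"
    unfolding t_def by (rule LIMSEQ_inverse_real_of_nat)
  have cF: "continuous_on UNIV F" using Ck_Suc_imp[OF F] by simp
  have cD: "continuous_on UNIV ?D" using Ck_SucD(2)[OF F b] by simp
  have F0: "F x = 0" if "x \<notin> K" for x using that K(2) closure_subset[of "{x. F x \<noteq> 0}"] by auto
  have D0: "?D x = 0" if "x \<notin> K" for x
  proof -
    have "x \<notin> closure {x. F x \<noteq> 0}" using that K(2) by (rule contra_subsetD[rotated])
    then show ?thesis by (simp add: frechet_derivative_zero_off_support)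
  qed
  have iF: "integrable lborel F" using cF K(1) F0 by (rule integrable_continuous_compact_support[where F=F and K=K])
  have iD: "integrable lborel ?D" using cD K(1) D0 by (rule integrable_continuous_compact_support[where F="?D" and K=K])
  have "\<exists>B\<ge>1. \<forall>x. norm (?D x) \<le> B"
    using cD K(1) D0 by (rule continuous_compact_support_bounded[where f="?D" and K=K])
  then obtain B where "1 \<le> B" and B: "\<And>x. \<bar>?D x\<bar> \<le> B" by auto
  obtain R where R: "\<And>x. x \<in> K \<Longrightarrow> norm x \<le> R"
    using compact_imp_bounded[OF K(1)] bounded_iff by metis
  have line: "((\<lambda>s. F (x + s *\<^sub>R b)) has_real_derivative ?D (x + s *\<^sub>R b)) (at s)" for x s
  proof -
    have "((\<lambda>s. x + s *\<^sub>R b) has_derivative (\<lambda>h. h *\<^sub>R b)) (at s)"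
      by (auto intro!: derivative_eq_intros)
    from has_derivative_compose[OF this Ck_SucD(1)[OF F]]
    have "((\<lambda>s. F (x + s *\<^sub>R b)) has_derivative (\<lambda>h. frechet_derivative F (at (x + s *\<^sub>R b)) (h *\<^sub>R b))) (at s)" .
    moreover have "linear (frechet_derivative F (at (x + s *\<^sub>R b)))"
      using Ck_SucD(1)[OF F] has_derivative_linear by blast
    ultimately show ?thesis
      by (simp add: has_field_derivative_def linear_cmul[of "frechet_derivative F (at (x + s *\<^sub>R b))"]
          mult_commute_abs)
  qed
  define T where "T n x = (F (x + t n *\<^sub>R b) - F x) / t n" for n x
  have T_bound: "\<bar>T n x\<bar> \<le> B * indicator (cball 0 (R + 1)) x" for n x
  proof (cases "x \<in> cball 0 (R + 1)")
    case True
    have "\<exists>z>0. z < t n \<and> F (x + t n *\<^sub>R b) - F (x + 0 *\<^sub>R b) = (t n - 0) * ?D (x + z *\<^sub>R b)"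
      using t[of n] line by (intro MVT2) auto
    then obtain z where z: "F (x + t n *\<^sub>R b) - F x = t n * ?D (x + z *\<^sub>R b)" by auto
    have "T n x = ?D (x + z *\<^sub>R b)"
      unfolding T_def z using t(1)[of n] by simp
    then show ?thesis using True B by simp
  next
    case False
    then have x: "R + 1 < norm x" by simp
    have "norm (t n *\<^sub>R b) \<le> 1" using t[of n] b by simp
    then have "R < norm (x + t n *\<^sub>R b)"
      using x norm_diff_ineq[of x "t n *\<^sub>R b"] by linarith
    then have "F (x + t n *\<^sub>R b) = 0" using R F0 by (meson not_le)
    moreover have "F x = 0" using x R[of x] by (intro F0) auto
    ultimately have "T n x = 0" unfolding T_def by simp
    then show ?thesis using False by simp
  qed
  have "(\<lambda>n. \<integral>x. T n x \<partial>lborel) \<longlonglongrightarrow> (\<integral>x. ?D x \<partial>lborel)"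
  proof (rule integral_dominated_convergence[where w="\<lambda>x. B * indicator (cball 0 (R + 1)) x"])
    show "?D \<in> borel_measurable lborel" using iD by auto
    show "T n \<in> borel_measurable lborel" for n
      unfolding T_def using integrable_translation_lborel[OF iF] iF by (intro borel_measurable_integrable) auto
    show "integrable lborel (\<lambda>x. B * indicator (cball 0 (R + 1)) x :: real)"
      by (intro integrable_mult_right integrable_real_indicator emeasure_bounded_finite) auto
    show "AE x in lborel. (\<lambda>n. T n x) \<longlonglongrightarrow> ?D x"
    proof (rule AE_I2)
      fix x
      have lim: "((\<lambda>s. (F (x + s *\<^sub>R b) - F x) / s) \<longlongrightarrow> ?D x) (at 0)"
        using line[of x 0] by (simp add: has_field_derivative_iff)
      have "t n \<noteq> 0" for n using t(1)[of n] by simp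
      then have "filterlim t (at 0) sequentially"
        using t0 by (simp add: filterlim_at)
      from filterlim_compose[OF lim this] show "(\<lambda>n. T n x) \<longlonglongrightarrow> ?D x"
        unfolding T_def .
    qed
    show "AE x in lborel. norm (T n x) \<le> B * indicator (cball 0 (R + 1)) x" for n
      using T_bound[of n] by (intro AE_I2) simp
  qed
  moreover have "(\<integral>x. T n x \<partial>lborel) = 0" for n
    unfolding T_def integral_divide_zero
      Bochner_Integration.integral_diff[OF integrable_translation_lborel[OF iF] iF]
      integral_translation_lborel[OF borel_measurable_continuous_onI[OF cF]]
    by simp
  ultimately show ?thesis
    by (simp add: LIMSEQ_const_iff)
qed

definition classical_gradient :: "('a::euclidean_space \<Rightarrow> real) \<Rightarrow> 'a \<Rightarrow> 'a" where
  "classical_gradient \<phi> x = (\<Sum>b\<in>Basis. frechet_derivative \<phi> (at x) b *\<^sub>R b)"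

lemma classical_gradient_inner_Basis:
  "b \<in> Basis \<Longrightarrow> classical_gradient \<phi> x \<bullet> b = frechet_derivative \<phi> (at x) b"
  by (simp add: classical_gradient_def)

lemma continuous_classical_gradient:
  "\<phi> \<in> test_functions \<Omega> \<Longrightarrow> continuous_on S (classical_gradient \<phi>)"
  unfolding classical_gradient_def
  by (intro continuous_intros test_functionD(7)) auto

lemma frechet_derivative_eq_inner:
  assumes "\<phi> \<in> test_functions \<Omega>"
  shows "frechet_derivative \<phi> (at x) h = classical_gradient \<phi> x \<bullet> h"
proof -
  have l: "linear (frechet_derivative \<phi> (at x))"
    using test_functionD(5)[OF assms] has_derivative_linear by blast
  have "frechet_derivative \<phi> (at x) h = frechet_derivative \<phi> (at x) (\<Sum>b\<in>Basis. (h \<bullet> b) *\<^sub>R b)"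
    by (simp add: euclidean_representation)
  also have "\<dots> = (\<Sum>b\<in>Basis. (h \<bullet> b) * frechet_derivative \<phi> (at x) b)"
    using l by (simp add: linear_sum linear_cmul)
  also have "\<dots> = classical_gradient \<phi> x \<bullet> h"
    by (simp add: classical_gradient_def inner_sum_left) (simp add: inner_commute mult.commute)
  finally show ?thesis .
qed

lemma classical_gradient_zero:
  "x \<notin> closure {x. \<phi> x \<noteq> 0} \<Longrightarrow> classical_gradient \<phi> x = 0"
  by (simp add: classical_gradient_def frechet_derivative_zero_off_support)

lemma absolutely_integrable_on_compact:
  fixes f :: "'a::euclidean_space \<Rightarrow> 'b::euclidean_space"
  assumes "continuous_on K f" "compact K"
  shows "f absolutely_integrable_on K"
  using borel_integrable_compact[OF assms(2,1)]
  by (simp add: set_integrable_def integrable_completion)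

text \<open>By the product rule, integration by parts is the vanishing of the integral of a partial derivative
  of \<open>\<phi> * \<psi>\<close>.\<close>

lemma has_weak_gradient_classical:
  fixes \<Omega> :: "'a::euclidean_space set"
  assumes "open \<Omega>" and \<phi>: "\<phi> \<in> test_functions \<Omega>"
  shows "has_weak_gradient \<Omega> \<phi> (classical_gradient \<phi>)"
  unfolding has_weak_gradient_def
proof (intro conjI allI impI ballI)
  fix K assume K: "compact K \<and> K \<subseteq> \<Omega>"
  show "\<phi> absolutely_integrable_on K"
    using K by (intro absolutely_integrable_on_compact test_functionD(6)[OF \<phi>]) simp
  show "classical_gradient \<phi> absolutely_integrable_on K"
    using K by (intro absolutely_integrable_on_compact continuous_classical_gradient[OF \<phi>]) simp
next
  fix \<psi> b assume \<psi>: "\<psi> \<in> test_functions \<Omega>" and b: "(b::'a) \<in> Basis"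
  have Om: "\<Omega> \<inter> space lebesgue \<in> sets lebesgue" using \<open>open \<Omega>\<close> by simp
  let ?p = "\<lambda>x. \<phi> x * frechet_derivative \<psi> (at x) b"
  let ?q = "\<lambda>x. frechet_derivative \<phi> (at x) b * \<psi> x"
  let ?K = "closure {x. \<psi> x \<noteq> 0}"
  note K = test_functionD(2,3)[OF \<psi>]
  have \<psi>0: "\<psi> x = 0" if "x \<notin> ?K" for x by (rule zero_off_support[OF that])
  have \<psi>0': "frechet_derivative \<psi> (at x) b = 0" if "x \<notin> ?K" for x
    using frechet_derivative_zero_off_support[OF that] by simp
  have ip: "integrable lborel ?p"
  proof (rule integrable_continuous_compact_support[where F="?p" and K="?K"])
    show "continuous_on UNIV ?p"
      by (intro continuous_on_mult test_functionD(6)[OF \<phi>] test_functionD(7)[OF \<psi> b])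
    show "?p x = 0" if "x \<notin> ?K" for x using \<psi>0'[OF that] by simp
  qed (rule K(1))
  have iq: "integrable lborel ?q"
  proof (rule integrable_continuous_compact_support[where F="?q" and K="?K"])
    show "continuous_on UNIV ?q"
      by (intro continuous_on_mult test_functionD(7)[OF \<phi> b] test_functionD(6)[OF \<psi>])
    show "?q x = 0" if "x \<notin> ?K" for x using \<psi>0[OF that] by simp
  qed (rule K(1))
  have deriv: "frechet_derivative (\<lambda>x. \<phi> x * \<psi> x) (at x) b = ?p x + ?q x" for x
    using frechet_derivative_at[OF has_derivative_mult[OF test_functionD(5)[OF \<phi>] test_functionD(5)[OF \<psi>], of x]]
    by metis
  have "closure {x. \<phi> x * \<psi> x \<noteq> 0} \<subseteq> ?K"
    by (rule closure_mono) auto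
  from integral_partial_derivative_eq_0[OF Ck_mult[OF test_functionD(1)[OF \<phi>] test_functionD(1)[OF \<psi>]]
      K(1) this b]
  have "(\<integral>x. ?p x + ?q x \<partial>lborel) = 0"
    by (simp only: deriv)
  then have sum0: "(\<integral>x. ?p x \<partial>lborel) + (\<integral>x. ?q x \<partial>lborel) = 0"
    using Bochner_Integration.integral_add[OF ip iq] by simp
  have *: "(\<integral>x. r x \<partial>lebesgue_on \<Omega>) = (\<integral>x. r x \<partial>lborel)"
    if "integrable lborel r" "\<And>x. x \<notin> ?K \<Longrightarrow> r x = 0" for r :: "'a \<Rightarrow> real"
  proof -
    have eq: "indicator \<Omega> x *\<^sub>R r x = r x" for x
      using that(2)[of x] K(2) by (cases "x \<in> ?K") (auto simp: indicator_def)
    show ?thesis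
      unfolding integral_restrict_space[OF Om] eq
      using that(1) by (intro integral_completion) auto
  qed
  have "(\<integral>x. ?p x \<partial>lebesgue_on \<Omega>) = (\<integral>x. ?p x \<partial>lborel)"
    by (rule *[OF ip], drule \<psi>0') simp
  moreover have "(\<integral>x. ?q x \<partial>lebesgue_on \<Omega>) = (\<integral>x. ?q x \<partial>lborel)"
    by (rule *[OF iq], drule \<psi>0) simp
  ultimately show "(\<integral>x. ?p x \<partial>lebesgue_on \<Omega>)
      = - (\<integral>x. (classical_gradient \<phi> x \<bullet> b) * \<psi> x \<partial>lebesgue_on \<Omega>)"
    using sum0 b by (simp add: classical_gradient_inner_Basis)
qed

lemma has_weak_gradient_diff:
  fixes \<Omega> :: "'a::euclidean_space set"
  assumes "open \<Omega>" and G: "has_weak_gradient \<Omega> u G" and H: "has_weak_gradient \<Omega> v H"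
  shows "has_weak_gradient \<Omega> (\<lambda>x. u x - v x) (\<lambda>x. G x - H x)"
  unfolding has_weak_gradient_def
proof (intro conjI allI impI ballI)
  have loc: "w absolutely_integrable_on K" "F absolutely_integrable_on K"
    if "has_weak_gradient \<Omega> w F" "compact K" "K \<subseteq> \<Omega>" for w F K
    using that by (auto simp: has_weak_gradient_def)
  fix K assume K: "compact K \<and> K \<subseteq> \<Omega>"
  show "(\<lambda>x. u x - v x) absolutely_integrable_on K" "(\<lambda>x. G x - H x) absolutely_integrable_on K"
    using loc[OF G] loc[OF H] K by (simp_all add: set_integral_diff)
next
  fix \<psi> b assume \<psi>: "\<psi> \<in> test_functions \<Omega>" and b: "(b::'a) \<in> Basis"
  let ?K = "closure {x. \<psi> x \<noteq> 0}"
  note K = test_functionD(2,3)[OF \<psi>]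
  have \<psi>0: "\<psi> x = 0" if "x \<notin> ?K" for x by (rule zero_off_support[OF that])
  have \<psi>0': "frechet_derivative \<psi> (at x) b = 0" if "x \<notin> ?K" for x
    using frechet_derivative_zero_off_support[OF that] by simp
  have i1: "integrable (lebesgue_on \<Omega>) (\<lambda>x. w x * frechet_derivative \<psi> (at x) b)"
    if "has_weak_gradient \<Omega> w F" for w F
    using that
    by (intro integrable_mult_compact_support[OF \<open>open \<Omega>\<close> _ K test_functionD(7)[OF \<psi> b] \<psi>0'])
       (simp add: has_weak_gradient_def)
  have i2: "integrable (lebesgue_on \<Omega>) (\<lambda>x. (F x \<bullet> b) * \<psi> x)"
    if "has_weak_gradient \<Omega> w F" for w F
    using that
    by (intro integrable_mult_compact_support[OF \<open>open \<Omega>\<close> _ K test_functionD(6)[OF \<psi>] \<psi>0]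
        absolutely_integrable_component)
       (simp add: has_weak_gradient_def)
  have p: "(\<integral>x. w x * frechet_derivative \<psi> (at x) b \<partial>lebesgue_on \<Omega>)
      = - (\<integral>x. (F x \<bullet> b) * \<psi> x \<partial>lebesgue_on \<Omega>)" if "has_weak_gradient \<Omega> w F" for w F
    using that \<psi> b by (auto simp: has_weak_gradient_def)
  show "(\<integral>x. (u x - v x) * frechet_derivative \<psi> (at x) b \<partial>lebesgue_on \<Omega>)
      = - (\<integral>x. ((G x - H x) \<bullet> b) * \<psi> x \<partial>lebesgue_on \<Omega>)"
    unfolding left_diff_distrib inner_diff_left
      Bochner_Integration.integral_diff[OF i1[OF G] i1[OF H]]
      Bochner_Integration.integral_diff[OF i2[OF G] i2[OF H]]
    using p[OF G] p[OF H] by simp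
qed

lemma has_weak_gradient_weak_grad:
  "has_weak_gradient \<Omega> u G \<Longrightarrow> has_weak_gradient \<Omega> u (weak_grad \<Omega> u)"
  unfolding weak_grad_def by (rule someI[where P="has_weak_gradient \<Omega> u"])

text \<open>Connects the gradient of an approximating test function with the weak gradients that occur in
  \<^const>\<open>W1px_norm\<close>: those are chosen separately for \<open>u\<close> and for \<open>u - \<phi>\<close>, and only uniqueness
  relates the two choices.\<close>

lemma weak_grad_diff_test_function:
  fixes \<Omega> :: "'a::euclidean_space set"
  assumes "open \<Omega>" "has_weak_gradient \<Omega> u G" and \<phi>: "\<phi> \<in> test_functions \<Omega>"
  shows "AE x in lebesgue_on \<Omega>.
    weak_grad \<Omega> (\<lambda>x. u x - \<phi> x) x = weak_grad \<Omega> u x - classical_gradient \<phi> x"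
proof -
  note d = has_weak_gradient_diff[OF \<open>open \<Omega>\<close> has_weak_gradient_weak_grad[OF assms(2)]
      has_weak_gradient_classical[OF \<open>open \<Omega>\<close> \<phi>]]
  show ?thesis
    by (rule has_weak_gradient_unique[OF \<open>open \<Omega>\<close> has_weak_gradient_weak_grad[OF d] d])
qed

section \<open>The maximal inequality\<close>

text \<open>The superlevel set \<open>{M g > l}\<close> of the Hardy--Littlewood maximal function, written without the
  supremum over all radii.\<close>

definition large_average_set :: "('a::euclidean_space \<Rightarrow> ennreal) \<Rightarrow> real \<Rightarrow> 'a set" where
  "large_average_set g l =
     {x. \<exists>r>0. ennreal l * emeasure lborel (ball x r) < (\<integral>\<^sup>+y. g y * indicator (ball x r) y \<partial>lborel)}"

lemma emeasure_lborel_ball_eq: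
  fixes c :: "'a::euclidean_space"
  assumes "0 \<le> r"
  shows "emeasure lborel (ball c r) = ennreal (r ^ DIM('a) * measure lborel (ball (0::'a) 1))"
  using content_ball_conv_unit_ball[OF assms, of c] emeasure_lborel_ball_finite[of c r]
  by (simp add: emeasure_eq_ennreal_measure)

lemma unit_ball_content_pos: "0 < measure lborel (ball (0::'a::euclidean_space) 1)"
  by (rule content_ball_pos) simp

text \<open>The Vitali covering lemma selects disjoint balls with average above \<open>l\<close> whose fivefold
  enlargements cover the level set. The union \<open>V\<close> of these enlargements is a Borel set, and it stands in
  for the level set in all later estimates.\<close>

lemma weak_type_estimate:
  fixes g :: "'a::euclidean_space \<Rightarrow> ennreal"
  assumes g: "g \<in> borel_measurable borel" and l: "0 < l"
  obtains V where "V \<in> sets borel" "large_average_set g l \<subseteq> V"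
    "ennreal l * emeasure lborel V \<le> ennreal (5 ^ DIM('a)) * (\<integral>\<^sup>+y. g y \<partial>lborel)"
proof (cases "(\<integral>\<^sup>+y. g y \<partial>lborel) = \<infinity>")
  case True
  then have "ennreal l * emeasure lborel (UNIV::'a set) \<le> ennreal (5 ^ DIM('a)) * (\<integral>\<^sup>+y. g y \<partial>lborel)"
    by (simp add: ennreal_mult_eq_top_iff)
  then show ?thesis by (intro that[of UNIV]) auto
next
  case False
  then obtain I where I: "(\<integral>\<^sup>+y. g y \<partial>lborel) = ennreal I" "0 \<le> I"
    by (cases "\<integral>\<^sup>+y. g y \<partial>lborel") auto
  let ?E = "large_average_set g l"
  let ?w = "measure lborel (ball (0::'a) 1)"
  have w: "0 < ?w" by (rule unit_ball_content_pos)
  have "\<forall>x\<in>?E. \<exists>r>0. ennreal l * emeasure lborel (ball x r) < (\<integral>\<^sup>+y. g y * indicator (ball x r) y \<partial>lborel)"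
    by (simp add: large_average_set_def)
  then obtain r where r: "\<And>x. x \<in> ?E \<Longrightarrow> 0 < r x"
    "\<And>x. x \<in> ?E \<Longrightarrow> ennreal l * emeasure lborel (ball x (r x)) < (\<integral>\<^sup>+y. g y * indicator (ball x (r x)) y \<partial>lborel)"
    by metis
  have bound: "0 < r x \<and> r x \<le> max 1 (I / (l * ?w))" if x: "x \<in> ?E" for x
  proof -
    have "ennreal l * emeasure lborel (ball x (r x)) < (\<integral>\<^sup>+y. g y * indicator (ball x (r x)) y \<partial>lborel)"
      by (rule r(2)[OF x])
    also have "\<dots> \<le> (\<integral>\<^sup>+y. g y \<partial>lborel)"
      by (intro nn_integral_mono) (auto simp: indicator_def)
    finally have "ennreal (l * (r x ^ DIM('a) * ?w)) < ennreal I"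
      using r(1)[OF x] l w by (simp add: emeasure_lborel_ball_eq I ennreal_mult)
    then have "r x ^ DIM('a) < I / (l * ?w)"
      using l w r(1)[OF x] by (simp add: ennreal_less_iff field_simps)
    moreover have "r x \<le> r x ^ DIM('a)" if "1 \<le> r x"
      using that self_le_power[of "r x" "DIM('a)"] by simp
    ultimately show ?thesis using r(1)[OF x] by fastforce
  qed
  have "?E \<subseteq> (\<Union>x\<in>?E. ball x (r x))" using r(1) by force
  from Vitali_covering_lemma_balls[where a="\<lambda>x. x" and r=r, OF this bound]
  obtain C where C: "countable C" "C \<subseteq> ?E"
    "pairwise (\<lambda>i j. disjnt (ball i (r i)) (ball j (r j))) C" "?E \<subseteq> (\<Union>i\<in>C. ball i (5 * r i))"
    by blast
  define P where "P n \<longleftrightarrow> n \<in> to_nat_on C ` C" for n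
  define e where "e = from_nat_into C"
  have e: "e n \<in> C" "to_nat_on C (e n) = n" if "P n" for n
    using that C(1) by (auto simp: P_def e_def)
  define X where "X n = (if P n then ball (e n) (r (e n)) else {})" for n
  define D where "D n = (if P n then ball (e n) (5 * r (e n)) else {})" for n
  define V where "V = (\<Union>n. D n)"
  have "?E \<subseteq> V"
  proof
    fix x assume "x \<in> ?E"
    then obtain i where i: "i \<in> C" "x \<in> ball i (5 * r i)" using C(4) by blast
    then have "P (to_nat_on C i)" "e (to_nat_on C i) = i"
      using C(1) by (auto simp: P_def e_def)
    then have "x \<in> D (to_nat_on C i)" using i(2) by (simp add: D_def)
    then show "x \<in> V" by (auto simp: V_def)
  qed
  moreover have "V \<in> sets borel" unfolding V_def D_def by auto
  moreover have "ennreal l * emeasure lborel V \<le> ennreal (5 ^ DIM('a)) * (\<integral>\<^sup>+y. g y \<partial>lborel)"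
  proof -
    have disj: "disjoint_family X"
      unfolding disjoint_family_on_def
    proof (intro ballI impI)
      fix m n :: nat assume "m \<noteq> n"
      show "X m \<inter> X n = {}"
      proof (cases "P m \<and> P n")
        case True
        then have "e m \<noteq> e n" using e(2) \<open>m \<noteq> n\<close> by metis
        then have "disjnt (ball (e m) (r (e m))) (ball (e n) (r (e n)))"
          using C(3) True e(1) by (simp add: pairwise_def)
        then show ?thesis using True by (simp add: X_def disjnt_def)
      qed (auto simp: X_def)
    qed
    let ?\<nu> = "density lborel g"
    have gm: "g \<in> borel_measurable lborel" using g by simp
    have X: "range X \<subseteq> sets ?\<nu>" by (auto simp: X_def)
    have each: "ennreal l * emeasure lborel (D n) \<le> ennreal (5 ^ DIM('a)) * emeasure ?\<nu> (X n)" for n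
    proof (cases "P n")
      case True
      then have x: "e n \<in> ?E" using e(1) C(2) by blast
      have "ennreal l * emeasure lborel (D n)
          = ennreal (5 ^ DIM('a)) * (ennreal l * emeasure lborel (ball (e n) (r (e n))))"
        using True r(1)[OF x] l w
        by (simp add: D_def emeasure_lborel_ball_eq power_mult_distrib mult_ac flip: ennreal_mult)
      also have "\<dots> \<le> ennreal (5 ^ DIM('a)) * (\<integral>\<^sup>+y. g y * indicator (ball (e n) (r (e n))) y \<partial>lborel)"
        using r(2)[OF x] by (intro mult_left_mono) auto
      also have "\<dots> = ennreal (5 ^ DIM('a)) * emeasure ?\<nu> (X n)"
        using True gm by (simp add: X_def emeasure_density)
      finally show ?thesis .
    qed (simp add: D_def)
    have "ennreal l * emeasure lborel V \<le> ennreal l * (\<Sum>n. emeasure lborel (D n))"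
      unfolding V_def by (intro mult_left_mono emeasure_subadditive_countably) (auto simp: D_def)
    also have "\<dots> = (\<Sum>n. ennreal l * emeasure lborel (D n))"
      by (simp add: ennreal_suminf_cmult)
    also have "\<dots> \<le> (\<Sum>n. ennreal (5 ^ DIM('a)) * emeasure ?\<nu> (X n))"
      by (intro suminf_le each) auto
    also have "\<dots> = ennreal (5 ^ DIM('a)) * (\<Sum>n. emeasure ?\<nu> (X n))"
      by (simp add: ennreal_suminf_cmult)
    also have "(\<Sum>n. emeasure ?\<nu> (X n)) = emeasure ?\<nu> (\<Union>n. X n)"
      by (rule suminf_emeasure[OF X disj])
    also have "\<dots> \<le> emeasure ?\<nu> (space ?\<nu>)"
      by (rule emeasure_space)
    also have "\<dots> = (\<integral>\<^sup>+y. g y \<partial>lborel)"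
      using gm by (simp add: emeasure_density)
    finally show ?thesis by (simp add: mult_left_mono)
  qed
  ultimately show ?thesis using that by blast
qed

text \<open>The part of \<open>g\<close> below \<open>l\<close> contributes at most \<open>l\<close> to any average, so an average above
  \<open>2 * l\<close> leaves more than \<open>l\<close> for the part above \<open>l\<close>.\<close>

lemma large_average_set_truncate:
  fixes g :: "'a::euclidean_space \<Rightarrow> ennreal"
  assumes g: "g \<in> borel_measurable borel" and l: "0 < l"
  shows "large_average_set g (2 * l) \<subseteq> large_average_set (\<lambda>y. g y * indicator {y. ennreal l < g y} y) l"
proof
  fix x assume "x \<in> large_average_set g (2 * l)"
  then obtain r where "0 < r" and
    r: "ennreal (2 * l) * emeasure lborel (ball x r) < (\<integral>\<^sup>+y. g y * indicator (ball x r) y \<partial>lborel)"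
    by (auto simp: large_average_set_def)
  let ?h = "\<lambda>y. g y * indicator {y. ennreal l < g y} y"
  have [measurable]: "g \<in> borel_measurable borel" "ball x r \<in> sets borel" by (fact, simp)
  have fin: "ennreal l * emeasure lborel (ball x r) \<noteq> \<infinity>"
    using \<open>0 < r\<close> by (simp add: emeasure_lborel_ball_eq ennreal_mult_eq_top_iff)
  have "ennreal l * emeasure lborel (ball x r) + ennreal l * emeasure lborel (ball x r)
      = ennreal (2 * l) * emeasure lborel (ball x r)"
  proof -
    have "ennreal (2 * l) = ennreal l + ennreal l"
      using l by (simp flip: ennreal_plus)
    then show ?thesis by (simp only: distrib_right)
  qed
  also note r
  also have "(\<integral>\<^sup>+y. g y * indicator (ball x r) y \<partial>lborel)
      \<le> (\<integral>\<^sup>+y. ennreal l * indicator (ball x r) y + ?h y * indicator (ball x r) y \<partial>lborel)"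
    by (intro nn_integral_mono) (auto simp: indicator_def not_less)
  also have "\<dots> = ennreal l * emeasure lborel (ball x r) + (\<integral>\<^sup>+y. ?h y * indicator (ball x r) y \<partial>lborel)"
    by (subst nn_integral_add) (measurable, simp add: nn_integral_cmult_indicator)
  finally have "ennreal l * emeasure lborel (ball x r) < (\<integral>\<^sup>+y. ?h y * indicator (ball x r) y \<partial>lborel)"
    using fin by (simp add: ennreal_add_left_cancel_less)
  then show "x \<in> large_average_set ?h l"
    using \<open>0 < r\<close> by (auto simp: large_average_set_def)
qed

text \<open>A geometric sum is a constant times its largest term, which is at most \<open>t powr (q - 1)\<close>.\<close>

lemma sum_dyadic_powers_le:
  fixes q t :: real
  assumes "1 < q" "0 \<le> t"
  defines "a \<equiv> 2 powr (q - 1)"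
  shows "(\<Sum>k<n. a ^ k * of_bool (2 ^ k < t)) \<le> a / (a - 1) * t powr (q - 1)"
proof (induction n)
  case 0
  have "1 < a" using \<open>1 < q\<close> by (simp add: a_def)
  then show ?case by simp
next
  case (Suc n)
  have a: "1 < a" using \<open>1 < q\<close> by (simp add: a_def)
  show ?case
  proof (cases "2 ^ n < t")
    case True
    have "(\<Sum>k<Suc n. a ^ k * of_bool (2 ^ k < t)) \<le> (\<Sum>k<Suc n. a ^ k)"
      using a by (intro sum_mono) auto
    also have "\<dots> = (a ^ Suc n - 1) / (a - 1)"
      using a by (subst geometric_sum) auto
    also have "\<dots> \<le> a / (a - 1) * a ^ n"
      using a by (simp add: divide_simps)
    also have "a ^ n = (2 ^ n) powr (q - 1)"
      by (simp add: a_def powr_powr mult.commute flip: powr_realpow)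
    also have "a / (a - 1) * (2 ^ n) powr (q - 1) \<le> a / (a - 1) * t powr (q - 1)"
      using a True \<open>1 < q\<close> by (intro mult_left_mono powr_mono2) auto
    finally show ?thesis .
  qed (use Suc in simp)
qed

text \<open>The strong type \<open>(q, q)\<close> bound for the maximal function \<open>M g\<close>: the hypothesis says
  \<open>F \<le> C * (max 1 (M g)) powr q\<close> on \<open>S\<close>. The proof is the interpolation argument of Marcinkiewicz with
  dyadic levels in place of an integral over all levels. On the level set of \<open>2 ^ k\<close> only the part of \<open>g\<close>
  above \<open>2 ^ k / 2\<close> matters, and summing the weak type estimates over \<open>k\<close> gives a geometric series
  in which \<open>g powr (q - 1)\<close> reappears.\<close>

lemma nn_integral_le_of_large_average_sets:
  fixes g F :: "'a::euclidean_space \<Rightarrow> real" and q :: real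
  defines "K \<equiv> 5 ^ DIM('a) * 2 powr q * 2 * (2 powr (q - 1) / (2 powr (q - 1) - 1)) * 2 powr (q - 1)"
  assumes q: "1 < q" and g: "g \<in> borel_measurable borel" "\<And>x. 0 \<le> g x" "\<And>x. g x \<le> M"
    and C: "0 \<le> C" and S: "S \<in> sets borel"
    and F: "\<And>x l. x \<in> S \<Longrightarrow> 1 \<le> l \<Longrightarrow> x \<notin> large_average_set (\<lambda>y. ennreal (g y)) l \<Longrightarrow> F x \<le> C * l powr q"
  shows "(\<integral>\<^sup>+x. ennreal (F x) * indicator S x \<partial>lborel)
    \<le> ennreal C * (emeasure lborel S + ennreal K * (\<integral>\<^sup>+x. ennreal (g x powr q) \<partial>lborel))"
proof -
  let ?E = "\<lambda>k::nat. large_average_set (\<lambda>y. ennreal (g y)) (2 ^ k)"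
  let ?h = "\<lambda>k::nat. \<lambda>y. ennreal (g y) * indicator {y. ennreal (2 ^ k / 2) < ennreal (g y)} y"
  have [measurable]: "g \<in> borel_measurable borel" by fact
  have ex_V: "\<forall>k. \<exists>V. V \<in> sets borel \<and> ?E k \<subseteq> V \<and>
      ennreal (2 ^ k / 2) * emeasure lborel V \<le> ennreal (5 ^ DIM('a)) * (\<integral>\<^sup>+y. ?h k y \<partial>lborel)"
  proof
    fix k
    have "?E k \<subseteq> large_average_set (?h k) (2 ^ k / 2)"
      using large_average_set_truncate[of "\<lambda>y. ennreal (g y)" "2 ^ k / 2"] by simp
    moreover obtain V where "V \<in> sets borel" "large_average_set (?h k) (2 ^ k / 2) \<subseteq> V"
      "ennreal (2 ^ k / 2) * emeasure lborel V \<le> ennreal (5 ^ DIM('a)) * (\<integral>\<^sup>+y. ?h k y \<partial>lborel)"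
      by (rule weak_type_estimate[of "?h k" "2 ^ k / 2"]) auto
    ultimately show "\<exists>V. V \<in> sets borel \<and> ?E k \<subseteq> V \<and>
        ennreal (2 ^ k / 2) * emeasure lborel V \<le> ennreal (5 ^ DIM('a)) * (\<integral>\<^sup>+y. ?h k y \<partial>lborel)"
      by blast
  qed
  obtain V where "\<forall>k. V k \<in> sets borel \<and> ?E k \<subseteq> V k \<and>
      ennreal (2 ^ k / 2) * emeasure lborel (V k) \<le> ennreal (5 ^ DIM('a)) * (\<integral>\<^sup>+y. ?h k y \<partial>lborel)"
    using choice[OF ex_V] by (rule exE)
  then have V: "V k \<in> sets borel" "?E k \<subseteq> V k"
      "ennreal (2 ^ k / 2) * emeasure lborel (V k) \<le> ennreal (5 ^ DIM('a)) * (\<integral>\<^sup>+y. ?h k y \<partial>lborel)" for k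
    by simp_all
  define b where "b k = (2 ^ Suc k) powr q" for k :: nat
  have pointwise: "ennreal (F x) * indicator S x
      \<le> ennreal C * (indicator S x + (\<Sum>k. ennreal (b k) * indicator (V k) x))" for x
  proof (cases "x \<in> S")
    case True
    obtain n where "M \<le> 2 ^ n"
      using real_arch_pow[of 2 M] by (auto intro: less_imp_le)
    have "x \<notin> ?E n"
    proof
      assume "x \<in> ?E n"
      then obtain r where "0 < r" and
        r: "ennreal (2 ^ n) * emeasure lborel (ball x r) < (\<integral>\<^sup>+y. ennreal (g y) * indicator (ball x r) y \<partial>lborel)"
        by (auto simp: large_average_set_def)
      have "(\<integral>\<^sup>+y. ennreal (g y) * indicator (ball x r) y \<partial>lborel)
          \<le> (\<integral>\<^sup>+y. ennreal (2 ^ n) * indicator (ball x r) y \<partial>lborel)"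
        using g(3) \<open>M \<le> 2 ^ n\<close> by (intro nn_integral_mono mult_right_mono ennreal_leI) (auto intro: order_trans)
      also have "\<dots> = ennreal (2 ^ n) * emeasure lborel (ball x r)"
        by (simp add: nn_integral_cmult_indicator)
      finally show False using r by simp
    qed
    then have ex: "\<exists>k. x \<notin> ?E k" by blast
    \<comment> \<open>Boundedness of \<open>g\<close> makes the levels terminate; the last level reached pays for \<open>F x\<close>.\<close>
    define k where "k = (LEAST k. x \<notin> ?E k)"
    have k: "x \<notin> ?E k" unfolding k_def using ex by (rule LeastI_ex)
    then have Fk: "F x \<le> C * (2 ^ k) powr q" using F[OF True] by simp
    show ?thesis
    proof (cases k)
      case 0
      then have "ennreal (F x) \<le> ennreal C" using Fk by (simp add: ennreal_leI)
      also have "\<dots> \<le> ennreal C * (indicator S x + (\<Sum>k. ennreal (b k) * indicator (V k) x))"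
        using True mult_left_mono[of 1 "1 + (\<Sum>k. ennreal (b k) * indicator (V k) x)" "ennreal C"] by simp
      finally show ?thesis using True by simp
    next
      case (Suc j)
      then have "x \<in> ?E j" using not_less_Least[of j "\<lambda>k. x \<notin> ?E k"] by (simp add: k_def)
      then have j: "x \<in> V j" using V(2) by blast
      have "ennreal (F x) \<le> ennreal C * ennreal (b j)"
        using Fk Suc C by (simp add: ennreal_leI b_def flip: ennreal_mult)
      also have "ennreal (b j) = (\<Sum>k\<in>{j}. ennreal (b k) * indicator (V k) x)" using j by simp
      also have "\<dots> \<le> (\<Sum>k. ennreal (b k) * indicator (V k) x)"
        by (intro sum_le_suminf) auto
      also have "\<dots> \<le> indicator S x + (\<Sum>k. ennreal (b k) * indicator (V k) x)" by simp
      finally show ?thesis using True by (simp add: mult_left_mono)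
    qed
  qed simp
  have level: "ennreal (b k) * emeasure lborel (V k)
      \<le> (\<integral>\<^sup>+y. ennreal (5 ^ DIM('a) * 2 powr q * 2) *
            ennreal (g y * ((2 powr (q - 1)) ^ k * of_bool (2 ^ k < 2 * g y))) \<partial>lborel)" for k
  proof -
    have b: "b k = 2 powr q * 2 * (2 powr (q - 1)) ^ k * (2 ^ k / 2)"
    proof -
      have "b k = 2 powr (real (Suc k) * q)"
      proof -
        have "(2::real) ^ Suc k = 2 powr real (Suc k)"
          by (rule powr_realpow[symmetric]) simp
        then show ?thesis by (simp only: b_def powr_powr)
      qed
      moreover have "(2 powr (q - 1)) ^ k = 2 powr ((q - 1) * real k)"
        by (simp add: powr_powr flip: powr_realpow)
      moreover have "(2::real) ^ k = 2 powr (real k)" by (simp add: powr_realpow)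
      ultimately show ?thesis by (simp add: algebra_simps flip: powr_add)
    qed
    have "ennreal (b k) * emeasure lborel (V k)
        = ennreal (2 powr q * 2 * (2 powr (q - 1)) ^ k) * (ennreal (2 ^ k / 2) * emeasure lborel (V k))"
      unfolding b by (subst ennreal_mult) (auto simp: mult.assoc)
    also have "\<dots> \<le> ennreal (2 powr q * 2 * (2 powr (q - 1)) ^ k) *
        (ennreal (5 ^ DIM('a)) * (\<integral>\<^sup>+y. ?h k y \<partial>lborel))"
      by (intro mult_left_mono V(3)) simp
    also have "\<dots> = (\<integral>\<^sup>+y. ennreal (2 powr q * 2 * (2 powr (q - 1)) ^ k) *
        (ennreal (5 ^ DIM('a)) * ?h k y) \<partial>lborel)"
      by (simp add: nn_integral_cmult)
    also have "\<dots> \<le> (\<integral>\<^sup>+y. ennreal (5 ^ DIM('a) * 2 powr q * 2) *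
            ennreal (g y * ((2 powr (q - 1)) ^ k * of_bool (2 ^ k < 2 * g y))) \<partial>lborel)"
      using g(2)
      by (intro nn_integral_mono)
         (auto simp: indicator_def ennreal_less_iff mult_ac simp flip: ennreal_mult)
    finally show ?thesis .
  qed
  have inner: "(\<Sum>k. ennreal (5 ^ DIM('a) * 2 powr q * 2) *
            ennreal (g y * ((2 powr (q - 1)) ^ k * of_bool (2 ^ k < 2 * g y))))
      \<le> ennreal K * ennreal (g y powr q)" for y
  proof -
    define a where "a = 2 powr (q - 1)"
    have a: "1 < a" using q by (simp add: a_def)
    have "(\<Sum>k. ennreal (g y * (a ^ k * of_bool (2 ^ k < 2 * g y))))
        \<le> ennreal (a / (a - 1) * a * g y powr q)"
      unfolding suminf_eq_SUP
    proof (rule SUP_least)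
      fix n
      have "(\<Sum>k<n. g y * (a ^ k * of_bool (2 ^ k < 2 * g y))) =
          g y * (\<Sum>k<n. a ^ k * of_bool (2 ^ k < 2 * g y))"
        by (rule sum_distrib_left[symmetric])
      also have "\<dots> \<le> g y * (a / (a - 1) * (2 * g y) powr (q - 1))"
        using g(2)[of y] sum_dyadic_powers_le[OF q, of "2 * g y" n]
        by (intro mult_left_mono) (auto simp: a_def)
      also have "\<dots> = a / (a - 1) * a * (g y * g y powr (q - 1))"
        using g(2)[of y] by (simp add: powr_mult a_def)
      also have "g y * g y powr (q - 1) = g y powr q"
        using g(2)[of y] powr_mult_base[of "g y" "q - 1"] by simp
      finally show "(\<Sum>k<n. ennreal (g y * (a ^ k * of_bool (2 ^ k < 2 * g y))))
          \<le> ennreal (a / (a - 1) * a * g y powr q)"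
        using g(2)[of y] a by (subst sum_ennreal) (auto intro!: ennreal_leI)
    qed
    then have "ennreal (5 ^ DIM('a) * 2 powr q * 2) * (\<Sum>k. ennreal (g y * (a ^ k * of_bool (2 ^ k < 2 * g y))))
       \<le> ennreal (5 ^ DIM('a) * 2 powr q * 2) * ennreal (a / (a - 1) * a * g y powr q)"
      by (rule mult_left_mono) simp
    also have "\<dots> = ennreal (5 ^ DIM('a) * 2 powr q * 2 * (a / (a - 1) * a * g y powr q))"
      using a by (subst ennreal_mult) auto
    also have "5 ^ DIM('a) * 2 powr q * 2 * (a / (a - 1) * a * g y powr q) = K * g y powr q"
      unfolding K_def a_def by (simp only: mult.assoc)
    also have "ennreal (K * g y powr q) = ennreal K * ennreal (g y powr q)"
      by (rule ennreal_mult'') simp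
    finally show ?thesis unfolding a_def by simp
  qed
  have "(\<integral>\<^sup>+x. ennreal (F x) * indicator S x \<partial>lborel)
      \<le> (\<integral>\<^sup>+x. ennreal C * (indicator S x + (\<Sum>k. ennreal (b k) * indicator (V k) x)) \<partial>lborel)"
    by (intro nn_integral_mono pointwise)
  also have "\<dots> = ennreal C * (emeasure lborel S + (\<Sum>k. ennreal (b k) * emeasure lborel (V k)))"
    using S V(1) by (simp add: nn_integral_cmult nn_integral_add nn_integral_suminf)
  also have "(\<Sum>k. ennreal (b k) * emeasure lborel (V k))
      \<le> (\<Sum>k. \<integral>\<^sup>+y. ennreal (5 ^ DIM('a) * 2 powr q * 2) *
            ennreal (g y * ((2 powr (q - 1)) ^ k * of_bool (2 ^ k < 2 * g y))) \<partial>lborel)"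
    by (intro suminf_le level) auto
  also have "\<dots> = (\<integral>\<^sup>+y. (\<Sum>k. ennreal (5 ^ DIM('a) * 2 powr q * 2) *
            ennreal (g y * ((2 powr (q - 1)) ^ k * of_bool (2 ^ k < 2 * g y)))) \<partial>lborel)"
    by (rule nn_integral_suminf[symmetric]) measurable
  also have "\<dots> \<le> (\<integral>\<^sup>+y. ennreal K * ennreal (g y powr q) \<partial>lborel)"
    by (intro nn_integral_mono inner)
  also have "\<dots> = ennreal K * (\<integral>\<^sup>+y. ennreal (g y powr q) \<partial>lborel)"
    by (rule nn_integral_cmult) measurable
  finally show ?thesis
    by (simp add: mult_left_mono add_left_mono)
qed

section \<open>Controlling a function by averages of its gradient\<close>

lemma norm_diff_le_line_integral:
  fixes \<phi> :: "'a::euclidean_space \<Rightarrow> real"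
  assumes \<phi>: "\<phi> \<in> test_functions \<Omega>"
  shows "ennreal \<bar>\<phi> y - \<phi> x\<bar>
    \<le> (\<integral>\<^sup>+s. ennreal (norm (classical_gradient \<phi> (x + s *\<^sub>R (y - x))) * norm (y - x)) * indicator {0..1} s \<partial>lborel)"
proof -
  let ?G = "\<lambda>s. classical_gradient \<phi> (x + s *\<^sub>R (y - x))"
  have d: "((\<lambda>s. \<phi> (x + s *\<^sub>R (y - x))) has_vector_derivative ?G s \<bullet> (y - x)) (at s within {0..1})" for s
  proof -
    have "((\<lambda>s. x + s *\<^sub>R (y - x)) has_derivative (\<lambda>h. h *\<^sub>R (y - x))) (at s within {0..1})"
      by (auto intro!: derivative_eq_intros)
    from has_derivative_compose[OF this test_functionD(5)[OF \<phi>]]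
    show ?thesis
      by (simp add: frechet_derivative_eq_inner[OF \<phi>] has_vector_derivative_def)
  qed
  have cG: "continuous_on S ?G" for S
    by (rule continuous_on_compose2[OF continuous_classical_gradient[OF \<phi>, of UNIV]])
       (auto intro!: continuous_intros)
  have "((\<lambda>s. ?G s \<bullet> (y - x)) has_integral \<phi> y - \<phi> x) {0..1}"
    using fundamental_theorem_of_calculus[of 0 1, OF _ d] by simp
  moreover have "continuous_on {0..1} (\<lambda>s. norm (?G s) * norm (y - x))"
    by (intro continuous_intros cG)
  then have int: "((\<lambda>s. norm (?G s) * norm (y - x)) has_integral
      integral {0..1} (\<lambda>s. norm (?G s) * norm (y - x))) {0..1}"
    using integrable_continuous_real by blast
  moreover have "norm (?G s \<bullet> (y - x)) \<le> norm (?G s) * norm (y - x)" for s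
    by (simp add: Cauchy_Schwarz_ineq2)
  ultimately have "\<bar>\<phi> y - \<phi> x\<bar> \<le> integral {0..1} (\<lambda>s. norm (?G s) * norm (y - x))"
    using Henstock_Kurzweil_Integration.integral_norm_bound_integral[of "\<lambda>s. ?G s \<bullet> (y - x)" "{0..1}" "\<lambda>s. norm (?G s) * norm (y - x)"]
    by (simp add: has_integral_iff)
  then show ?thesis
    using nn_integral_has_integral_lebesgue'[OF _ int] by (simp add: ennreal_leI)
qed

lemma nn_integral_lborel_affine:
  fixes h :: "'a::euclidean_space \<Rightarrow> ennreal"
  assumes "h \<in> borel_measurable borel" "0 < s"
  shows "(\<integral>\<^sup>+x. h x \<partial>lborel) = ennreal (s ^ DIM('a)) * (\<integral>\<^sup>+x. h (t + s *\<^sub>R x) \<partial>lborel)"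
  using assms
  by (subst lborel_affine[of s t])
     (auto simp: nn_integral_density nn_integral_distr nn_integral_cmult)

text \<open>Since \<open>\<phi>\<close> vanishes on \<open>ball z \<rho>\<close>, the value \<open>\<phi> x\<close> is a line integral of the gradient from
  \<open>x\<close> to any point of that ball. Averaging over these points and exchanging the integrals leaves, for
  each \<open>s\<close>, the integral of the gradient over the ball shrunk by the factor \<open>s\<close> towards \<open>x\<close>, which
  is contained in \<open>ball x (s * R)\<close>. The Jacobian \<open>s ^ DIM('a)\<close> cancels against the volume of the
  latter, so the bound is uniform in \<open>s\<close>.\<close>

lemma test_function_le_gradient_averages:
  fixes \<phi> :: "'a::euclidean_space \<Rightarrow> real"
  assumes \<phi>: "\<phi> \<in> test_functions \<Omega>" and z: "\<And>y. y \<in> ball z \<rho> \<Longrightarrow> \<phi> y = 0"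
    and \<rho>: "0 < \<rho>" "ball z \<rho> \<subseteq> ball x R" and "0 \<le> A"
    and avg: "\<And>r. 0 < r \<Longrightarrow> (\<integral>\<^sup>+y. ennreal (norm (classical_gradient \<phi> y)) * indicator (ball x r) y \<partial>lborel)
      \<le> ennreal A * emeasure lborel (ball x r)"
  shows "\<bar>\<phi> x\<bar> \<le> R * (R / \<rho>) ^ DIM('a) * A"
proof -
  let ?n = "DIM('a)"
  let ?w = "measure lborel (ball (0::'a) 1)"
  let ?f = "\<lambda>y. norm (classical_gradient \<phi> y)"
  have w: "0 < ?w" by (rule unit_ball_content_pos)
  have "z \<in> ball z \<rho>" using \<rho>(1) by simp
  then have "z \<in> ball x R" using \<rho>(2) by (rule subsetD[rotated])
  then have R: "0 < R" using zero_le_dist[of x z] unfolding mem_ball by linarith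
  have [measurable]: "classical_gradient \<phi> \<in> borel_measurable borel"
    by (intro borel_measurable_continuous_onI continuous_classical_gradient[OF \<phi>])
  have [measurable]: "ball z r \<in> sets borel" for z :: 'a and r by simp
  let ?k = "\<lambda>y s. ennreal (R * ?f (x + s *\<^sub>R (y - x))) * indicator {0..1} s * indicator (ball z \<rho>) y"
  have "ennreal \<bar>\<phi> x\<bar> * emeasure lborel (ball z \<rho>) = (\<integral>\<^sup>+y. ennreal \<bar>\<phi> x\<bar> * indicator (ball z \<rho>) y \<partial>lborel)"
    by (simp add: nn_integral_cmult_indicator)
  also have "\<dots> \<le> (\<integral>\<^sup>+y. (\<integral>\<^sup>+s. ?k y s \<partial>lborel) \<partial>lborel)"
  proof (rule nn_integral_mono)
    fix y
    show "ennreal \<bar>\<phi> x\<bar> * indicator (ball z \<rho>) y \<le> (\<integral>\<^sup>+s. ?k y s \<partial>lborel)"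
    proof (cases "y \<in> ball z \<rho>")
      case True
      then have "y \<in> ball x R" using \<rho>(2) by blast
      then have "norm (y - x) \<le> R" by (simp add: dist_norm norm_minus_commute)
      have "ennreal \<bar>\<phi> x\<bar> = ennreal \<bar>\<phi> y - \<phi> x\<bar>" using z[OF True] by simp
      also have "\<dots> \<le> (\<integral>\<^sup>+s. ennreal (?f (x + s *\<^sub>R (y - x)) * norm (y - x)) * indicator {0..1} s \<partial>lborel)"
        by (rule norm_diff_le_line_integral[OF \<phi>])
      also have "\<dots> \<le> (\<integral>\<^sup>+s. ?k y s \<partial>lborel)"
        using True \<open>norm (y - x) \<le> R\<close>
        by (intro nn_integral_mono) (auto simp: indicator_def mult.commute[of _ "norm (y - x)"] intro!: ennreal_leI mult_right_mono)
      finally show ?thesis using True by simp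
    qed simp
  qed
  also have "\<dots> = (\<integral>\<^sup>+s. (\<integral>\<^sup>+y. ?k y s \<partial>lborel) \<partial>lborel)"
    by (rule lborel_pair.Fubini'[symmetric]) measurable
  also have "\<dots> \<le> (\<integral>\<^sup>+(s::real). ennreal (R * A * (R ^ ?n * ?w)) * indicator {0..1} s \<partial>lborel)"
  proof (rule nn_integral_mono_AE)
    have "AE s in lborel. s \<noteq> (0::real)" by (rule AE_lborel_singleton)
    then show "AE s in lborel. (\<integral>\<^sup>+y. ?k y s \<partial>lborel) \<le> ennreal (R * A * (R ^ ?n * ?w)) * indicator {0..1} s"
    proof eventually_elim
      case (elim s)
      show ?case
      proof (cases "s \<in> {0..1}")
        case True
        then have s: "0 < s" using elim by simp
        let ?g = "\<lambda>y. ennreal (?f y) * indicator (ball x (s * R)) y"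
        have eq: "(x - s *\<^sub>R x) + s *\<^sub>R y = x + s *\<^sub>R (y - x)" for y
          by (simp add: algebra_simps)
        have "ennreal (s ^ ?n) * (\<integral>\<^sup>+y. ?g (x + s *\<^sub>R (y - x)) \<partial>lborel) = (\<integral>\<^sup>+y. ?g y \<partial>lborel)"
          using nn_integral_lborel_affine[of ?g s "x - s *\<^sub>R x"] s unfolding eq by simp
        also have "\<dots> \<le> ennreal A * emeasure lborel (ball x (s * R))"
          using s R by (intro avg) simp
        also have "\<dots> = ennreal (s ^ ?n) * ennreal (A * (R ^ ?n * ?w))"
          using s R \<open>0 \<le> A\<close> w
          by (simp add: emeasure_lborel_ball_eq power_mult_distrib mult_ac flip: ennreal_mult)
        finally have le: "(\<integral>\<^sup>+y. ?g (x + s *\<^sub>R (y - x)) \<partial>lborel) \<le> ennreal (A * (R ^ ?n * ?w))"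
          using s by (simp add: ennreal_mult_le_mult_iff)
        have "(\<integral>\<^sup>+y. ?k y s \<partial>lborel) \<le> (\<integral>\<^sup>+y. ennreal R * ?g (x + s *\<^sub>R (y - x)) \<partial>lborel)"
        proof (rule nn_integral_mono)
          fix y
          show "?k y s \<le> ennreal R * ?g (x + s *\<^sub>R (y - x))"
          proof (cases "y \<in> ball z \<rho>")
            case inb: True
            then have "y \<in> ball x R" using \<rho>(2) by blast
            then have "norm (y - x) < R" by (simp add: dist_norm norm_minus_commute)
            then have "x + s *\<^sub>R (y - x) \<in> ball x (s * R)"
              using s by (simp add: dist_norm)
            then show ?thesis using True inb R by (simp add: ennreal_mult)
          qed simp
        qed
        also have "\<dots> = ennreal R * (\<integral>\<^sup>+y. ?g (x + s *\<^sub>R (y - x)) \<partial>lborel)"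
          by (rule nn_integral_cmult) measurable
        also have "\<dots> \<le> ennreal R * ennreal (A * (R ^ ?n * ?w))"
          by (intro mult_left_mono le) simp
        also have "\<dots> = ennreal (R * A * (R ^ ?n * ?w))"
          using R \<open>0 \<le> A\<close> w by (simp add: mult.assoc flip: ennreal_mult)
        finally show ?thesis using True by simp
      qed simp
    qed
  qed
  also have "\<dots> = ennreal (R * A * (R ^ ?n * ?w))"
    by (simp add: nn_integral_cmult_indicator)
  finally have "ennreal (\<bar>\<phi> x\<bar> * (\<rho> ^ ?n * ?w)) \<le> ennreal (R * A * (R ^ ?n * ?w))"
    using \<rho>(1) w by (simp add: emeasure_lborel_ball_eq ennreal_mult)
  then have "\<bar>\<phi> x\<bar> * \<rho> ^ ?n * ?w \<le> R * A * R ^ ?n * ?w"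
    using R \<open>0 \<le> A\<close> w by (simp add: mult.assoc)
  then have "\<bar>\<phi> x\<bar> * \<rho> ^ ?n \<le> R * A * R ^ ?n" using w by simp
  then show ?thesis
    using \<rho>(1) by (simp add: power_divide field_simps)
qed

section \<open>Log-Hoelder exponents\<close>

lemma log_hoelder_continuous_on:
  assumes "log_hoelder \<Omega> p"
  shows "continuous_on (closure \<Omega>) p"
  unfolding continuous_on_iff
proof (intro ballI allI impI)
  fix x e assume x: "x \<in> closure \<Omega>" and e: "0 < (e::real)"
  obtain C where C: "0 < C" "\<And>x y. x \<in> closure \<Omega> \<Longrightarrow> y \<in> closure \<Omega> \<Longrightarrow> x \<noteq> y \<Longrightarrow>
      \<bar>p x - p y\<bar> \<le> C / ln (exp 1 + 1 / dist x y)"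
    using assms unfolding log_hoelder_def by auto
  show "\<exists>d>0. \<forall>y\<in>closure \<Omega>. dist y x < d \<longrightarrow> dist (p y) (p x) < e"
  proof (intro exI conjI ballI impI)
    show "0 < exp (- (C / e))" by simp
    fix y assume y: "y \<in> closure \<Omega>" and d: "dist y x < exp (- (C / e))"
    show "dist (p y) (p x) < e"
    proof (cases "x = y")
      case False
      then have pos: "0 < dist x y" by simp
      then have "exp (C / e) < 1 / dist x y"
        using d by (simp add: exp_minus dist_commute divide_simps mult.commute)
      then have "exp (C / e) < exp 1 + 1 / dist x y"
        using exp_gt_zero[of "1::real"] by linarith
      then have "ln (exp (C / e)) < ln (exp 1 + 1 / dist x y)"
        by (intro ln_less_cancel_iff[THEN iffD2]) (auto intro: less_trans[OF exp_gt_zero])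
      then have L: "C / e < ln (exp 1 + 1 / dist x y)" by simp
      moreover have "0 < C / e" using C(1) e by simp
      ultimately have "0 < ln (exp 1 + 1 / dist x y)" by linarith
      then have "C / ln (exp 1 + 1 / dist x y) < e"
        using L e by (simp add: divide_less_eq mult.commute)
      then show ?thesis
        using C(2)[OF x y False] by (simp add: dist_real_def abs_minus_commute)
    qed (use e in simp)
  qed
qed

text \<open>An average over \<open>ball x r\<close> of a function with modular at most one is at most \<open>1\<close> plus the
  reciprocal of the measure of the ball, hence of order \<open>r powr (- DIM('a))\<close> for small \<open>r\<close>, while the
  exponent oscillates on that ball by at most \<open>C / ln (exp 1 + 1 / r)\<close>. The logarithms cancel, so raising the
  average to the oscillation of the exponent costs only a constant.\<close>

lemma log_hoelder_powr_le:
  fixes \<Omega> :: "'a::euclidean_space set"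
  assumes "log_hoelder \<Omega> p"
  obtains K where "1 \<le> K"
    "\<And>x y r a. x \<in> \<Omega> \<Longrightarrow> y \<in> \<Omega> \<Longrightarrow> dist x y < r \<Longrightarrow> 1 \<le> a \<Longrightarrow>
       a \<le> 1 + 1 / measure lborel (ball x r) \<Longrightarrow> a powr \<bar>p x - p y\<bar> \<le> K"
proof -
  obtain C where C: "0 < C" "\<And>x y. x \<in> closure \<Omega> \<Longrightarrow> y \<in> closure \<Omega> \<Longrightarrow> x \<noteq> y \<Longrightarrow>
      \<bar>p x - p y\<bar> \<le> C / ln (exp 1 + 1 / dist x y)"
    using assms unfolding log_hoelder_def by auto
  let ?n = "DIM('a)"
  let ?w = "measure lborel (ball (0::'a) 1)"
  have w: "0 < ?w" by (rule unit_ball_content_pos)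
  define c where "c = ln (1 + 1 / ?w) + ?n"
  have c: "0 \<le> c" using w by (auto simp: c_def)
  show ?thesis
  proof (rule that[of "exp (C * c)"])
    show "1 \<le> exp (C * c)" using C(1) c by simp
    fix x y :: 'a and r a :: real
    assume xy: "x \<in> \<Omega>" "y \<in> \<Omega>" and r: "dist x y < r" and a: "1 \<le> a" "a \<le> 1 + 1 / measure lborel (ball x r)"
    have "0 < r" using r zero_le_dist[of x y] by linarith
    show "a powr \<bar>p x - p y\<bar> \<le> exp (C * c)"
    proof (cases "x = y")
      case True
      then show ?thesis using a(1) C(1) c by simp
    next
      case False
      define L where "L = ln (exp 1 + 1 / r)"
      have e1: "1 < exp (1::real)" by simp
      have "exp 1 \<le> exp 1 + 1 / r" using \<open>0 < r\<close> by simp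
      then have "ln (exp 1) \<le> L" unfolding L_def by (intro ln_mono) (auto intro: add_pos_pos)
      then have L: "1 \<le> L" by simp
      have "1 / r \<le> 1 / dist x y"
        using r False \<open>0 < r\<close> by (intro divide_left_mono mult_pos_pos) auto
      then have "L \<le> ln (exp 1 + 1 / dist x y)"
        unfolding L_def using \<open>0 < r\<close> by (intro ln_mono) (auto intro: add_pos_nonneg)
      then have "C / ln (exp 1 + 1 / dist x y) \<le> C / L"
        using C(1) L by (intro divide_left_mono mult_pos_pos) auto
      then have osc: "\<bar>p x - p y\<bar> \<le> C / L"
        using C(2)[of x y] False xy closure_subset by fastforce
      have "a \<le> 1 + (1 / ?w) * (1 / r) ^ ?n"
        using a(2) content_ball_conv_unit_ball[of r x] \<open>0 < r\<close>
        by (simp add: power_one_over mult.commute)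
      also have "\<dots> \<le> 1 * (exp 1 + 1 / r) ^ ?n + (1 / ?w) * (exp 1 + 1 / r) ^ ?n"
      proof (intro add_mono mult_left_mono power_mono)
        have "1 \<le> exp 1 + 1 / r" using e1 \<open>0 < r\<close> by (smt (verit) divide_pos_pos)
        then show "1 \<le> 1 * (exp 1 + 1 / r) ^ ?n" by (simp add: one_le_power)
      qed (use w \<open>0 < r\<close> in auto)
      also have "\<dots> = (1 + 1 / ?w) * (exp 1 + 1 / r) ^ ?n" by (simp add: distrib_right)
      finally have "ln a \<le> ln ((1 + 1 / ?w) * (exp 1 + 1 / r) ^ ?n)"
        using a(1) by (intro ln_mono) auto
      also have "\<dots> = ln (1 + 1 / ?w) + ?n * L"
      proof -
        have "0 < 1 + 1 / ?w" "0 < exp 1 + 1 / r" using w \<open>0 < r\<close> by (auto intro: add_pos_pos)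
        then show ?thesis by (simp add: ln_mult_pos ln_realpow L_def)
      qed
      also have "\<dots> \<le> c * L"
      proof -
        have "0 \<le> ln (1 + 1 / ?w)" using w by simp
        then have "ln (1 + 1 / ?w) * 1 \<le> ln (1 + 1 / ?w) * L" using L by (rule mult_left_mono[rotated])
        then show ?thesis by (simp add: c_def distrib_right)
      qed
      finally have lna: "ln a \<le> c * L" .
      have "a powr \<bar>p x - p y\<bar> \<le> a powr (C / L)"
        using a(1) osc by (intro powr_mono) auto
      also have "\<dots> = exp (C / L * ln a)" using a(1) by (simp add: powr_def)
      also have "\<dots> \<le> exp (C / L * (c * L))"
        unfolding exp_le_cancel_iff
        using C(1) L by (intro mult_left_mono lna divide_nonneg_nonneg) auto
      also have "\<dots> = exp (C * c)" using L by simp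
      finally show ?thesis .
    qed
  qed
qed

text \<open>Diening's pointwise estimate: up to a constant, averages of \<open>f\<close> to the power \<open>p x / q\<close> are bounded
  by averages of \<open>g\<close>, the power of \<open>f\<close> with \<^emph>\<open>variable\<close> exponent. With \<open>a\<close> half the average of
  \<open>f\<close>, the values of \<open>f\<close> below \<open>a\<close> account for at most half of the integral. Where \<open>f > a\<close>, one has
  \<open>f y \<le> g y * a powr (1 - p y / q)\<close>, and replacing \<open>p y\<close> by \<open>p x\<close> in the exponent costs only the
  constant \<open>K\<close>.\<close>

lemma average_le_of_modular_le_1:
  fixes \<Omega> :: "'a::euclidean_space set" and f p :: "'a \<Rightarrow> real" and q K :: real
  defines "g \<equiv> \<lambda>y. indicator \<Omega> y * f y powr (p y / q)"
  assumes q: "1 \<le> q" and p: "\<And>y. y \<in> \<Omega> \<Longrightarrow> q \<le> p y"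
    and f: "f \<in> borel_measurable borel" "\<And>y. 0 \<le> f y" "\<And>y. y \<notin> \<Omega> \<Longrightarrow> f y = 0"
    and g: "g \<in> borel_measurable borel"
    and h: "(\<lambda>y. indicator \<Omega> y * f y powr p y) \<in> borel_measurable borel"
    and mod: "(\<integral>\<^sup>+y. ennreal (indicator \<Omega> y * f y powr p y) \<partial>lborel) \<le> 1"
    and K: "1 \<le> K" "\<And>x y r a. x \<in> \<Omega> \<Longrightarrow> y \<in> \<Omega> \<Longrightarrow> dist x y < r \<Longrightarrow> 1 \<le> a \<Longrightarrow>
       a \<le> 1 + 1 / measure lborel (ball x r) \<Longrightarrow> a powr \<bar>p x - p y\<bar> \<le> K"
    and x: "x \<in> \<Omega>" and l: "1 \<le> l" "x \<notin> large_average_set (\<lambda>y. ennreal (g y)) l" and r: "0 < r"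
  shows "(\<integral>\<^sup>+y. ennreal (f y) * indicator (ball x r) y \<partial>lborel)
    \<le> ennreal (2 * K * l powr (q / p x)) * emeasure lborel (ball x r)"
proof -
  have [measurable]: "f \<in> borel_measurable borel" "g \<in> borel_measurable borel"
    "(\<lambda>y. indicator \<Omega> y * f y powr p y) \<in> borel_measurable borel" "ball x r \<in> sets borel"
    using f(1) g h by auto
  define m where "m = measure lborel (ball x r)"
  have m: "0 < m" unfolding m_def using r by (rule content_ball_pos)
  have em: "emeasure lborel (ball x r) = ennreal m"
    unfolding m_def using emeasure_lborel_ball_finite[of x r] by (simp add: emeasure_eq_ennreal_measure)
  let ?J = "\<integral>\<^sup>+y. ennreal (f y) * indicator (ball x r) y \<partial>lborel"
  have "?J \<le> (\<integral>\<^sup>+y. indicator (ball x r) y + ennreal (indicator \<Omega> y * f y powr p y) \<partial>lborel)"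
  proof (rule nn_integral_mono)
    fix y
    have "f y \<le> 1 + indicator \<Omega> y * f y powr p y"
    proof (cases "y \<in> \<Omega> \<and> 1 \<le> f y")
      case True
      then have "f y powr 1 \<le> f y powr p y"
        using p[of y] q by (intro powr_mono) auto
      then show ?thesis using True by simp
    next
      case False
      then have "f y \<le> 1" using f(3)[of y] by (cases "y \<in> \<Omega>") auto
      moreover have "0 \<le> indicator \<Omega> y * f y powr p y" by simp
      ultimately show ?thesis by linarith
    qed
    then have "ennreal (f y) \<le> 1 + ennreal (indicator \<Omega> y * f y powr p y)"
      by (metis ennreal_1 ennreal_leI ennreal_plus indicator_pos_le mult_nonneg_nonneg powr_ge_zero zero_le_one)
    then show "ennreal (f y) * indicator (ball x r) y
        \<le> indicator (ball x r) y + ennreal (indicator \<Omega> y * f y powr p y)"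
      by (cases "y \<in> ball x r") simp_all
  qed
  also have "\<dots> = emeasure lborel (ball x r) + (\<integral>\<^sup>+y. ennreal (indicator \<Omega> y * f y powr p y) \<partial>lborel)"
    by (subst nn_integral_add) auto
  also have "\<dots> \<le> ennreal m + 1"
    using mod by (simp add: em add_left_mono)
  also have "\<dots> = ennreal (m + 1)" using m by simp
  finally have Jm: "?J \<le> ennreal (m + 1)" .
  then obtain j where j: "?J = ennreal j" "0 \<le> j"
    by (cases ?J) (auto simp: top_unique)
  have jm: "j \<le> m + 1"
    using Jm m unfolding j(1) by (subst (asm) ennreal_le_iff) auto
  define a where "a = j / (2 * m)"
  have ja: "j = 2 * a * m" using m by (simp add: a_def)
  have px: "0 < p x" "1 \<le> p x / q" using p[OF x] q by auto
  have l1: "1 \<le> l powr (q / p x)" using l(1) px q by (simp add: ge_one_powr_ge_zero)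
  have "a \<le> K * l powr (q / p x)"
  proof (cases "a \<le> 1")
    case True
    also have "1 \<le> K * l powr (q / p x)" using mult_mono[OF K(1) l1] K(1) by simp
    finally show ?thesis .
  next
    case False
    then have a: "1 < a" by simp
    have "a \<le> (m + 1) / (2 * m)" unfolding a_def using jm m by (intro divide_right_mono) auto
    also have "\<dots> \<le> 1 + 1 / m" using m by (simp add: field_simps)
    finally have am: "a \<le> 1 + 1 / measure lborel (ball x r)" by (simp add: m_def)
    define c where "c = K * a powr (1 - p x / q)"
    have c: "0 \<le> c" using K(1) by (simp add: c_def)
    have pointwise: "f y \<le> a + c * g y" if y: "y \<in> ball x r" for y
    proof (cases "y \<in> \<Omega> \<and> a < f y")
      case True
      define s where "s = p y / q"
      have s: "1 \<le> s" using p[of y] q True by (simp add: s_def)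
      have "(f y / a) powr 1 \<le> (f y / a) powr s"
        using True a s by (intro powr_mono) auto
      then have "f y / a \<le> f y powr s / a powr s"
        using True a by (simp add: powr_divide)
      then have "f y \<le> f y powr s * a powr (1 - s)"
        using a by (simp add: powr_diff field_simps)
      also have "a powr (1 - s) = a powr (1 - p x / q) * a powr (p x / q - s)"
        by (simp flip: powr_add)
      also have "a powr (p x / q - s) \<le> a powr \<bar>p x - p y\<bar>"
      proof (rule powr_mono)
        have "p x / q - s = (p x - p y) / q" by (simp add: s_def diff_divide_distrib)
        also have "\<dots> \<le> \<bar>p x - p y\<bar> / q" using q by (intro divide_right_mono) auto
        also have "\<dots> \<le> \<bar>p x - p y\<bar>"
          using q mult_left_mono[of 1 q "\<bar>p x - p y\<bar>"] by (simp add: divide_le_eq)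
        finally show "p x / q - s \<le> \<bar>p x - p y\<bar>" .
      qed (use a in simp)
      also have "\<dots> \<le> K"
        using K(2)[of x y r a] x True y a am by (simp add: dist_commute)
      finally have "f y \<le> f y powr s * (a powr (1 - p x / q) * K)"
        by (simp add: mult_left_mono)
      also have "\<dots> = c * g y" using True by (simp add: c_def g_def s_def)
      finally show ?thesis using a by simp
    next
      case False
      then have "f y \<le> a" using f(3)[of y] a by (cases "y \<in> \<Omega>") auto
      moreover have "0 \<le> c * g y" using c by (simp add: g_def)
      ultimately show ?thesis by linarith
    qed
    have "ennreal (2 * a * m) = ?J" using j ja by simp
    also have "?J \<le> (\<integral>\<^sup>+y. ennreal a * indicator (ball x r) y + ennreal c * (ennreal (g y) * indicator (ball x r) y) \<partial>lborel)"
    proof (rule nn_integral_mono)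
      fix y
      show "ennreal (f y) * indicator (ball x r) y
          \<le> ennreal a * indicator (ball x r) y + ennreal c * (ennreal (g y) * indicator (ball x r) y)"
      proof (cases "y \<in> ball x r")
        case True
        have "ennreal (f y) \<le> ennreal (a + c * g y)" by (rule ennreal_leI[OF pointwise[OF True]])
        also have "\<dots> = ennreal a + ennreal c * ennreal (g y)"
          using a c by (simp add: ennreal_plus ennreal_mult g_def)
        finally show ?thesis using True by simp
      qed simp
    qed
    also have "\<dots> = ennreal a * ennreal m + ennreal c * (\<integral>\<^sup>+y. ennreal (g y) * indicator (ball x r) y \<partial>lborel)"
      by (subst nn_integral_add) (measurable, simp add: nn_integral_cmult_indicator nn_integral_cmult em)
    also have "\<dots> \<le> ennreal a * ennreal m + ennreal c * (ennreal l * ennreal m)"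
    proof -
      have "(\<integral>\<^sup>+y. ennreal (g y) * indicator (ball x r) y \<partial>lborel) \<le> ennreal l * ennreal m"
        using l(2) r unfolding large_average_set_def mem_Collect_eq em[symmetric] by (meson not_less)
      then show ?thesis by (intro add_left_mono mult_left_mono) auto
    qed
    also have "\<dots> = ennreal (a * m + c * (l * m))"
      using a c m l(1) by (simp add: ennreal_plus ennreal_mult)
    finally have "2 * a * m \<le> a * m + c * (l * m)"
      using a c m l(1) by (subst (asm) ennreal_le_iff) auto
    then have "a * m \<le> (c * l) * m" by simp
    then have "a \<le> c * l" using m by simp
    then have "a * a powr (p x / q - 1) \<le> (c * l) * a powr (p x / q - 1)"
      by (rule mult_right_mono) simp
    moreover have "a * a powr (p x / q - 1) = a powr (p x / q)"
      using a powr_mult_base[of a "p x / q - 1"] by simp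
    moreover have "(c * l) * a powr (p x / q - 1) = K * l"
      using a by (simp add: c_def flip: powr_add)
    ultimately have "a powr (p x / q) \<le> K * l" by simp
    then have "(a powr (p x / q)) powr (q / p x) \<le> (K * l) powr (q / p x)"
      using px q by (intro powr_mono2) auto
    then have "a \<le> K powr (q / p x) * l powr (q / p x)"
      using px q a K(1) l(1) by (simp add: powr_powr powr_mult)
    also have "K powr (q / p x) \<le> K powr 1"
      using px K(1) q by (intro powr_mono) (auto simp: divide_simps)
    finally show ?thesis using K(1) by (simp add: mult_right_mono)
  qed
  then have "j \<le> 2 * K * l powr (q / p x) * m"
    using m unfolding ja by (simp add: mult_right_mono)
  then show ?thesis
    unfolding j(1) em using K(1) m by (simp add: ennreal_leI flip: ennreal_mult)
qed

section \<open>Balls in the exterior of a Lipschitz domain\<close>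

text \<open>Moving from a boundary point in the direction \<open>\<nu>\<close> leaves the subgraph, and a cone around this
  direction stays outside, its opening being determined by the Lipschitz constant. The cone contains
  balls of radius proportional to the distance moved.\<close>

lemma lipschitz_boundary_exterior_ball_local:
  fixes \<Omega> :: "'a::euclidean_space set"
  assumes "open \<Omega>" "lipschitz_boundary \<Omega>" "z \<in> frontier \<Omega>"
  shows "\<exists>r \<kappa>. 0 < r \<and> 0 < \<kappa> \<and> \<kappa> \<le> 1 \<and> (\<forall>y\<in>frontier \<Omega> \<inter> ball z r. \<forall>s\<in>{0<..r}.
     \<exists>w. dist y w \<le> s \<and> ball w (\<kappa> * s) \<inter> \<Omega> = {})"
proof -
  obtain R \<nu> g L where R: "0 < R" and \<nu>: "norm \<nu> = 1" and g: "L-lipschitz_on {y. y \<bullet> \<nu> = 0} g"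
    and eq: "\<Omega> \<inter> ball z R = {x \<in> ball z R. x \<bullet> \<nu> < g (x - (x \<bullet> \<nu>) *\<^sub>R \<nu>)}"
    using assms(2,3) unfolding lipschitz_boundary_def by blast
  have L: "0 \<le> L" using g by (rule lipschitz_on_nonneg)
  \<comment> \<open>A displacement \<open>\<eta>\<close> lowers the height by at most \<open>norm \<eta>\<close> and raises \<open>g\<close> by at most \<open>2 * L * norm \<eta>\<close>.\<close>
  define \<kappa> where "\<kappa> = 1 / (2 * L + 1)"
  have \<kappa>: "0 < \<kappa>" "\<kappa> \<le> 1" using L by (auto simp: \<kappa>_def divide_simps)
  define \<pi> where "\<pi> x = x - (x \<bullet> \<nu>) *\<^sub>R \<nu>" for x :: 'a
  have \<nu>\<nu>: "\<nu> \<bullet> \<nu> = 1" using \<nu> by (simp add: norm_eq_1)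
  have \<pi>0: "\<pi> x \<in> {y. y \<bullet> \<nu> = 0}" for x by (simp add: \<pi>_def inner_diff_left \<nu>\<nu>)
  show ?thesis
  proof (rule exI[of _ "R / 4"], rule exI[of _ \<kappa>], intro conjI ballI)
    show "0 < R / 4" "0 < \<kappa>" "\<kappa> \<le> 1" using R \<kappa> by auto
    fix y s assume y: "y \<in> frontier \<Omega> \<inter> ball z (R / 4)" and s: "s \<in> {0<..R / 4}"
    have "y \<notin> \<Omega>" using y \<open>open \<Omega>\<close> by (simp add: frontier_def interior_open)
    moreover have "y \<in> ball z R" using y R by auto
    moreover from \<open>y \<notin> \<Omega>\<close> have "y \<notin> {x \<in> ball z R. x \<bullet> \<nu> < g (x - (x \<bullet> \<nu>) *\<^sub>R \<nu>)}"
      unfolding eq[symmetric] by simp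
    ultimately have gy: "g (\<pi> y) \<le> y \<bullet> \<nu>"
      by (simp add: \<pi>_def not_less)
    show "\<exists>w. dist y w \<le> s \<and> ball w (\<kappa> * s) \<inter> \<Omega> = {}"
    proof (rule exI[of _ "y + s *\<^sub>R \<nu>"], intro conjI)
      show "dist y (y + s *\<^sub>R \<nu>) \<le> s" using \<nu> s by (simp add: dist_norm)
      show "ball (y + s *\<^sub>R \<nu>) (\<kappa> * s) \<inter> \<Omega> = {}"
      proof (rule ccontr)
        assume "ball (y + s *\<^sub>R \<nu>) (\<kappa> * s) \<inter> \<Omega> \<noteq> {}"
        then obtain v where v: "dist (y + s *\<^sub>R \<nu>) v < \<kappa> * s" "v \<in> \<Omega>" by auto
        define \<eta> where "\<eta> = v - (y + s *\<^sub>R \<nu>)"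
        have \<eta>: "norm \<eta> < \<kappa> * s" using v(1) by (simp add: \<eta>_def dist_norm norm_minus_commute)
        have veq: "v = y + s *\<^sub>R \<nu> + \<eta>" by (simp add: \<eta>_def)
        have \<eta>s: "(2 * L + 1) * norm \<eta> < s"
          using \<eta> L by (simp add: \<kappa>_def divide_simps mult.commute)
        have "0 \<le> L * norm \<eta>" using L by simp
        then have \<eta>s': "norm \<eta> < s" using \<eta>s by (simp add: distrib_right)
        have in\<eta>: "\<bar>\<eta> \<bullet> \<nu>\<bar> \<le> norm \<eta>" using Cauchy_Schwarz_ineq2[of \<eta> \<nu>] \<nu> by simp
        have "dist z v \<le> dist z y + dist y v" by (rule dist_triangle)
        also have "dist y v = norm (s *\<^sub>R \<nu> + \<eta>)"
        proof -
          have "v - y = s *\<^sub>R \<nu> + \<eta>" by (simp add: veq)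
          then show ?thesis by (simp add: dist_norm norm_minus_commute[of y v])
        qed
        also have "\<dots> \<le> norm (s *\<^sub>R \<nu>) + norm \<eta>" by (rule norm_triangle_ineq)
        finally have "dist z v < R" using y s \<eta>s' \<nu> R by auto
        then have "v \<in> \<Omega> \<inter> ball z R" using v(2) by simp
        then have "v \<bullet> \<nu> < g (\<pi> v)" unfolding eq by (simp add: \<pi>_def)
        moreover have "\<pi> v - \<pi> y = \<eta> - (\<eta> \<bullet> \<nu>) *\<^sub>R \<nu>"
          by (simp add: \<pi>_def veq inner_add_left \<nu>\<nu> algebra_simps)
        then have "norm (\<pi> v - \<pi> y) \<le> norm \<eta> + norm ((\<eta> \<bullet> \<nu>) *\<^sub>R \<nu>)"
          using norm_triangle_ineq4[of \<eta> "(\<eta> \<bullet> \<nu>) *\<^sub>R \<nu>"] by (simp only:)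
        then have "dist (\<pi> v) (\<pi> y) \<le> 2 * norm \<eta>"
          using in\<eta> \<nu> by (simp add: dist_norm)
        then have "L * dist (\<pi> v) (\<pi> y) \<le> L * (2 * norm \<eta>)"
          using L by (rule mult_left_mono)
        moreover have "dist (g (\<pi> v)) (g (\<pi> y)) \<le> L * dist (\<pi> v) (\<pi> y)"
          using lipschitz_onD[OF g \<pi>0 \<pi>0] .
        moreover have "v \<bullet> \<nu> = y \<bullet> \<nu> + s + \<eta> \<bullet> \<nu>"
          by (simp add: veq inner_add_left \<nu>\<nu>)
        ultimately show False
          using gy in\<eta> \<eta>s by (simp add: dist_real_def distrib_right)
      qed
    qed
  qed
qed

lemma frontier_nonempty_of_bounded_open:
  fixes \<Omega> :: "'a::euclidean_space set"
  assumes "open \<Omega>" "bounded \<Omega>" "\<Omega> \<noteq> {}"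
  shows "frontier \<Omega> \<noteq> {}"
  using assms frontier_eq_empty[of \<Omega>] not_bounded_UNIV by auto

lemma lipschitz_boundary_exterior_ball_uniform:
  fixes \<Omega> :: "'a::euclidean_space set"
  assumes "open \<Omega>" "bounded \<Omega>" "\<Omega> \<noteq> {}" "lipschitz_boundary \<Omega>"
  obtains s0 \<kappa> where "0 < s0" "0 < \<kappa>" "\<kappa> \<le> 1"
    "\<And>y s. y \<in> frontier \<Omega> \<Longrightarrow> 0 < s \<Longrightarrow> s \<le> s0 \<Longrightarrow> \<exists>w. dist y w \<le> s \<and> ball w (\<kappa> * s) \<inter> \<Omega> = {}"
proof -
  have "\<forall>z\<in>frontier \<Omega>. \<exists>r \<kappa>. 0 < r \<and> 0 < \<kappa> \<and> \<kappa> \<le> 1 \<and> (\<forall>y\<in>frontier \<Omega> \<inter> ball z r. \<forall>s\<in>{0<..r}.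
     \<exists>w. dist y w \<le> s \<and> ball w (\<kappa> * s) \<inter> \<Omega> = {})"
    using lipschitz_boundary_exterior_ball_local[OF assms(1,4)] by blast
  then obtain r where "\<forall>z\<in>frontier \<Omega>. \<exists>\<kappa>. 0 < r z \<and> 0 < \<kappa> \<and> \<kappa> \<le> 1 \<and> (\<forall>y\<in>frontier \<Omega> \<inter> ball z (r z). \<forall>s\<in>{0<..r z}.
     \<exists>w. dist y w \<le> s \<and> ball w (\<kappa> * s) \<inter> \<Omega> = {})"
    by (rule bchoice[THEN exE])
  then obtain \<kappa> where "\<forall>z\<in>frontier \<Omega>. 0 < r z \<and> 0 < \<kappa> z \<and> \<kappa> z \<le> 1 \<and> (\<forall>y\<in>frontier \<Omega> \<inter> ball z (r z). \<forall>s\<in>{0<..r z}.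
     \<exists>w. dist y w \<le> s \<and> ball w (\<kappa> z * s) \<inter> \<Omega> = {})"
    by (rule bchoice[THEN exE])
  then have r: "0 < r z" and \<kappa>: "0 < \<kappa> z" "\<kappa> z \<le> 1"
    and ext: "\<And>y s. y \<in> frontier \<Omega> \<Longrightarrow> y \<in> ball z (r z) \<Longrightarrow> 0 < s \<Longrightarrow> s \<le> r z \<Longrightarrow>
      \<exists>w. dist y w \<le> s \<and> ball w (\<kappa> z * s) \<inter> \<Omega> = {}"
    if "z \<in> frontier \<Omega>" for z using that by simp_all
  have "compact (frontier \<Omega>)" using assms(2) by (rule compact_frontier_bounded)
  moreover have "frontier \<Omega> \<subseteq> (\<Union>z\<in>frontier \<Omega>. ball z (r z))" using r by force
  ultimately obtain D where D: "D \<subseteq> frontier \<Omega>" "finite D" "frontier \<Omega> \<subseteq> (\<Union>z\<in>D. ball z (r z))"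
    using compactE_image[of "frontier \<Omega>" "frontier \<Omega>" "\<lambda>z. ball z (r z)"] by auto
  have "D \<noteq> {}" using D(3) frontier_nonempty_of_bounded_open[OF assms(1-3)] by auto
  show ?thesis
  proof (rule that[of "Min (r ` D)" "Min (\<kappa> ` D)"])
    show "0 < Min (r ` D)" "0 < Min (\<kappa> ` D)"
      using D(1,2) \<open>D \<noteq> {}\<close> r \<kappa>(1) by (auto simp: subset_iff)
    obtain z0 where "z0 \<in> D" using \<open>D \<noteq> {}\<close> by blast
    then have "Min (\<kappa> ` D) \<le> \<kappa> z0" using D(2) by simp
    then show "Min (\<kappa> ` D) \<le> 1" using \<kappa>(2)[of z0] \<open>z0 \<in> D\<close> D(1) by fastforce
    fix y s assume y: "y \<in> frontier \<Omega>" and s: "0 < s" "s \<le> Min (r ` D)"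
    obtain z where z: "z \<in> D" "y \<in> ball z (r z)" using D(3) y by blast
    have "s \<le> r z" using s(2) z(1) D(2) by (meson Min_le finite_imageI imageI order_trans)
    then obtain w where w: "dist y w \<le> s" "ball w (\<kappa> z * s) \<inter> \<Omega> = {}"
      using ext[of z y s] z D(1) y s(1) by blast
    have "Min (\<kappa> ` D) \<le> \<kappa> z" using z(1) D(2) by simp
    then have "Min (\<kappa> ` D) * s \<le> \<kappa> z * s" using s(1) by (simp add: mult_right_mono)
    then have "ball w (Min (\<kappa> ` D) * s) \<subseteq> ball w (\<kappa> z * s)" by (rule subset_ball)
    then show "\<exists>w. dist y w \<le> s \<and> ball w (Min (\<kappa> ` D) * s) \<inter> \<Omega> = {}"
      using w by blast
  qed
qed

lemma bdry_dist_pos: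
  fixes \<Omega> :: "'a::euclidean_space set"
  assumes "open \<Omega>" "bounded \<Omega>" "x \<in> \<Omega>"
  shows "0 < bdry_dist \<Omega> x"
proof -
  have "frontier \<Omega> \<noteq> {}" using assms by (intro frontier_nonempty_of_bounded_open) auto
  moreover have "x \<notin> frontier \<Omega>" using assms by (simp add: frontier_def interior_open)
  ultimately show ?thesis
    unfolding bdry_dist_def by (intro infdist_pos_not_in_closed) auto
qed

text \<open>The exterior balls are centred near a boundary point closest to \<open>x\<close> and scaled with the distance
  of \<open>x\<close>. Points far from the boundary are covered too, because \<open>\<Omega>\<close> is bounded: shrinking the
  factor by \<open>s0 / M\<close> keeps the radius in the admissible range.\<close>

lemma exterior_ball_at_boundary_distance:
  fixes \<Omega> :: "'a::euclidean_space set"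
  assumes "bounded_lipschitz_domain \<Omega>"
  obtains k where "0 < k" "k \<le> 1"
    "\<And>x. x \<in> \<Omega> \<Longrightarrow> \<exists>z. ball z (k * bdry_dist \<Omega> x) \<inter> \<Omega> = {} \<and>
       ball z (k * bdry_dist \<Omega> x) \<subseteq> ball x (3 * bdry_dist \<Omega> x)"
proof -
  have \<Omega>: "open \<Omega>" "bounded \<Omega>" "\<Omega> \<noteq> {}" "lipschitz_boundary \<Omega>"
    using assms by (auto simp: bounded_lipschitz_domain_def)
  obtain s0 \<kappa> where s0: "0 < s0" and \<kappa>: "0 < \<kappa>" "\<kappa> \<le> 1"
    and ext: "\<And>y s. y \<in> frontier \<Omega> \<Longrightarrow> 0 < s \<Longrightarrow> s \<le> s0 \<Longrightarrow> \<exists>w. dist y w \<le> s \<and> ball w (\<kappa> * s) \<inter> \<Omega> = {}"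
    using lipschitz_boundary_exterior_ball_uniform[OF \<Omega>] by blast
  have fr: "frontier \<Omega> \<noteq> {}" by (rule frontier_nonempty_of_bounded_open[OF \<Omega>(1-3)])
  then obtain z0 where z0: "z0 \<in> frontier \<Omega>" by blast
  obtain e where e: "\<forall>x\<in>\<Omega>. dist z0 x \<le> e"
    using \<Omega>(2) unfolding bounded_any_center[where a=z0] by blast
  define M where "M = max 1 e"
  have M: "0 < M" "\<And>x. x \<in> \<Omega> \<Longrightarrow> dist z0 x \<le> M"
    using e by (auto simp: M_def le_max_iff_disj)
  have dM: "bdry_dist \<Omega> x \<le> M" if "x \<in> \<Omega>" for x
    using infdist_le[OF z0, of x] M(2)[OF that] by (simp add: bdry_dist_def dist_commute)
  define l where "l = min 1 (s0 / M)"
  have l: "0 < l" "l \<le> 1" using s0 M(1) by (auto simp: l_def)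
  show ?thesis
  proof (rule that[of "\<kappa> * l"])
    show "0 < \<kappa> * l" using \<kappa> l by simp
    show "\<kappa> * l \<le> 1" using \<kappa> l by (intro mult_le_one) auto
    fix x assume x: "x \<in> \<Omega>"
    let ?d = "bdry_dist \<Omega> x"
    have d: "0 < ?d" by (rule bdry_dist_pos[OF \<Omega>(1,2) x])
    obtain y where y: "y \<in> frontier \<Omega>" "?d = dist x y"
      using infdist_attains_inf[OF frontier_closed fr, of x] by (auto simp: bdry_dist_def)
    have "l * ?d \<le> (s0 / M) * M"
      using dM[OF x] d s0 M(1) by (intro mult_mono) (auto simp: l_def)
    then have "l * ?d \<le> s0" using M(1) by simp
    then obtain w where w: "dist y w \<le> l * ?d" "ball w (\<kappa> * (l * ?d)) \<inter> \<Omega> = {}"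
      using ext[OF y(1), of "l * ?d"] l(1) d by auto
    have "l * ?d \<le> ?d" using l d by simp
    have "\<kappa> * l * ?d \<le> 1 * ?d" using \<open>\<kappa> * l \<le> 1\<close> d by (intro mult_right_mono) auto
    have "ball w (\<kappa> * l * ?d) \<subseteq> ball x (3 * ?d)"
    proof
      fix v assume "v \<in> ball w (\<kappa> * l * ?d)"
      then have "dist w v < ?d" using \<open>\<kappa> * l * ?d \<le> 1 * ?d\<close> by simp
      moreover have "dist x v \<le> dist x y + dist y w + dist w v"
        using dist_triangle[of x v y] dist_triangle[of y v w] by linarith
      ultimately show "v \<in> ball x (3 * ?d)"
        using w(1) y(2) \<open>l * ?d \<le> ?d\<close> unfolding mem_ball by linarith
    qed
    then show "\<exists>z. ball z (\<kappa> * l * ?d) \<inter> \<Omega> = {} \<and> ball z (\<kappa> * l * ?d) \<subseteq> ball x (3 * ?d)"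
      using w(2) by (intro exI[of _ w]) (simp add: mult.assoc)
  qed
qed

section \<open>Hardy's inequality for test functions\<close>

lemma modular_eq_lborel:
  fixes \<Omega> :: "'a::euclidean_space set"
  assumes "open \<Omega>"
  shows "modular \<Omega> p u = (\<integral>\<^sup>+x. ennreal (\<bar>u x\<bar> powr p x) * indicator \<Omega> x \<partial>lborel)"
  using assms unfolding modular_def
  by (subst nn_integral_restrict_space) (auto simp: nn_integral_completion)

text \<open>Extended by zero, a test function vanishes on the exterior ball belonging to \<open>x\<close>, so that
  \<open>\<phi> x / bdry_dist \<Omega> x\<close> is bounded by the largest average of the gradient around \<open>x\<close>. Diening's
  estimate turns its \<open>p x\<close>-th power into the \<open>q\<close>-th power of averages of \<open>g\<close>, where
  \<open>q > 1\<close> is a lower bound of \<open>p\<close>, and the maximal inequality with the constant exponent \<open>q\<close>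
  finishes the proof, as \<open>g powr q\<close> is the integrand of the modular of the gradient.\<close>

lemma hardy_test_function:
  fixes \<Omega> :: "'a::euclidean_space set"
  assumes dom: "bounded_lipschitz_domain \<Omega>" and ve: "variable_exponent \<Omega> p" and lh: "log_hoelder \<Omega> p"
  obtains C where "0 \<le> C"
    "\<And>\<phi>. \<phi> \<in> test_functions \<Omega> \<Longrightarrow> modular \<Omega> p (\<lambda>x. norm (classical_gradient \<phi> x)) \<le> 1 \<Longrightarrow>
       modular \<Omega> p (\<lambda>x. \<phi> x / bdry_dist \<Omega> x) \<le> ennreal C"
proof -
  have \<Omega>: "open \<Omega>" "bounded \<Omega>"
    using dom by (auto simp: bounded_lipschitz_domain_def)
  then have [measurable]: "\<Omega> \<in> sets borel" by simp
  obtain q P where q: "1 < q" and pb: "\<And>x. x \<in> \<Omega> \<Longrightarrow> q \<le> p x" "\<And>x. x \<in> \<Omega> \<Longrightarrow> p x \<le> P"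
    using ve closure_subset[of \<Omega>] unfolding variable_exponent_def by blast
  obtain K where K: "1 \<le> K" "\<And>x y r a. x \<in> \<Omega> \<Longrightarrow> y \<in> \<Omega> \<Longrightarrow> dist x y < r \<Longrightarrow> 1 \<le> a \<Longrightarrow>
       a \<le> 1 + 1 / measure lborel (ball x r) \<Longrightarrow> a powr \<bar>p x - p y\<bar> \<le> K"
    using log_hoelder_powr_le[OF lh] by blast
  obtain k where k: "0 < k" "k \<le> 1" and ext: "\<And>x. x \<in> \<Omega> \<Longrightarrow> \<exists>z. ball z (k * bdry_dist \<Omega> x) \<inter> \<Omega> = {} \<and>
       ball z (k * bdry_dist \<Omega> x) \<subseteq> ball x (3 * bdry_dist \<Omega> x)"
    using exterior_ball_at_boundary_distance[OF dom] by blast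
  have "continuous_on \<Omega> p"
    using log_hoelder_continuous_on[OF lh] closure_subset continuous_on_subset by blast
  then have pm: "(\<lambda>x. indicator \<Omega> x *\<^sub>R p x) \<in> borel_measurable borel"
    by (intro borel_measurable_continuous_on_indicator) auto
  define c where "c = 3 * (3 / k) ^ DIM('a) * (2 * K)"
  have c: "1 \<le> c"
  proof -
    have "1 \<le> 3 / k" using k by simp
    then have "1 * 1 * 1 \<le> 3 * (3 / k) ^ DIM('a) * (2 * K)"
      using K(1) k by (intro mult_mono one_le_power) auto
    then show ?thesis by (simp add: c_def)
  qed
  define K2 where "K2 = 5 ^ DIM('a) * 2 powr q * 2 * (2 powr (q - 1) / (2 powr (q - 1) - 1)) * 2 powr (q - 1)"
  have "0 \<le> K2" using q ge_one_powr_ge_zero[of 2 "q - 1"] by (auto simp: K2_def intro!: divide_nonneg_nonneg)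
  show ?thesis
  proof (rule that[of "c powr P * (measure lborel \<Omega> + K2)"])
    show "0 \<le> c powr P * (measure lborel \<Omega> + K2)" using \<open>0 \<le> K2\<close> by simp
    fix \<phi> assume \<phi>: "\<phi> \<in> test_functions \<Omega>"
      and mod: "modular \<Omega> p (\<lambda>x. norm (classical_gradient \<phi> x)) \<le> 1"
    define f where "f = (\<lambda>x. norm (classical_gradient \<phi> x))"
    define g where "g = (\<lambda>y. indicator \<Omega> y * f y powr (p y / q))"
    have cf: "continuous_on UNIV f"
      unfolding f_def by (intro continuous_intros continuous_classical_gradient[OF \<phi>])
    have [measurable]: "f \<in> borel_measurable borel"
      by (rule borel_measurable_continuous_onI[OF cf])
    have f0: "f y = 0" if "y \<notin> \<Omega>" for y
      using that test_functionD(3)[OF \<phi>] classical_gradient_zero[of y \<phi>] by (auto simp: f_def)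
    have [simp]: "0 \<le> f y" for y by (simp add: f_def)
    have pw: "(\<lambda>y. indicator \<Omega> y * f y powr (p y / t)) \<in> borel_measurable borel" for t
    proof -
      have "(\<lambda>y. indicator \<Omega> y * f y powr ((indicator \<Omega> y *\<^sub>R p y) / t)) \<in> borel_measurable borel"
        using pm by measurable
      moreover have "(\<lambda>y. indicator \<Omega> y * f y powr ((indicator \<Omega> y *\<^sub>R p y) / t))
          = (\<lambda>y. indicator \<Omega> y * f y powr (p y / t))"
        by (auto simp: fun_eq_iff indicator_def)
      ultimately show ?thesis by simp
    qed
    have gm: "g \<in> borel_measurable borel" unfolding g_def by (rule pw)
    have hm: "(\<lambda>y. indicator \<Omega> y * f y powr p y) \<in> borel_measurable borel" using pw[of 1] by simp
    have mod_eq: "(\<integral>\<^sup>+y. ennreal (indicator \<Omega> y * f y powr p y) \<partial>lborel)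
        = modular \<Omega> p (\<lambda>x. norm (classical_gradient \<phi> x))"
      unfolding modular_eq_lborel[OF \<Omega>(1)]
      by (intro nn_integral_cong) (auto simp: f_def indicator_def)
    have "\<exists>B\<ge>1. \<forall>x. norm (classical_gradient \<phi> x) \<le> B"
      by (rule continuous_compact_support_bounded[OF continuous_classical_gradient[OF \<phi>]
            test_functionD(2)[OF \<phi>] classical_gradient_zero[of _ \<phi>]])
    then obtain B where B1: "1 \<le> B" and fB: "\<And>y. f y \<le> B"
      unfolding f_def by blast
    have gB: "g y \<le> B powr (P / q)" for y
    proof (cases "y \<in> \<Omega>")
      case True
      have "f y powr (p y / q) \<le> B powr (p y / q)"
        using fB pb(1)[OF True] q by (intro powr_mono2) auto
      also have "\<dots> \<le> B powr (P / q)"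
        using pb(2)[OF True] q B1 by (intro powr_mono divide_right_mono) auto
      finally show ?thesis using True by (simp add: g_def)
    qed (use B1 in \<open>simp add: g_def\<close>)
    have point: "\<bar>\<phi> x / bdry_dist \<Omega> x\<bar> powr p x \<le> c powr P * l powr q"
      if x: "x \<in> \<Omega>" and l: "1 \<le> l" "x \<notin> large_average_set (\<lambda>y. ennreal (g y)) l" for x l
    proof -
      let ?d = "bdry_dist \<Omega> x"
      have d: "0 < ?d" by (rule bdry_dist_pos[OF \<Omega> x])
      obtain z where z: "ball z (k * ?d) \<inter> \<Omega> = {}" "ball z (k * ?d) \<subseteq> ball x (3 * ?d)"
        using ext[OF x] by blast
      have "\<bar>\<phi> x\<bar> \<le> 3 * ?d * (3 * ?d / (k * ?d)) ^ DIM('a) * (2 * K * l powr (q / p x))"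
      proof (rule test_function_le_gradient_averages[OF \<phi>, of z])
        show "\<phi> y = 0" if "y \<in> ball z (k * ?d)" for y
          using that z(1) test_functionD(4)[OF \<phi>, of y] by blast
        show "0 < k * ?d" using k d by simp
        show "0 \<le> 2 * K * l powr (q / p x)" using K(1) by simp
        fix r :: real assume "0 < r"
        have f_eq: "norm (classical_gradient \<phi> y) = f y" for y by (simp add: f_def)
        show "(\<integral>\<^sup>+y. ennreal (norm (classical_gradient \<phi> y)) * indicator (ball x r) y \<partial>lborel)
            \<le> ennreal (2 * K * l powr (q / p x)) * emeasure lborel (ball x r)"
          using average_le_of_modular_le_1[of q \<Omega> p f K x l r] q pb(1) f0 gm hm mod mod_eq K x l \<open>0 < r\<close>
          unfolding g_def f_eq by simp
      qed (rule z(2))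
      also have "\<dots> = ?d * (c * l powr (q / p x))"
        using d by (simp add: c_def)
      finally have "\<bar>\<phi> x / ?d\<bar> \<le> c * l powr (q / p x)"
        using d by (simp add: divide_le_eq mult.commute)
      then have "\<bar>\<phi> x / ?d\<bar> powr p x \<le> (c * l powr (q / p x)) powr p x"
        using pb(1)[OF x] q by (intro powr_mono2) auto
      also have "\<dots> = c powr p x * l powr q"
        using c pb(1)[OF x] q by (simp add: powr_mult powr_powr)
      also have "\<dots> \<le> c powr P * l powr q"
        using c pb(2)[OF x] by (intro mult_right_mono powr_mono) auto
      finally show ?thesis .
    qed
    have "modular \<Omega> p (\<lambda>x. \<phi> x / bdry_dist \<Omega> x)
        = (\<integral>\<^sup>+x. ennreal (\<bar>\<phi> x / bdry_dist \<Omega> x\<bar> powr p x) * indicator \<Omega> x \<partial>lborel)"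
      by (rule modular_eq_lborel[OF \<Omega>(1)])
    also have "\<dots> \<le> ennreal (c powr P) * (emeasure lborel \<Omega> + ennreal K2 * (\<integral>\<^sup>+x. ennreal (g x powr q) \<partial>lborel))"
      unfolding K2_def
      by (rule nn_integral_le_of_large_average_sets[OF q gm _ gB _ _ point]) (auto simp: g_def)
    also have "(\<integral>\<^sup>+x. ennreal (g x powr q) \<partial>lborel) = (\<integral>\<^sup>+y. ennreal (indicator \<Omega> y * f y powr p y) \<partial>lborel)"
      using q by (intro nn_integral_cong) (auto simp: g_def indicator_def powr_powr)
    also have "\<dots> \<le> 1" using mod mod_eq by simp
    also have "emeasure lborel \<Omega> = ennreal (measure lborel \<Omega>)"
      using emeasure_bounded_finite[OF \<Omega>(2)] by (simp add: emeasure_eq_ennreal_measure)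
    also have "ennreal (c powr P) * (ennreal (measure lborel \<Omega>) + ennreal K2 * 1)
        = ennreal (c powr P * (measure lborel \<Omega> + K2))"
      using \<open>0 \<le> K2\<close> by (simp add: ennreal_mult)
    finally show "modular \<Omega> p (\<lambda>x. \<phi> x / bdry_dist \<Omega> x) \<le> ennreal (c powr P * (measure lborel \<Omega> + K2))"
      by (simp add: mult_left_mono add_left_mono)
  qed
qed

section \<open>Modulars and Luxemburg norms\<close>

lemma borel_measurable_lebesgue_on_continuous:
  fixes f :: "'a::euclidean_space \<Rightarrow> 'b::euclidean_space"
  assumes "open \<Omega>" "continuous_on \<Omega> f"
  shows "f \<in> borel_measurable (lebesgue_on \<Omega>)"
  using assms by (intro continuous_imp_measurable_on_sets_lebesgue) auto

lemma has_weak_gradient_measurable: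
  fixes \<Omega> :: "'a::euclidean_space set"
  assumes "open \<Omega>" "has_weak_gradient \<Omega> u G"
  shows "G \<in> borel_measurable (lebesgue_on \<Omega>)"
proof -
  obtain \<D> where D: "countable \<D>" "\<And>X. X \<in> \<D> \<Longrightarrow> X \<subseteq> \<Omega> \<and> (\<exists>a b. X = cbox a b)" "\<Union>\<D> = \<Omega>"
    by (rule open_countable_Union_open_cbox[OF \<open>open \<Omega>\<close>]) (rule that; auto)
  show ?thesis
  proof (rule measurable_piecewise_restrict[OF D(1)])
    fix X assume X: "X \<in> \<D>"
    then obtain a b where ab: "X = cbox a b" "X \<subseteq> \<Omega>" using D(2) by blast
    have XL: "X \<in> sets lebesgue" by (simp add: ab(1))
    show "X \<inter> space (lebesgue_on \<Omega>) \<in> sets (lebesgue_on \<Omega>)"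
      using ab XL \<open>open \<Omega>\<close> by (auto simp: sets_restrict_space_iff)
    have "\<forall>K. compact K \<and> K \<subseteq> \<Omega> \<longrightarrow> u absolutely_integrable_on K \<and> G absolutely_integrable_on K"
      using assms(2) unfolding has_weak_gradient_def by (rule conjunct1)
    moreover have "compact X" unfolding ab(1) by (rule compact_cbox)
    ultimately have "G absolutely_integrable_on X" using ab(2) by simp
    then have "G \<in> borel_measurable (lebesgue_on X)"
      using XL by (simp add: absolutely_integrable_measurable)
    moreover have "restrict_space (lebesgue_on \<Omega>) X = lebesgue_on X"
      using ab(2) \<open>open \<Omega>\<close> XL by (subst restrict_restrict_space) (auto simp: Int_absorb1)
    ultimately show "G \<in> borel_measurable (restrict_space (lebesgue_on \<Omega>) X)" by simp
  next
    show "space (lebesgue_on \<Omega>) \<subseteq> \<Union>\<D>" using D(3) by simp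
  qed
qed

lemma modular_mono:
  assumes "\<forall>x\<in>\<Omega>. 0 \<le> p x" "AE x in lebesgue_on \<Omega>. \<bar>v x\<bar> \<le> \<bar>u x\<bar>"
  shows "modular \<Omega> p v \<le> modular \<Omega> p u"
  unfolding modular_def
proof (rule nn_integral_mono_AE)
  have "AE x in lebesgue_on \<Omega>. x \<in> \<Omega>" by (rule AE_I2) simp
  with assms(2) show "AE x in lebesgue_on \<Omega>. ennreal (\<bar>v x\<bar> powr p x) \<le> ennreal (\<bar>u x\<bar> powr p x)"
    by eventually_elim (use assms(1) in \<open>auto intro!: ennreal_leI powr_mono2\<close>)
qed

lemma modular_divide_le:
  assumes p: "\<forall>x\<in>\<Omega>. 1 \<le> p x" and t: "1 \<le> t"
    and m: "(\<lambda>x. \<bar>u x\<bar> powr p x) \<in> borel_measurable (lebesgue_on \<Omega>)"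
  shows "modular \<Omega> p (\<lambda>x. u x / t) \<le> ennreal (1 / t) * modular \<Omega> p u"
proof -
  have "modular \<Omega> p (\<lambda>x. u x / t) \<le> (\<integral>\<^sup>+x. ennreal (1 / t) * ennreal (\<bar>u x\<bar> powr p x) \<partial>lebesgue_on \<Omega>)"
    unfolding modular_def
  proof (rule nn_integral_mono)
    fix x assume "x \<in> space (lebesgue_on \<Omega>)"
    then have x: "1 \<le> p x" using p by simp
    have "t powr 1 \<le> t powr p x" using x t by (intro powr_mono) auto
    then have "\<bar>u x\<bar> powr p x / t powr p x \<le> \<bar>u x\<bar> powr p x / t"
      using t by (intro divide_left_mono mult_pos_pos) auto
    then have "\<bar>u x / t\<bar> powr p x \<le> 1 / t * \<bar>u x\<bar> powr p x"
      using t by (simp add: abs_divide powr_divide)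
    then show "ennreal (\<bar>u x / t\<bar> powr p x) \<le> ennreal (1 / t) * ennreal (\<bar>u x\<bar> powr p x)"
      using t by (simp add: ennreal_leI flip: ennreal_mult)
  qed
  also have "\<dots> = ennreal (1 / t) * modular \<Omega> p u"
    unfolding modular_def using measurable_compose[OF m measurable_ennreal] by (rule nn_integral_cmult)
  finally show ?thesis .
qed

text \<open>Guarantees that the infimum in \<^const>\<open>luxemburg_norm\<close> is taken over a nonempty set.\<close>

lemma modular_scale_le_1:
  assumes p: "\<forall>x\<in>\<Omega>. 1 \<le> p x"
    and m: "(\<lambda>x. \<bar>u x\<bar> powr p x) \<in> borel_measurable (lebesgue_on \<Omega>)"
    and fin: "modular \<Omega> p u < \<infinity>" and le: "AE x in lebesgue_on \<Omega>. \<bar>v x\<bar> \<le> \<bar>u x\<bar>"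
  shows "\<exists>t>0. modular \<Omega> p (\<lambda>x. v x / t) \<le> 1"
proof -
  obtain a where a: "modular \<Omega> p u = ennreal a" "0 \<le> a"
    using fin by (cases "modular \<Omega> p u") auto
  define t where "t = max 1 a"
  have t: "1 \<le> t" "a \<le> t" by (auto simp: t_def)
  have "modular \<Omega> p (\<lambda>x. v x / t) \<le> modular \<Omega> p (\<lambda>x. u x / t)"
  proof (rule modular_mono)
    show "\<forall>x\<in>\<Omega>. 0 \<le> p x" using p by force
    show "AE x in lebesgue_on \<Omega>. \<bar>v x / t\<bar> \<le> \<bar>u x / t\<bar>"
      using le by eventually_elim (use t in \<open>auto simp: abs_divide intro: divide_right_mono\<close>)
  qed
  also have "\<dots> \<le> ennreal (1 / t) * ennreal a"
    using modular_divide_le[OF p t(1) m] by (simp add: a(1))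
  also have "\<dots> = ennreal (1 / t * a)" using t a(2) by (simp flip: ennreal_mult)
  also have "\<dots> \<le> 1" using t by (simp add: ennreal_le_1)
  finally show ?thesis using t(1) by (intro exI[of _ t]) auto
qed

lemma modular_le_1_of_luxemburg_norm_less:
  assumes p: "\<forall>x\<in>\<Omega>. 1 \<le> p x" and ex: "\<exists>t>0. modular \<Omega> p (\<lambda>x. v x / t) \<le> 1"
  shows "0 \<le> luxemburg_norm \<Omega> p v"
    and "luxemburg_norm \<Omega> p v < \<tau> \<Longrightarrow> 0 < \<tau> \<and> modular \<Omega> p (\<lambda>x. v x / \<tau>) \<le> 1"
proof -
  let ?S = "{\<tau>. 0 < \<tau> \<and> modular \<Omega> p (\<lambda>x. v x / \<tau>) \<le> 1}"
  have S: "?S \<noteq> {}" using ex by blast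
  show "0 \<le> luxemburg_norm \<Omega> p v"
    unfolding luxemburg_norm_def by (rule cInf_greatest[OF S]) auto
  assume "luxemburg_norm \<Omega> p v < \<tau>"
  then obtain s where s: "0 < s" "modular \<Omega> p (\<lambda>x. v x / s) \<le> 1" "s < \<tau>"
    using cInf_lessD[OF S] unfolding luxemburg_norm_def by blast
  have "modular \<Omega> p (\<lambda>x. v x / \<tau>) \<le> modular \<Omega> p (\<lambda>x. v x / s)"
  proof (rule modular_mono)
    show "\<forall>x\<in>\<Omega>. 0 \<le> p x" using p by force
    have "\<bar>v x / \<tau>\<bar> \<le> \<bar>v x / s\<bar>" for x
      using s by (simp add: abs_divide) (intro divide_left_mono mult_pos_pos, auto)
    then show "AE x in lebesgue_on \<Omega>. \<bar>v x / \<tau>\<bar> \<le> \<bar>v x / s\<bar>" by simp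
  qed
  then show "0 < \<tau> \<and> modular \<Omega> p (\<lambda>x. v x / \<tau>) \<le> 1"
    using s by (auto intro: order_trans)
qed

lemma powr_add_le_max:
  fixes a b p :: real
  assumes "0 \<le> a" "0 \<le> b" "0 \<le> p"
  shows "(a + b) powr p \<le> 2 powr p * (a powr p + b powr p)"
proof -
  have "(a + b) powr p \<le> (2 * max a b) powr p"
    using assms by (intro powr_mono2) auto
  also have "\<dots> = 2 powr p * (max a b) powr p" using assms by (simp add: powr_mult)
  also have "(max a b) powr p \<le> a powr p + b powr p"
    using assms by (simp add: max_def)
  finally show ?thesis by simp
qed

lemma modular_add_finite:
  assumes p: "\<forall>x\<in>\<Omega>. 0 \<le> p x" "\<forall>x\<in>\<Omega>. p x \<le> P"
    and m: "(\<lambda>x. \<bar>u x\<bar> powr p x) \<in> borel_measurable (lebesgue_on \<Omega>)"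
      "(\<lambda>x. \<bar>v x\<bar> powr p x) \<in> borel_measurable (lebesgue_on \<Omega>)"
    and fin: "modular \<Omega> p u < \<infinity>" "modular \<Omega> p v < \<infinity>"
  shows "modular \<Omega> p (\<lambda>x. \<bar>u x\<bar> + \<bar>v x\<bar>) < \<infinity>"
proof -
  have "modular \<Omega> p (\<lambda>x. \<bar>u x\<bar> + \<bar>v x\<bar>)
      \<le> (\<integral>\<^sup>+x. ennreal (2 powr P) * (ennreal (\<bar>u x\<bar> powr p x) + ennreal (\<bar>v x\<bar> powr p x)) \<partial>lebesgue_on \<Omega>)"
    unfolding modular_def
  proof (rule nn_integral_mono)
    fix x assume "x \<in> space (lebesgue_on \<Omega>)"
    then have x: "0 \<le> p x" "p x \<le> P" using p by auto
    have "\<bar>\<bar>u x\<bar> + \<bar>v x\<bar>\<bar> powr p x \<le> 2 powr p x * (\<bar>u x\<bar> powr p x + \<bar>v x\<bar> powr p x)"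
      using powr_add_le_max[of "\<bar>u x\<bar>" "\<bar>v x\<bar>" "p x"] x by simp
    also have "\<dots> \<le> 2 powr P * (\<bar>u x\<bar> powr p x + \<bar>v x\<bar> powr p x)"
      using x by (intro mult_right_mono powr_mono) auto
    finally show "ennreal (\<bar>\<bar>u x\<bar> + \<bar>v x\<bar>\<bar> powr p x)
        \<le> ennreal (2 powr P) * (ennreal (\<bar>u x\<bar> powr p x) + ennreal (\<bar>v x\<bar> powr p x))"
      by (simp add: ennreal_leI flip: ennreal_mult ennreal_plus)
  qed
  also have "\<dots> = ennreal (2 powr P) * (modular \<Omega> p u + modular \<Omega> p v)"
    unfolding modular_def using m by (simp add: nn_integral_cmult nn_integral_add)
  also have "\<dots> < \<infinity>" using fin by (simp add: ennreal_mult_less_top)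
  finally show ?thesis .
qed

lemma modular_bounded_finite:
  fixes \<Omega> :: "'a::euclidean_space set"
  assumes \<Omega>: "open \<Omega>" "bounded \<Omega>" and p: "\<forall>x\<in>\<Omega>. 0 \<le> p x" "\<forall>x\<in>\<Omega>. p x \<le> P"
    and B: "1 \<le> B" "\<And>x. x \<in> \<Omega> \<Longrightarrow> \<bar>u x\<bar> \<le> B"
  shows "modular \<Omega> p u < \<infinity>"
proof -
  have "modular \<Omega> p u \<le> (\<integral>\<^sup>+x. ennreal (B powr P) \<partial>lebesgue_on \<Omega>)"
    unfolding modular_def
  proof (rule nn_integral_mono)
    fix x assume "x \<in> space (lebesgue_on \<Omega>)"
    then have x: "x \<in> \<Omega>" by simp
    have "\<bar>u x\<bar> powr p x \<le> B powr p x" using B(2)[OF x] p(1) x by (intro powr_mono2) auto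
    also have "\<dots> \<le> B powr P" using p(2) x B(1) by (intro powr_mono) auto
    finally show "ennreal (\<bar>u x\<bar> powr p x) \<le> ennreal (B powr P)" by (rule ennreal_leI)
  qed
  also have "\<dots> = ennreal (B powr P) * emeasure lebesgue \<Omega>"
    using \<Omega>(1) by (simp add: emeasure_restrict_space)
  also have "\<dots> < \<infinity>"
    using emeasure_bounded_finite[OF \<Omega>(2)] \<Omega>(1) by (simp add: ennreal_mult_less_top)
  finally show ?thesis .
qed

text \<open>A quasi-triangle inequality for the Luxemburg norm: \<open>(a + b) / 4\<close> is at most half the maximum of
  \<open>a\<close> and \<open>b\<close>, and the factor one half survives exponents above one. The factor \<open>4\<close> only
  affects constants.\<close>

lemma modular_add_le_1:
  assumes p: "\<forall>x\<in>\<Omega>. 1 \<le> p x" and \<tau>: "0 < \<tau>"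
    and m: "(\<lambda>x. \<bar>u x / \<tau>\<bar> powr p x) \<in> borel_measurable (lebesgue_on \<Omega>)"
      "(\<lambda>x. \<bar>v x / \<tau>\<bar> powr p x) \<in> borel_measurable (lebesgue_on \<Omega>)"
    and le: "modular \<Omega> p (\<lambda>x. u x / \<tau>) \<le> 1" "modular \<Omega> p (\<lambda>x. v x / \<tau>) \<le> 1"
    and w: "AE x in lebesgue_on \<Omega>. \<bar>w x\<bar> \<le> \<bar>u x\<bar> + \<bar>v x\<bar>"
  shows "modular \<Omega> p (\<lambda>x. w x / (4 * \<tau>)) \<le> 1"
proof -
  have "modular \<Omega> p (\<lambda>x. w x / (4 * \<tau>))
      \<le> (\<integral>\<^sup>+x. ennreal (1 / 2) * (ennreal (\<bar>u x / \<tau>\<bar> powr p x) + ennreal (\<bar>v x / \<tau>\<bar> powr p x)) \<partial>lebesgue_on \<Omega>)"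
    unfolding modular_def
  proof (rule nn_integral_mono_AE)
    have "AE x in lebesgue_on \<Omega>. x \<in> \<Omega>" by (rule AE_I2) simp
    with w show "AE x in lebesgue_on \<Omega>. ennreal (\<bar>w x / (4 * \<tau>)\<bar> powr p x)
        \<le> ennreal (1 / 2) * (ennreal (\<bar>u x / \<tau>\<bar> powr p x) + ennreal (\<bar>v x / \<tau>\<bar> powr p x))"
    proof eventually_elim
      case (elim x)
      then have x: "1 \<le> p x" using p by simp
      let ?a = "\<bar>u x / \<tau>\<bar>" and ?b = "\<bar>v x / \<tau>\<bar>"
      have "\<bar>w x / (4 * \<tau>)\<bar> \<le> (?a + ?b) / 4"
        using elim(1) \<tau> by (simp add: abs_divide field_simps)
      then have "\<bar>w x / (4 * \<tau>)\<bar> powr p x \<le> ((?a + ?b) / 4) powr p x"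
        using x by (intro powr_mono2) auto
      also have "\<dots> = (?a + ?b) powr p x / 4 powr p x"
        by (simp add: powr_divide)
      also have "\<dots> \<le> 2 powr p x * (?a powr p x + ?b powr p x) / 4 powr p x"
        using powr_add_le_max[of ?a ?b "p x"] x by (intro divide_right_mono) auto
      also have "\<dots> = (2 / 4) powr p x * (?a powr p x + ?b powr p x)"
        by (subst powr_divide) auto
      also have "(2 / 4::real) powr p x \<le> (2 / 4) powr 1"
        using x by (intro powr_mono') auto
      finally have "\<bar>w x / (4 * \<tau>)\<bar> powr p x \<le> 1 / 2 * (?a powr p x + ?b powr p x)"
        by (simp add: mult_right_mono)
      then have "ennreal (\<bar>w x / (4 * \<tau>)\<bar> powr p x) \<le> ennreal (1 / 2 * (?a powr p x + ?b powr p x))"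
        by (rule ennreal_leI)
      also have "\<dots> = ennreal (1 / 2) * (ennreal (?a powr p x) + ennreal (?b powr p x))"
        by (subst ennreal_mult) auto
      finally show ?case .
    qed
  qed
  also have "\<dots> = ennreal (1 / 2) * (modular \<Omega> p (\<lambda>x. u x / \<tau>) + modular \<Omega> p (\<lambda>x. v x / \<tau>))"
    unfolding modular_def using m by (simp add: nn_integral_cmult nn_integral_add)
  also have "\<dots> \<le> ennreal (1 / 2) * (1 + 1)"
    using le by (intro mult_left_mono add_mono) auto
  also have "\<dots> = ennreal (1 / 2 * 2)"
    by (subst ennreal_mult) auto
  also have "\<dots> = 1" by simp
  finally show ?thesis .
qed

lemma powr_mult_le_half_powr:
  fixes j :: nat and a p :: real
  assumes "1 \<le> p"
  shows "\<bar>2 ^ j * a\<bar> powr p \<le> (1 / 2) ^ j * \<bar>a / (1 / 4) ^ j\<bar> powr p"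
proof -
  have "\<bar>2 ^ j * a\<bar> = (1 / 2) ^ j * \<bar>a / (1 / 4) ^ j\<bar>"
  proof -
    have eq: "(1 / 2) ^ j / (1 / 4) ^ j = (2::real) ^ j" by (simp flip: power_divide)
    have "(1 / 2) ^ j * \<bar>a / (1 / 4) ^ j\<bar> = (1 / 2) ^ j / (1 / 4) ^ j * \<bar>a\<bar>"
      by (simp add: abs_divide)
    then show ?thesis unfolding eq by (simp add: abs_mult)
  qed
  then have "\<bar>2 ^ j * a\<bar> powr p = ((1 / 2) ^ j) powr p * \<bar>a / (1 / 4) ^ j\<bar> powr p"
    by (simp only: powr_mult[of "(1 / 2) ^ j" "\<bar>a / (1 / 4) ^ j\<bar>"] zero_le_power abs_ge_zero)
  also have "((1 / 2) ^ j) powr p \<le> ((1 / 2) ^ j :: real) powr 1"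
    using assms by (intro powr_mono') (auto simp: power_le_one)
  finally show ?thesis by (simp add: mult_right_mono)
qed

text \<open>Convergence at the rate \<open>1 / 4 ^ j\<close> in the norm leaves room for a factor \<open>2 ^ j\<close>: the modulars of
  \<open>2 ^ j * (u - v j)\<close> are summable, so almost everywhere these functions are eventually below one.\<close>

lemma AE_tendsto_of_modular:
  assumes p: "\<forall>x\<in>\<Omega>. 1 \<le> p x"
    and m: "\<And>j t. (\<lambda>x. \<bar>t * (u x - v j x)\<bar> powr p x) \<in> borel_measurable (lebesgue_on \<Omega>)"
    and le: "\<And>j. modular \<Omega> p (\<lambda>x. (u x - v j x) / (1 / 4) ^ j) \<le> 1"
  shows "AE x in lebesgue_on \<Omega>. (\<lambda>j. v j x) \<longlonglongrightarrow> u x"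
proof -
  let ?T = "\<lambda>j x. \<bar>2 ^ j * (u x - v j x)\<bar> powr p x"
  have T: "(\<integral>\<^sup>+x. ennreal (?T j x) \<partial>lebesgue_on \<Omega>) \<le> ennreal ((1 / 2) ^ j)" for j
  proof -
    have "(\<integral>\<^sup>+x. ennreal (?T j x) \<partial>lebesgue_on \<Omega>)
        \<le> (\<integral>\<^sup>+x. ennreal ((1 / 2) ^ j) * ennreal (\<bar>(u x - v j x) / (1 / 4) ^ j\<bar> powr p x) \<partial>lebesgue_on \<Omega>)"
    proof (rule nn_integral_mono)
      fix x assume "x \<in> space (lebesgue_on \<Omega>)"
      then have "1 \<le> p x" using p by simp
      from ennreal_leI[OF powr_mult_le_half_powr[OF this]]
      show "ennreal (?T j x) \<le> ennreal ((1 / 2) ^ j) * ennreal (\<bar>(u x - v j x) / (1 / 4) ^ j\<bar> powr p x)"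
        by (subst ennreal_mult[symmetric]) auto
    qed
    also have "\<dots> = ennreal ((1 / 2) ^ j) * modular \<Omega> p (\<lambda>x. (u x - v j x) / (1 / 4) ^ j)"
    proof -
      have "(\<lambda>x. \<bar>(u x - v j x) / (1 / 4) ^ j\<bar> powr p x) \<in> borel_measurable (lebesgue_on \<Omega>)"
        using m[of "inverse ((1 / 4) ^ j)" j] by (simp only: divide_inverse mult.commute)
      from measurable_compose[OF this measurable_ennreal] show ?thesis
        unfolding modular_def by (rule nn_integral_cmult)
    qed
    also have "\<dots> \<le> ennreal ((1 / 2) ^ j) * 1" by (intro mult_left_mono le) simp
    finally show ?thesis by simp
  qed
  have Tm: "(\<lambda>x. ennreal (?T j x)) \<in> borel_measurable (lebesgue_on \<Omega>)" for j
    by (rule measurable_compose[OF m measurable_ennreal])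
  have "(\<integral>\<^sup>+x. (\<Sum>j. ennreal (?T j x)) \<partial>lebesgue_on \<Omega>) = (\<Sum>j. \<integral>\<^sup>+x. ennreal (?T j x) \<partial>lebesgue_on \<Omega>)"
    by (rule nn_integral_suminf[OF Tm])
  also have "\<dots> \<le> (\<Sum>j. ennreal ((1 / 2) ^ j))"
    by (intro suminf_le T) auto
  also have "\<dots> < \<infinity>"
    by (subst suminf_ennreal2) (auto simp: summable_geometric)
  finally have fin: "(\<integral>\<^sup>+x. (\<Sum>j. ennreal (?T j x)) \<partial>lebesgue_on \<Omega>) \<noteq> \<infinity>"
    by simp
  have "AE x in lebesgue_on \<Omega>. (\<Sum>j. ennreal (?T j x)) \<noteq> \<infinity>"
    by (rule nn_integral_noteq_infinite[OF _ fin]) (intro borel_measurable_suminf_order Tm)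
  moreover have "AE x in lebesgue_on \<Omega>. x \<in> \<Omega>" by (rule AE_I2) simp
  ultimately show ?thesis
  proof eventually_elim
    case (elim x)
    have "summable (\<lambda>j. ?T j x)"
      using elim(1) by (intro summable_suminf_not_top) auto
    then have "(\<lambda>j. ?T j x) \<longlonglongrightarrow> 0" by (rule summable_LIMSEQ_zero)
    then have "eventually (\<lambda>j. ?T j x < 1) sequentially"
      by (rule order_tendstoD) simp
    then have ev: "eventually (\<lambda>j. norm (v j x - u x) \<le> (1 / 2) ^ j) sequentially"
    proof eventually_elim
      case (elim j)
      have "\<not> 1 \<le> \<bar>2 ^ j * (u x - v j x)\<bar>"
      proof
        assume "1 \<le> \<bar>2 ^ j * (u x - v j x)\<bar>"
        then have "1 \<le> ?T j x" using p \<open>x \<in> \<Omega>\<close> by (intro ge_one_powr_ge_zero) auto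
        then show False using elim by simp
      qed
      then have "2 ^ j * \<bar>u x - v j x\<bar> \<le> 1" by (simp only: abs_mult) simp
      then have "\<bar>u x - v j x\<bar> \<le> 1 / 2 ^ j" by (simp add: divide_simps mult.commute)
      then show ?case by (simp add: abs_minus_commute power_one_over)
    qed
    have "(\<lambda>j. (1 / 2 :: real) ^ j) \<longlonglongrightarrow> 0" by (intro LIMSEQ_power_zero) simp
    then have "(\<lambda>j. v j x - u x) \<longlonglongrightarrow> 0"
      by (rule Lim_null_comparison[OF ev])
    then show ?case by (rule LIM_zero_cancel)
  qed
qed

section \<open>Hardy's inequality in the Sobolev space\<close>

lemma test_function_scale:
  fixes \<phi> :: "'a::euclidean_space \<Rightarrow> real"
  assumes \<phi>: "\<phi> \<in> test_functions \<Omega>" and t: "t \<noteq> 0"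
  shows "(\<lambda>x. \<phi> x / t) \<in> test_functions \<Omega>"
    and "classical_gradient (\<lambda>x. \<phi> x / t) x = classical_gradient \<phi> x /\<^sub>R t"
proof -
  have "Ck k (\<lambda>x. (1 / t) * \<phi> x)" for k
    by (intro Ck_mult Ck_const test_functionD(1)[OF \<phi>])
  moreover have "{x. \<phi> x / t \<noteq> 0} = {x. \<phi> x \<noteq> 0}" using t by auto
  ultimately show "(\<lambda>x. \<phi> x / t) \<in> test_functions \<Omega>"
    using \<phi> by (simp add: test_functions_def)
  have "((\<lambda>x. \<phi> x / t) has_derivative (\<lambda>h. frechet_derivative \<phi> (at x) h / t)) (at x)" for x
    by (rule bounded_linear.has_derivative[OF bounded_linear_divide test_functionD(5)[OF \<phi>]])
  then have "frechet_derivative (\<lambda>x. \<phi> x / t) (at x) = (\<lambda>h. frechet_derivative \<phi> (at x) h / t)" for x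
    using frechet_derivative_at by metis
  then show "classical_gradient (\<lambda>x. \<phi> x / t) x = classical_gradient \<phi> x /\<^sub>R t"
    by (simp add: classical_gradient_def scaleR_sum_right divide_inverse mult.commute)
qed

text \<open>Hardy's inequality in the form of a modular bound, for every \<open>\<tau>\<close> above the gradient norm.
  Approximating test functions have gradients of norm at most \<open>4 * \<tau>\<close>, and a sequence of them converges
  almost everywhere, so Fatou's lemma carries the inequality over from test functions.\<close>

lemma hardy_W1px0:
  fixes \<Omega> :: "'a::euclidean_space set"
  assumes dom: "bounded_lipschitz_domain \<Omega>" and ve: "variable_exponent \<Omega> p" and lh: "log_hoelder \<Omega> p"
  obtains C where "0 \<le> C"
    "\<And>u \<tau>. u \<in> W1px0 \<Omega> p \<Longrightarrow> grad_norm \<Omega> p u < \<tau> \<Longrightarrow>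
       0 < \<tau> \<and> modular \<Omega> p (\<lambda>x. u x / (4 * \<tau>) / bdry_dist \<Omega> x) \<le> ennreal C"
proof -
  have \<Omega>: "open \<Omega>" "bounded \<Omega>"
    using dom by (auto simp: bounded_lipschitz_domain_def)
  obtain q P where q: "1 < q" and pb: "\<And>x. x \<in> \<Omega> \<Longrightarrow> q \<le> p x" "\<And>x. x \<in> \<Omega> \<Longrightarrow> p x \<le> P"
    using ve closure_subset[of \<Omega>] unfolding variable_exponent_def by blast
  have p1: "\<forall>x\<in>\<Omega>. 1 \<le> p x" and p0: "\<forall>x\<in>\<Omega>. 0 \<le> p x" and pP: "\<forall>x\<in>\<Omega>. p x \<le> P"
    using pb q by force+
  have "continuous_on \<Omega> p"
    using log_hoelder_continuous_on[OF lh] closure_subset continuous_on_subset by blast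
  then have [measurable]: "p \<in> borel_measurable (lebesgue_on \<Omega>)"
    by (rule borel_measurable_lebesgue_on_continuous[OF \<Omega>(1)])
  have pm: "(\<lambda>x. \<bar>v x\<bar> powr p x) \<in> borel_measurable (lebesgue_on \<Omega>)"
    if "v \<in> borel_measurable (lebesgue_on \<Omega>)" for v
    using that by measurable
  have dm[measurable]: "bdry_dist \<Omega> \<in> borel_measurable (lebesgue_on \<Omega>)"
    unfolding bdry_dist_def
    by (intro borel_measurable_lebesgue_on_continuous[OF \<Omega>(1)] continuous_on_infdist continuous_on_id)
  obtain C where C: "0 \<le> C"
    "\<And>\<phi>. \<phi> \<in> test_functions \<Omega> \<Longrightarrow> modular \<Omega> p (\<lambda>x. norm (classical_gradient \<phi> x)) \<le> 1 \<Longrightarrow>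
       modular \<Omega> p (\<lambda>x. \<phi> x / bdry_dist \<Omega> x) \<le> ennreal C"
    using hardy_test_function[OF dom ve lh] by blast
  show ?thesis
  proof (rule that[OF C(1)])
    fix u \<tau> assume u: "u \<in> W1px0 \<Omega> p" and less: "grad_norm \<Omega> p u < \<tau>"
    let ?G = "weak_grad \<Omega> u"
    have um[measurable]: "u \<in> borel_measurable (lebesgue_on \<Omega>)" and ufin: "modular \<Omega> p u < \<infinity>"
      and uG: "\<exists>G. has_weak_gradient \<Omega> u G"
      and Gm[measurable]: "(\<lambda>x. norm (?G x)) \<in> borel_measurable (lebesgue_on \<Omega>)"
      and Gfin: "modular \<Omega> p (\<lambda>x. norm (?G x)) < \<infinity>"
      and dens: "\<And>e. 0 < e \<Longrightarrow> \<exists>\<phi>\<in>test_functions \<Omega>. W1px_norm \<Omega> p (\<lambda>x. u x - \<phi> x) < e"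
      using u by (auto simp: W1px0_def W1px_def Lpx_def)
    have "\<exists>t>0. modular \<Omega> p (\<lambda>x. norm (?G x) / t) \<le> 1"
      by (rule modular_scale_le_1[OF p1 pm[OF Gm] Gfin AE_I2]) simp
    note G\<tau> = modular_le_1_of_luxemburg_norm_less(2)[OF p1 this less[unfolded grad_norm_def]]
    then have \<tau>: "0 < \<tau>" by simp
    have approx: "\<exists>\<phi>\<in>test_functions \<Omega>. modular \<Omega> p (\<lambda>x. (u x - \<phi> x) / (1 / 4) ^ j) \<le> 1 \<and>
        modular \<Omega> p (\<lambda>x. norm (classical_gradient \<phi> x) / (4 * \<tau>)) \<le> 1" for j :: nat
    proof -
      \<comment> \<open>The bound by \<open>\<tau>\<close> controls the gradient, the bound by \<open>(1 / 4) ^ j\<close> gives convergence almost everywhere.\<close>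
      define e where "e = min \<tau> ((1 / 4) ^ j)"
      have "0 < e" using \<tau> by (simp add: e_def)
      then obtain \<phi> where \<phi>: "\<phi> \<in> test_functions \<Omega>" and n: "W1px_norm \<Omega> p (\<lambda>x. u x - \<phi> x) < e"
        using dens by blast
      let ?H = "weak_grad \<Omega> (\<lambda>x. u x - \<phi> x)"
      obtain G0 where "has_weak_gradient \<Omega> u G0" using uG by blast
      note wg = weak_grad_diff_test_function[OF \<Omega>(1) this \<phi>]
      have \<phi>m: "\<phi> \<in> borel_measurable (lebesgue_on \<Omega>)"
        by (intro borel_measurable_lebesgue_on_continuous[OF \<Omega>(1)] test_functionD(6)[OF \<phi>])
      have cgm: "(\<lambda>x. norm (classical_gradient \<phi> x)) \<in> borel_measurable (lebesgue_on \<Omega>)"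
        by (intro borel_measurable_lebesgue_on_continuous[OF \<Omega>(1)] continuous_on_norm
            continuous_classical_gradient[OF \<phi>])
      have "?H \<in> borel_measurable (lebesgue_on \<Omega>)"
        by (rule has_weak_gradient_measurable[OF \<Omega>(1) has_weak_gradient_weak_grad[OF
            has_weak_gradient_diff[OF \<Omega>(1) \<open>has_weak_gradient \<Omega> u G0\<close> has_weak_gradient_classical[OF \<Omega>(1) \<phi>]]]])
      then have Hm: "(\<lambda>x. norm (?H x)) \<in> borel_measurable (lebesgue_on \<Omega>)"
        by (rule measurable_compose[OF _ borel_measurable_norm])
      have "\<exists>B\<ge>1. \<forall>x. norm (\<phi> x) \<le> B"
        by (rule continuous_compact_support_bounded[OF test_functionD(6)[OF \<phi>] test_functionD(2)[OF \<phi>]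
              zero_off_support[of _ \<phi>]])
      then obtain B where B: "1 \<le> B" "\<forall>x. norm (\<phi> x) \<le> B" by blast
      have "\<exists>B\<ge>1. \<forall>x. norm (classical_gradient \<phi> x) \<le> B"
        by (rule continuous_compact_support_bounded[OF continuous_classical_gradient[OF \<phi>]
              test_functionD(2)[OF \<phi>] classical_gradient_zero[of _ \<phi>]])
      then obtain B' where B': "1 \<le> B'" "\<forall>x. norm (classical_gradient \<phi> x) \<le> B'" by blast
      have "modular \<Omega> p \<phi> < \<infinity>"
        using B by (intro modular_bounded_finite[OF \<Omega> p0 pP, of B]) auto
      then have fin1: "modular \<Omega> p (\<lambda>x. \<bar>u x\<bar> + \<bar>\<phi> x\<bar>) < \<infinity>"
        by (intro modular_add_finite[OF p0 pP pm[OF um] pm[OF \<phi>m] ufin])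
      have ex1: "\<exists>t>0. modular \<Omega> p (\<lambda>x. (u x - \<phi> x) / t) \<le> 1"
        using um \<phi>m by (intro modular_scale_le_1[OF p1 pm fin1]) auto
      have "modular \<Omega> p (\<lambda>x. norm (classical_gradient \<phi> x)) < \<infinity>"
        using B' by (intro modular_bounded_finite[OF \<Omega> p0 pP, of B']) auto
      then have fin2: "modular \<Omega> p (\<lambda>x. \<bar>norm (?G x)\<bar> + \<bar>norm (classical_gradient \<phi> x)\<bar>) < \<infinity>"
        by (intro modular_add_finite[OF p0 pP pm[OF Gm] pm[OF cgm] Gfin])
      have ex2: "\<exists>t>0. modular \<Omega> p (\<lambda>x. norm (?H x) / t) \<le> 1"
      proof (rule modular_scale_le_1[OF p1 pm fin2])
        show "(\<lambda>x. \<bar>norm (?G x)\<bar> + \<bar>norm (classical_gradient \<phi> x)\<bar>) \<in> borel_measurable (lebesgue_on \<Omega>)"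
          by (intro borel_measurable_add borel_measurable_abs Gm cgm)
        show "AE x in lebesgue_on \<Omega>. \<bar>norm (?H x)\<bar> \<le> \<bar>\<bar>norm (?G x)\<bar> + \<bar>norm (classical_gradient \<phi> x)\<bar>\<bar>"
          using wg by eventually_elim (simp add: norm_triangle_ineq4)
      qed
      have n1: "luxemburg_norm \<Omega> p (\<lambda>x. u x - \<phi> x) < (1 / 4) ^ j"
        and n2: "luxemburg_norm \<Omega> p (\<lambda>x. norm (?H x)) < \<tau>"
        using n modular_le_1_of_luxemburg_norm_less(1)[OF p1 ex1]
          modular_le_1_of_luxemburg_norm_less(1)[OF p1 ex2]
        by (auto simp: W1px_norm_def grad_norm_def e_def)
      have "modular \<Omega> p (\<lambda>x. norm (classical_gradient \<phi> x) / (4 * \<tau>)) \<le> 1"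
      proof (rule modular_add_le_1[OF p1 \<tau> pm pm])
        show "(\<lambda>x. norm (?G x) / \<tau>) \<in> borel_measurable (lebesgue_on \<Omega>)"
          "(\<lambda>x. norm (?H x) / \<tau>) \<in> borel_measurable (lebesgue_on \<Omega>)"
          by (intro borel_measurable_divide Gm Hm borel_measurable_const)+
        show "modular \<Omega> p (\<lambda>x. norm (?G x) / \<tau>) \<le> 1" using G\<tau> by simp
        show "modular \<Omega> p (\<lambda>x. norm (?H x) / \<tau>) \<le> 1"
          using modular_le_1_of_luxemburg_norm_less(2)[OF p1 ex2 n2] by simp
        show "AE x in lebesgue_on \<Omega>. \<bar>norm (classical_gradient \<phi> x)\<bar> \<le> \<bar>norm (?G x)\<bar> + \<bar>norm (?H x)\<bar>"
          using wg
        proof eventually_elim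
          case (elim x)
          then have "classical_gradient \<phi> x = ?G x - ?H x" by simp
          then show ?case by (simp add: norm_triangle_ineq4)
        qed
      qed
      then show ?thesis
        using \<phi> modular_le_1_of_luxemburg_norm_less(2)[OF p1 ex1 n1] by blast
    qed
    then have "\<forall>j. \<exists>\<phi>. \<phi> \<in> test_functions \<Omega> \<and> modular \<Omega> p (\<lambda>x. (u x - \<phi> x) / (1 / 4) ^ j) \<le> 1 \<and>
        modular \<Omega> p (\<lambda>x. norm (classical_gradient \<phi> x) / (4 * \<tau>)) \<le> 1" by blast
    then obtain \<phi> where "\<forall>j. \<phi> j \<in> test_functions \<Omega> \<and> modular \<Omega> p (\<lambda>x. (u x - \<phi> j x) / (1 / 4) ^ j) \<le> 1 \<and>
        modular \<Omega> p (\<lambda>x. norm (classical_gradient (\<phi> j) x) / (4 * \<tau>)) \<le> 1"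
      by (rule choice[THEN exE])
    then have \<phi>: "\<phi> j \<in> test_functions \<Omega>" "modular \<Omega> p (\<lambda>x. (u x - \<phi> j x) / (1 / 4) ^ j) \<le> 1"
        "modular \<Omega> p (\<lambda>x. norm (classical_gradient (\<phi> j) x) / (4 * \<tau>)) \<le> 1" for j
      by simp_all
    have [measurable]: "\<phi> j \<in> borel_measurable (lebesgue_on \<Omega>)" for j
      by (intro borel_measurable_lebesgue_on_continuous[OF \<Omega>(1)] test_functionD(6)[OF \<phi>(1)])
    have conv: "AE x in lebesgue_on \<Omega>. (\<lambda>j. \<phi> j x) \<longlonglongrightarrow> u x"
      by (rule AE_tendsto_of_modular[OF p1 pm \<phi>(2)]) measurable
    have hardy: "modular \<Omega> p (\<lambda>x. \<phi> j x / (4 * \<tau>) / bdry_dist \<Omega> x) \<le> ennreal C" for j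
    proof (rule C(2))
      have t: "4 * \<tau> \<noteq> 0" using \<tau> by simp
      show "(\<lambda>x. \<phi> j x / (4 * \<tau>)) \<in> test_functions \<Omega>"
        by (rule test_function_scale(1)[OF \<phi>(1) t])
      have "norm (classical_gradient (\<lambda>x. \<phi> j x / (4 * \<tau>)) x) = norm (classical_gradient (\<phi> j) x) / (4 * \<tau>)" for x
      proof -
        have "0 < inverse (4 * \<tau>)" using \<tau> by simp
        then show ?thesis
          by (subst test_function_scale(2)[OF \<phi>(1)[of j] t])
             (simp only: norm_scaleR abs_of_pos divide_inverse mult.commute[of "inverse _"])
      qed
      then show "modular \<Omega> p (\<lambda>x. norm (classical_gradient (\<lambda>x. \<phi> j x / (4 * \<tau>)) x)) \<le> 1"
        using \<phi>(3)[of j] by (simp only:)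
    qed
    have "modular \<Omega> p (\<lambda>x. u x / (4 * \<tau>) / bdry_dist \<Omega> x)
        \<le> (\<integral>\<^sup>+x. liminf (\<lambda>j. ennreal (\<bar>\<phi> j x / (4 * \<tau>) / bdry_dist \<Omega> x\<bar> powr p x)) \<partial>lebesgue_on \<Omega>)"
      unfolding modular_def
    proof (rule nn_integral_mono_AE)
      have "AE x in lebesgue_on \<Omega>. x \<in> \<Omega>" by (rule AE_I2) simp
      with conv show "AE x in lebesgue_on \<Omega>. ennreal (\<bar>u x / (4 * \<tau>) / bdry_dist \<Omega> x\<bar> powr p x)
          \<le> liminf (\<lambda>j. ennreal (\<bar>\<phi> j x / (4 * \<tau>) / bdry_dist \<Omega> x\<bar> powr p x))"
      proof eventually_elim
        case (elim x)
        have "0 < p x" using pb(1)[OF elim(2)] q by simp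
        have "(\<lambda>j. ennreal (\<bar>\<phi> j x / (4 * \<tau>) / bdry_dist \<Omega> x\<bar> powr p x))
            \<longlonglongrightarrow> ennreal (\<bar>u x / (4 * \<tau>) / bdry_dist \<Omega> x\<bar> powr p x)"
          using bdry_dist_pos[OF \<Omega> elim(2)] \<tau> \<open>0 < p x\<close>
          by (intro tendsto_ennrealI tendsto_powr' tendsto_rabs tendsto_divide elim(1) tendsto_const) auto
        from lim_imp_Liminf[OF trivial_limit_sequentially this] show ?case
          by (simp only: order_refl)
      qed
    qed
    also have "\<dots> \<le> liminf (\<lambda>j. \<integral>\<^sup>+x. ennreal (\<bar>\<phi> j x / (4 * \<tau>) / bdry_dist \<Omega> x\<bar> powr p x) \<partial>lebesgue_on \<Omega>)"
      by (rule nn_integral_liminf) measurable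
    also have "\<dots> \<le> liminf (\<lambda>j. ennreal C)"
      using hardy unfolding modular_def by (intro Liminf_mono always_eventually) simp
    also have "\<dots> = ennreal C" by (simp add: Liminf_const)
    finally show "0 < \<tau> \<and> modular \<Omega> p (\<lambda>x. u x / (4 * \<tau>) / bdry_dist \<Omega> x) \<le> ennreal C"
      using \<tau> by simp
  qed
qed

section \<open>Convergence and boundedness of the singular terms\<close>

text \<open>Young's inequality with the crude constant one: compare \<open>s\<close> with \<open>t powr (p - 1)\<close>.\<close>

lemma young_conj_exponent:
  fixes s t p :: real
  assumes "0 \<le> s" "0 \<le> t" "1 < p"
  shows "s * t \<le> s powr (p / (p - 1)) + t powr p"
proof (cases "s \<le> t powr (p - 1)")
  case True
  then have "s * t \<le> t powr (p - 1) * t" using assms by (intro mult_right_mono) auto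
  also have "\<dots> = t powr p"
    using assms powr_mult_base[of t "p - 1"] by (simp add: mult.commute)
  finally show ?thesis by (simp add: add_increasing)
next
  case False
  then have s: "0 < s" using powr_ge_zero[of t "p - 1"] by linarith
  have "t = (t powr (p - 1)) powr (1 / (p - 1))" using assms by (simp add: powr_powr)
  also have "\<dots> \<le> s powr (1 / (p - 1))" using False assms by (intro powr_mono2) auto
  finally have "s * t \<le> s * s powr (1 / (p - 1))" using s by (intro mult_left_mono) auto
  also have "\<dots> = s powr (1 + 1 / (p - 1))" using s powr_mult_base[of s "1 / (p - 1)"] by simp
  also have "1 + 1 / (p - 1) = p / (p - 1)" using assms by (simp add: field_simps)
  finally show ?thesis by (simp add: add_increasing2)
qed

lemma borel_measurable_lebesgue_on_AE:
  fixes f g :: "'a::euclidean_space \<Rightarrow> real"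
  assumes "open \<Omega>" "f \<in> borel_measurable (lebesgue_on \<Omega>)" "AE x in lebesgue_on \<Omega>. f x = g x"
  shows "g \<in> borel_measurable (lebesgue_on \<Omega>)"
proof -
  have \<Omega>: "\<Omega> \<inter> space lebesgue \<in> sets lebesgue" using assms(1) by simp
  have "(\<lambda>x. indicator \<Omega> x *\<^sub>R f x) \<in> borel_measurable lebesgue"
    using assms(2) unfolding borel_measurable_restrict_space_iff[OF \<Omega>] .
  moreover have "AE x in lebesgue. indicator \<Omega> x *\<^sub>R f x = indicator \<Omega> x *\<^sub>R g x"
    using assms(3) unfolding AE_restrict_space_iff[OF \<Omega>]
    by eventually_elim (simp add: indicator_def)
  ultimately have "(\<lambda>x. indicator \<Omega> x *\<^sub>R g x) \<in> borel_measurable lebesgue"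
    by (rule borel_measurable_AE)
  then show ?thesis
    unfolding borel_measurable_restrict_space_iff[OF \<Omega>] .
qed

text \<open>Young's inequality bounds the integral by \<open>4 * \<tau>\<close> times the sum of the modular of \<open>\<omega>\<close> and the
  modular in Hardy's inequality. Letting \<open>\<tau>\<close> decrease to the gradient norm yields the linear bound.\<close>

lemma singular_weight_bound:
  fixes \<Omega> :: "'a::euclidean_space set" and p \<omega> :: "'a \<Rightarrow> real"
  assumes dom: "bounded_lipschitz_domain \<Omega>" and ve: "variable_exponent \<Omega> p" and lh: "log_hoelder \<Omega> p"
    and \<omega>: "\<omega> \<in> Lpx \<Omega> (conj_exponent p)"
  obtains C where "0 \<le> C"
    "\<And>\<phi>. \<phi> \<in> W1px0 \<Omega> p \<Longrightarrow> integrable (lebesgue_on \<Omega>) (\<lambda>x. \<bar>\<omega> x\<bar> * (\<bar>\<phi> x\<bar> / bdry_dist \<Omega> x))"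
    "\<And>\<phi>. \<phi> \<in> W1px0 \<Omega> p \<Longrightarrow>
       (\<integral>x. \<bar>\<omega> x\<bar> * (\<bar>\<phi> x\<bar> / bdry_dist \<Omega> x) \<partial>lebesgue_on \<Omega>) \<le> C * grad_norm \<Omega> p \<phi>"
proof -
  have \<Omega>: "open \<Omega>" "bounded \<Omega>"
    using dom by (auto simp: bounded_lipschitz_domain_def)
  obtain q where q: "1 < q" and pb: "\<And>x. x \<in> \<Omega> \<Longrightarrow> q \<le> p x"
    using ve closure_subset[of \<Omega>] unfolding variable_exponent_def by blast
  obtain H where H: "0 \<le> H"
    "\<And>u \<tau>. u \<in> W1px0 \<Omega> p \<Longrightarrow> grad_norm \<Omega> p u < \<tau> \<Longrightarrow>
       0 < \<tau> \<and> modular \<Omega> p (\<lambda>x. u x / (4 * \<tau>) / bdry_dist \<Omega> x) \<le> ennreal H"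
    using hardy_W1px0[OF dom ve lh] by blast
  have \<omega>m: "\<omega> \<in> borel_measurable (lebesgue_on \<Omega>)" and "modular \<Omega> (conj_exponent p) \<omega> < \<infinity>"
    using \<omega> by (auto simp: Lpx_def)
  then obtain W where W: "modular \<Omega> (conj_exponent p) \<omega> = ennreal W" "0 \<le> W"
    by (cases "modular \<Omega> (conj_exponent p) \<omega>") auto
  have "continuous_on \<Omega> p"
    using log_hoelder_continuous_on[OF lh] closure_subset continuous_on_subset by blast
  then have pm: "p \<in> borel_measurable (lebesgue_on \<Omega>)"
    by (rule borel_measurable_lebesgue_on_continuous[OF \<Omega>(1)])
  have dm: "bdry_dist \<Omega> \<in> borel_measurable (lebesgue_on \<Omega>)"
    unfolding bdry_dist_def
    by (intro borel_measurable_lebesgue_on_continuous[OF \<Omega>(1)] continuous_on_infdist continuous_on_id)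
  let ?f = "\<lambda>\<phi> x. \<bar>\<omega> x\<bar> * (\<bar>\<phi> x\<bar> / bdry_dist \<Omega> x)"
  have fm: "?f \<phi> \<in> borel_measurable (lebesgue_on \<Omega>)" if "\<phi> \<in> W1px0 \<Omega> p" for \<phi>
    using that \<omega>m dm by (auto simp: W1px0_def W1px_def Lpx_def)
  have f0: "AE x in lebesgue_on \<Omega>. 0 \<le> ?f \<phi> x" for \<phi>
    by (intro AE_I2 mult_nonneg_nonneg divide_nonneg_nonneg) (simp_all add: bdry_dist_def infdist_nonneg)
  have bound: "(\<integral>\<^sup>+x. ennreal (?f \<phi> x) \<partial>lebesgue_on \<Omega>) \<le> ennreal (4 * (W + H) * \<tau>)"
    if \<phi>: "\<phi> \<in> W1px0 \<Omega> p" and \<tau>: "grad_norm \<Omega> p \<phi> < \<tau>" for \<phi> \<tau>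
  proof -
    note H\<tau> = H(2)[OF \<phi> \<tau>]
    then have t: "0 < \<tau>" by (rule conjunct1)
    have \<phi>m: "\<phi> \<in> borel_measurable (lebesgue_on \<Omega>)" using \<phi> by (auto simp: W1px0_def W1px_def Lpx_def)
    have "(\<integral>\<^sup>+x. ennreal (?f \<phi> x) \<partial>lebesgue_on \<Omega>)
        \<le> (\<integral>\<^sup>+x. ennreal (4 * \<tau>) * (ennreal (\<bar>\<omega> x\<bar> powr conj_exponent p x)
              + ennreal (\<bar>\<phi> x / (4 * \<tau>) / bdry_dist \<Omega> x\<bar> powr p x)) \<partial>lebesgue_on \<Omega>)"
    proof (rule nn_integral_mono)
      fix x assume "x \<in> space (lebesgue_on \<Omega>)"
      then have x: "x \<in> \<Omega>" by simp
      have d: "0 < bdry_dist \<Omega> x" by (rule bdry_dist_pos[OF \<Omega> x])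
      let ?b = "\<bar>\<phi> x / (4 * \<tau>) / bdry_dist \<Omega> x\<bar>"
      have "?f \<phi> x = 4 * \<tau> * (\<bar>\<omega> x\<bar> * ?b)"
        using d t by (simp add: abs_mult abs_divide)
      also have "\<dots> \<le> 4 * \<tau> * (\<bar>\<omega> x\<bar> powr conj_exponent p x + ?b powr p x)"
        unfolding conj_exponent_def using pb[OF x] q t
        by (intro mult_left_mono young_conj_exponent) auto
      finally have "ennreal (?f \<phi> x) \<le> ennreal (4 * \<tau> * (\<bar>\<omega> x\<bar> powr conj_exponent p x + ?b powr p x))"
        by (rule ennreal_leI)
      also have "\<dots> = ennreal (4 * \<tau>) * (ennreal (\<bar>\<omega> x\<bar> powr conj_exponent p x) + ennreal (?b powr p x))"
        using t by (subst ennreal_mult) auto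
      finally show "ennreal (?f \<phi> x) \<le> ennreal (4 * \<tau>) * (ennreal (\<bar>\<omega> x\<bar> powr conj_exponent p x) + ennreal (?b powr p x))" .
    qed
    also have "\<dots> = ennreal (4 * \<tau>) * (modular \<Omega> (conj_exponent p) \<omega> + modular \<Omega> p (\<lambda>x. \<phi> x / (4 * \<tau>) / bdry_dist \<Omega> x))"
    proof -
      have m1: "(\<lambda>x. ennreal (\<bar>\<omega> x\<bar> powr conj_exponent p x)) \<in> borel_measurable (lebesgue_on \<Omega>)"
        unfolding conj_exponent_def using \<omega>m pm by measurable
      have m2: "(\<lambda>x. ennreal (\<bar>\<phi> x / (4 * \<tau>) / bdry_dist \<Omega> x\<bar> powr p x)) \<in> borel_measurable (lebesgue_on \<Omega>)"
        using \<phi>m dm pm by measurable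
      show ?thesis
        unfolding modular_def nn_integral_add[OF m1 m2, symmetric]
        by (intro nn_integral_cmult borel_measurable_add m1 m2)
    qed
    also have "\<dots> \<le> ennreal (4 * \<tau>) * (ennreal W + ennreal H)"
      using conjunct2[OF H\<tau>] by (intro mult_left_mono add_mono) (simp_all only: W(1) order_refl zero_le)
    also have "\<dots> = ennreal (4 * \<tau> * (W + H))"
      using t W(2) H(1) by (simp add: ennreal_mult)
    also have "4 * \<tau> * (W + H) = 4 * (W + H) * \<tau>" by (simp only: mult.commute mult.left_commute mult.assoc)
    finally show ?thesis .
  qed
  have int: "integrable (lebesgue_on \<Omega>) (?f \<phi>)" if \<phi>: "\<phi> \<in> W1px0 \<Omega> p" for \<phi>
  proof (rule integrableI_nonneg[OF fm[OF \<phi>] f0])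
    have "(\<integral>\<^sup>+x. ennreal (?f \<phi> x) \<partial>lebesgue_on \<Omega>) \<le> ennreal (4 * (W + H) * (grad_norm \<Omega> p \<phi> + 1))"
      by (rule bound[OF \<phi>]) simp
    also have "\<dots> < \<infinity>" by simp
    finally show "(\<integral>\<^sup>+x. ennreal (?f \<phi> x) \<partial>lebesgue_on \<Omega>) < \<infinity>" .
  qed
  show ?thesis
  proof (rule that[of "4 * (W + H)"])
    show "0 \<le> 4 * (W + H)" using W(2) H(1) by simp
    fix \<phi> assume \<phi>: "\<phi> \<in> W1px0 \<Omega> p"
    show "integrable (lebesgue_on \<Omega>) (?f \<phi>)" by (rule int[OF \<phi>])
    let ?g = "grad_norm \<Omega> p \<phi>" and ?I = "\<integral>x. ?f \<phi> x \<partial>lebesgue_on \<Omega>"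
    have le: "?I \<le> 4 * (W + H) * \<tau>" if "?g < \<tau>" for \<tau>
    proof -
      have "0 < \<tau>" using H(2)[OF \<phi> that] by (rule conjunct1)
      have "ennreal ?I = (\<integral>\<^sup>+x. ennreal (?f \<phi> x) \<partial>lebesgue_on \<Omega>)"
        by (rule nn_integral_eq_integral[OF int[OF \<phi>] f0, symmetric])
      also have "\<dots> \<le> ennreal (4 * (W + H) * \<tau>)" by (rule bound[OF \<phi> that])
      finally show ?thesis using W(2) H(1) \<open>0 < \<tau>\<close> by (subst (asm) ennreal_le_iff) auto
    qed
    have "(\<lambda>n. 4 * (W + H) * (?g + inverse (real (Suc n)))) \<longlonglongrightarrow> 4 * (W + H) * (?g + 0)"
      by (intro tendsto_intros LIMSEQ_inverse_real_of_nat)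
    moreover have "?I \<le> 4 * (W + H) * (?g + inverse (real (Suc n)))" for n
      by (rule le) simp
    ultimately show "?I \<le> 4 * (W + H) * ?g"
      using LIMSEQ_le_const by fastforce
  qed
qed

text \<open>The lower bound on \<open>v\<close> turns the singular factor into the power \<open>- \<theta> * \<gamma>\<close> of the distance \<open>d\<close>,
  which is split as the weight \<open>d powr (1 - \<theta> * \<gamma>)\<close> times the Hardy factor \<open>1 / d\<close>. As
  \<open>0 < \<gamma> < 1\<close>, the remaining constant \<open>c powr (- \<gamma>)\<close> is at most \<open>max 1 (1 / c)\<close> uniformly
  in the exponent.\<close>

lemma singular_term_le:
  fixes c d \<theta> \<gamma> h v :: real
  assumes "0 < c" "0 < d" "0 < \<gamma>" "\<gamma> < 1" "c * d powr \<theta> \<le> v"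
  shows "\<bar>h * v powr (- \<gamma>) * \<phi>\<bar> \<le> max 1 (1 / c) * (\<bar>h * d powr (1 - \<theta> * \<gamma>)\<bar> * (\<bar>\<phi>\<bar> / d))"
proof -
  have "v powr (- \<gamma>) \<le> (c * d powr \<theta>) powr (- \<gamma>)"
    using assms by (intro powr_mono2') auto
  also have "\<dots> = c powr (- \<gamma>) * d powr (- (\<theta> * \<gamma>))"
    using assms by (simp add: powr_mult powr_powr)
  also have "c powr (- \<gamma>) \<le> max 1 (1 / c)"
  proof (cases "1 \<le> c")
    case True
    then have "c powr (- \<gamma>) \<le> c powr 0" using assms by (intro powr_mono) auto
    then show ?thesis using True by simp
  next
    case False
    then have "c powr (- \<gamma>) \<le> c powr (- 1)" using assms by (intro powr_mono') auto
    then show ?thesis using assms by (simp add: powr_minus_divide)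
  qed
  also have "d powr (- (\<theta> * \<gamma>)) = d powr (1 - \<theta> * \<gamma>) / d"
    using assms by (simp add: powr_diff powr_minus_divide)
  finally have "v powr (- \<gamma>) \<le> max 1 (1 / c) * (d powr (1 - \<theta> * \<gamma>) / d)"
    using assms by (simp add: mult_right_mono)
  then have "\<bar>h\<bar> * \<bar>\<phi>\<bar> * v powr (- \<gamma>) \<le> \<bar>h\<bar> * \<bar>\<phi>\<bar> * (max 1 (1 / c) * (d powr (1 - \<theta> * \<gamma>) / d))"
    by (rule mult_left_mono) simp
  then show ?thesis
    by (simp add: abs_mult mult_ac)
qed

theorem lemma3p1:
  fixes \<Omega> :: "'a::euclidean_space set"
    and p h \<gamma> :: "'a \<Rightarrow> real"
    and \<epsilon> m \<mu> \<delta>\<^sub>0 c \<theta> :: real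
    and u :: "real \<Rightarrow> 'a \<Rightarrow> real"
  assumes "2 \<le> DIM('a)"
    and "bounded_lipschitz_domain \<Omega>"
    and "variable_exponent \<Omega> p" and "log_hoelder \<Omega> p"
    and "h \<in> Linfty \<Omega>" and "AE x in lebesgue_on \<Omega>. 0 \<le> h x"
    and "\<not> (AE x in lebesgue_on \<Omega>. h x = 0)"
    and "singular_exponent \<Omega> \<gamma>"
    and "0 < \<epsilon>" and "0 < m" and "0 \<le> \<mu>"
    and "\<And>\<delta>. \<delta> \<in> {0<..1} \<Longrightarrow>
           is_arg_min (I_reg \<Omega> p h \<gamma> \<epsilon> \<mu> \<delta>) (\<lambda>v. v \<in> mass_constraint \<Omega> p m) (u \<delta>)"
    and "\<delta>\<^sub>0 \<in> {0<..1}" and "0 < c" and "0 < \<theta>"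
    and "\<And>\<delta>. \<delta> \<in> {0<..\<delta>\<^sub>0} \<Longrightarrow> AE x in lebesgue_on \<Omega>. c * bdry_dist \<Omega> x powr \<theta> \<le> u \<delta> x"
    and "(\<lambda>x. h x * bdry_dist \<Omega> x powr (1 - \<theta> * \<gamma> x)) \<in> Lpx \<Omega> (conj_exponent p)"
  shows
    "(\<exists>C. \<forall>\<delta>\<in>{0<..\<delta>\<^sub>0}. \<forall>\<phi>\<in>W1px0 \<Omega> p.
        integrable (lebesgue_on \<Omega>) (\<lambda>x. h x * (u \<delta> x + \<delta>) powr (- \<gamma> x) * \<phi> x) \<and>
        \<bar>\<integral>x. h x * (u \<delta> x + \<delta>) powr (- \<gamma> x) * \<phi> x \<partial>lebesgue_on \<Omega>\<bar> \<le> C * grad_norm \<Omega> p \<phi>) \<and>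
     (\<forall>\<delta> w. decseq \<delta> \<and> (\<forall>n. \<delta> n \<in> {0<..1}) \<and> \<delta> \<longlonglongrightarrow> 0 \<and>
        (AE x in lebesgue_on \<Omega>. (\<lambda>n. u (\<delta> n) x) \<longlonglongrightarrow> w x) \<longrightarrow>
        (AE x in lebesgue_on \<Omega>.
           c * bdry_dist \<Omega> x powr \<theta> \<le> w x \<and> 0 < c * bdry_dist \<Omega> x powr \<theta>) \<and>
        (\<forall>\<phi>\<in>W1px0 \<Omega> p.
           integrable (lebesgue_on \<Omega>) (\<lambda>x. h x * w x powr (- \<gamma> x) * \<phi> x) \<and>
           (\<lambda>n. \<integral>x. h x * (u (\<delta> n) x + \<delta> n) powr (- \<gamma> x) * \<phi> x \<partial>lebesgue_on \<Omega>)
             \<longlonglongrightarrow> (\<integral>x. h x * w x powr (- \<gamma> x) * \<phi> x \<partial>lebesgue_on \<Omega>)))"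
proof -
  note dom = assms(2) and ve = assms(3) and lh = assms(4) and c = \<open>0 < c\<close>
  note lower = assms(16)
  have \<Omega>: "open \<Omega>" "bounded \<Omega>"
    using dom by (auto simp: bounded_lipschitz_domain_def)
  let ?M = "lebesgue_on \<Omega>"
  let ?d = "bdry_dist \<Omega>"
  let ?\<omega> = "\<lambda>x. h x * ?d x powr (1 - \<theta> * \<gamma> x)"
  define A where "A = max 1 (1 / c)"
  have A: "0 \<le> A" by (simp add: A_def)
  have space: "AE x in ?M. x \<in> \<Omega>" by (rule AE_I2) simp
  have \<gamma>: "0 < \<gamma> x" "\<gamma> x < 1" if "x \<in> \<Omega>" for x
  proof -
    obtain a b where ab: "0 < a" "b < 1" "\<forall>x\<in>closure \<Omega>. a \<le> \<gamma> x \<and> \<gamma> x \<le> b"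
      using assms(8) unfolding singular_exponent_def by blast
    have "x \<in> closure \<Omega>" using that closure_subset by blast
    with ab show "0 < \<gamma> x" "\<gamma> x < 1" by force+
  qed
  have "continuous_on (closure \<Omega>) \<gamma>"
    using assms(8) unfolding singular_exponent_def by (rule conjunct1)
  then have "continuous_on \<Omega> \<gamma>"
    by (rule continuous_on_subset) (rule closure_subset)
  then have \<gamma>m: "\<gamma> \<in> borel_measurable ?M"
    by (rule borel_measurable_lebesgue_on_continuous[OF \<Omega>(1)])
  have hm: "h \<in> borel_measurable ?M" using assms(5) by (simp add: Linfty_def)
  have um: "u \<delta> \<in> borel_measurable ?M" if "\<delta> \<in> {0<..1}" for \<delta>
    using assms(12)[OF that] by (simp add: is_arg_min_def mass_constraint_def W1px0_def W1px_def Lpx_def)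
  have \<phi>m: "\<phi> \<in> borel_measurable ?M" if "\<phi> \<in> W1px0 \<Omega> p" for \<phi>
    using that by (simp add: W1px0_def W1px_def Lpx_def)
  have tm: "(\<lambda>x. h x * v x powr (- \<gamma> x) * \<phi> x) \<in> borel_measurable ?M"
    if "v \<in> borel_measurable ?M" "\<phi> \<in> W1px0 \<Omega> p" for v \<phi>
    using that(1) \<phi>m[OF that(2)] hm \<gamma>m by measurable
  obtain C where C: "0 \<le> C"
    and int: "\<And>\<phi>. \<phi> \<in> W1px0 \<Omega> p \<Longrightarrow> integrable ?M (\<lambda>x. \<bar>?\<omega> x\<bar> * (\<bar>\<phi> x\<bar> / ?d x))"
    and le: "\<And>\<phi>. \<phi> \<in> W1px0 \<Omega> p \<Longrightarrow>
       (\<integral>x. \<bar>?\<omega> x\<bar> * (\<bar>\<phi> x\<bar> / ?d x) \<partial>?M) \<le> C * grad_norm \<Omega> p \<phi>"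
    using singular_weight_bound[OF dom ve lh assms(17)] by blast
  \<comment> \<open>One integrable function dominates all regularised terms as well as their limit.\<close>
  let ?D = "\<lambda>\<phi> x. A * (\<bar>?\<omega> x\<bar> * (\<bar>\<phi> x\<bar> / ?d x))"
  have intD: "integrable ?M (?D \<phi>)" if "\<phi> \<in> W1px0 \<Omega> p" for \<phi>
    using int[OF that] by (rule integrable_mult_right)
  have dominated: "AE x in ?M. norm (h x * v x powr (- \<gamma> x) * \<phi> x) \<le> ?D \<phi> x"
    if "AE x in ?M. c * ?d x powr \<theta> \<le> v x" for v \<phi>
    using that space
  proof eventually_elim
    case (elim x)
    show ?case
      unfolding A_def real_norm_def
      by (rule singular_term_le[OF c bdry_dist_pos[OF \<Omega> elim(2)] \<gamma>[OF elim(2)] elim(1)])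
  qed
  have lower\<delta>: "AE x in ?M. c * ?d x powr \<theta> \<le> u \<delta> x + \<delta>" if "\<delta> \<in> {0<..\<delta>\<^sub>0}" for \<delta>
    using lower[OF that] by eventually_elim (use that in auto)
  have u\<delta>m: "(\<lambda>x. u \<delta> x + \<delta>) \<in> borel_measurable ?M" if "\<delta> \<in> {0<..1}" for \<delta>
    using um[OF that] by measurable
  have sub: "\<delta> \<in> {0<..1}" if "\<delta> \<in> {0<..\<delta>\<^sub>0}" for \<delta> using that assms(13) by auto
  have bounded: "integrable ?M (\<lambda>x. h x * (u \<delta> x + \<delta>) powr (- \<gamma> x) * \<phi> x) \<and>
        \<bar>\<integral>x. h x * (u \<delta> x + \<delta>) powr (- \<gamma> x) * \<phi> x \<partial>?M\<bar> \<le> (A * C) * grad_norm \<Omega> p \<phi>"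
    if \<delta>: "\<delta> \<in> {0<..\<delta>\<^sub>0}" and \<phi>: "\<phi> \<in> W1px0 \<Omega> p" for \<delta> \<phi>
  proof
    let ?t = "\<lambda>x. h x * (u \<delta> x + \<delta>) powr (- \<gamma> x) * \<phi> x"
    note dom\<phi> = dominated[OF lower\<delta>[OF \<delta>], of \<phi>]
    show i: "integrable ?M ?t"
    proof (rule Bochner_Integration.integrable_bound[OF intD[OF \<phi>] tm[OF u\<delta>m[OF sub[OF \<delta>]] \<phi>]])
      show "AE x in ?M. norm (?t x) \<le> norm (?D \<phi> x)"
        using dom\<phi> by eventually_elim (simp only: real_norm_def order_trans[OF _ abs_ge_self])
    qed
    have "\<bar>\<integral>x. ?t x \<partial>?M\<bar> \<le> (\<integral>x. norm (?t x) \<partial>?M)"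
      using integral_norm_bound[of ?M ?t] by simp
    also have "\<dots> \<le> (\<integral>x. ?D \<phi> x \<partial>?M)"
      by (intro integral_mono_AE integrable_norm i intD[OF \<phi>] dom\<phi>)
    also have "\<dots> = A * (\<integral>x. \<bar>?\<omega> x\<bar> * (\<bar>\<phi> x\<bar> / ?d x) \<partial>?M)"
      by (rule integral_mult_right_zero)
    also have "\<dots> \<le> A * (C * grad_norm \<Omega> p \<phi>)"
      by (rule mult_left_mono[OF le[OF \<phi>] A])
    finally show "\<bar>\<integral>x. ?t x \<partial>?M\<bar> \<le> (A * C) * grad_norm \<Omega> p \<phi>" by (simp only: mult.assoc)
  qed
  have limit: "(AE x in ?M. c * ?d x powr \<theta> \<le> w x \<and> 0 < c * ?d x powr \<theta>) \<and>
      (\<forall>\<phi>\<in>W1px0 \<Omega> p. integrable ?M (\<lambda>x. h x * w x powr (- \<gamma> x) * \<phi> x) \<and>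
         (\<lambda>n. \<integral>x. h x * (u (\<delta> n) x + \<delta> n) powr (- \<gamma> x) * \<phi> x \<partial>?M)
           \<longlonglongrightarrow> (\<integral>x. h x * w x powr (- \<gamma> x) * \<phi> x \<partial>?M))"
    if \<delta>: "\<forall>n. \<delta> n \<in> {0<..1}" "\<delta> \<longlonglongrightarrow> 0" and conv: "AE x in ?M. (\<lambda>n. u (\<delta> n) x) \<longlonglongrightarrow> w x" for \<delta> w
  proof -
    have "eventually (\<lambda>n. \<delta> n < \<delta>\<^sub>0) sequentially"
      using \<delta>(2) assms(13) by (intro order_tendstoD(2)) auto
    then obtain N where N: "\<And>n. N \<le> n \<Longrightarrow> \<delta> n < \<delta>\<^sub>0"
      unfolding eventually_sequentially by blast
    \<comment> \<open>The lower bound holds only for parameters up to \<open>\<delta>\<^sub>0\<close>, so finitely many terms are dropped.\<close>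
    define \<eta> where "\<eta> n = \<delta> (n + N)" for n
    have \<eta>: "\<eta> n \<in> {0<..\<delta>\<^sub>0}" for n
      using N[of "n + N"] \<delta>(1) by (simp add: \<eta>_def less_imp_le)
    have \<eta>0: "\<eta> \<longlonglongrightarrow> 0" unfolding \<eta>_def by (rule LIMSEQ_ignore_initial_segment[OF \<delta>(2)])
    have conv': "AE x in ?M. (\<lambda>n. u (\<eta> n) x) \<longlonglongrightarrow> w x"
      using conv by eventually_elim (auto simp: \<eta>_def dest: LIMSEQ_ignore_initial_segment)
    have lower\<eta>: "AE x in ?M. \<forall>n. c * ?d x powr \<theta> \<le> u (\<eta> n) x"
      unfolding AE_all_countable using lower[OF \<eta>] by blast
    have lower_w: "AE x in ?M. c * ?d x powr \<theta> \<le> w x"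
      using conv' lower\<eta> by eventually_elim (blast intro: LIMSEQ_le_const)
    have pos: "AE x in ?M. 0 < c * ?d x powr \<theta>"
      using space
    proof eventually_elim
      case (elim x)
      then show ?case using bdry_dist_pos[OF \<Omega> elim] c by simp
    qed
    have wm: "w \<in> borel_measurable ?M"
    proof (rule borel_measurable_lebesgue_on_AE[OF \<Omega>(1)])
      show "(\<lambda>x. lim (\<lambda>n. u (\<eta> n) x)) \<in> borel_measurable ?M"
        by (intro borel_measurable_lim_metric um sub \<eta>)
      show "AE x in ?M. lim (\<lambda>n. u (\<eta> n) x) = w x"
        using conv' by eventually_elim (rule limI)
    qed
    have "integrable ?M (\<lambda>x. h x * w x powr (- \<gamma> x) * \<phi> x) \<and>
         (\<lambda>n. \<integral>x. h x * (u (\<delta> n) x + \<delta> n) powr (- \<gamma> x) * \<phi> x \<partial>?M)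
           \<longlonglongrightarrow> (\<integral>x. h x * w x powr (- \<gamma> x) * \<phi> x \<partial>?M)" if \<phi>: "\<phi> \<in> W1px0 \<Omega> p" for \<phi>
    proof
      have lim: "AE x in ?M. (\<lambda>n. h x * (u (\<eta> n) x + \<eta> n) powr (- \<gamma> x) * \<phi> x)
          \<longlonglongrightarrow> h x * w x powr (- \<gamma> x) * \<phi> x"
        using conv' lower_w pos
      proof eventually_elim
        case (elim x)
        have "(\<lambda>n. u (\<eta> n) x + \<eta> n) \<longlonglongrightarrow> w x + 0"
          by (intro tendsto_add elim(1) \<eta>0)
        moreover have "w x + 0 \<noteq> 0" using elim by linarith
        ultimately have "(\<lambda>n. (u (\<eta> n) x + \<eta> n) powr (- \<gamma> x)) \<longlonglongrightarrow> (w x + 0) powr (- \<gamma> x)"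
          by (intro tendsto_powr tendsto_const)
        then show ?case by (intro tendsto_mult tendsto_const) simp
      qed
      note dc = tm[OF wm \<phi>] tm[OF u\<delta>m[OF sub[OF \<eta>]] \<phi>] intD[OF \<phi>] lim dominated[OF lower\<delta>[OF \<eta>], of _ \<phi>]
      show "integrable ?M (\<lambda>x. h x * w x powr (- \<gamma> x) * \<phi> x)"
        by (rule integrable_dominated_convergence[OF dc])
      have "(\<lambda>n. \<integral>x. h x * (u (\<eta> n) x + \<eta> n) powr (- \<gamma> x) * \<phi> x \<partial>?M)
           \<longlonglongrightarrow> (\<integral>x. h x * w x powr (- \<gamma> x) * \<phi> x \<partial>?M)"
        by (rule integral_dominated_convergence[OF dc])
      then show "(\<lambda>n. \<integral>x. h x * (u (\<delta> n) x + \<delta> n) powr (- \<gamma> x) * \<phi> x \<partial>?M)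
           \<longlonglongrightarrow> (\<integral>x. h x * w x powr (- \<gamma> x) * \<phi> x \<partial>?M)"
        unfolding \<eta>_def by (rule LIMSEQ_offset)
    qed
    moreover have "AE x in ?M. c * ?d x powr \<theta> \<le> w x \<and> 0 < c * ?d x powr \<theta>"
      using lower_w pos by eventually_elim simp
    ultimately show ?thesis by blast
  qed
  show ?thesis
    using bounded limit by (intro conjI exI[of _ "A * C"] ballI allI impI) blast+
qed

end
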